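(* Let $I\subset\mathbb R$ be an open interval and consider a family of functions $Y_\eta,r_\eta$, $\eta\in I$ (see context), smooth in their inputs as well as in $\eta$, with bounded derivatives. Then for any positive integer $L$ there is $\varepsilon_0>0$ small enough such that when $0\le\varepsilon<\varepsilon_0$, for each $\eta\in I$ we can find $\omega_\eta$ and $W^0_\eta:\mathbb T\to\mathbb T\times\mathbb R$, with $W^0_\eta(\theta+1)=W^0_\eta(\theta)+(1,0)^T$, solving $$\omega_\eta \frac{d}{d\theta}W^0_\eta(\theta)-\begin{pmatrix}\omega_0\\ \lambda_0(W^0_\eta)_2(\theta)\end{pmatrix}=\varepsilon\,\overline Y_\eta\big(W^0_\eta(\theta),\,W^0_\eta(\theta-\omega_\eta\rho_\eta(W^0_\eta(\theta))),\,\varepsilon\big).$$ Furthermore, $(\eta,\theta)\mapsto W^0_\eta(\theta)$ is jointly $C^{L+Lip}$ in $\eta,\theta$.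
   Context: Setting. $\mathbb T=\mathbb R/\mathbb Z$, $\mathbb R_+=[0,\infty)$. A planar analytic ODE $\dot x=X_0(x)$ has a stable limit cycle. Fixed given data: $\omega_0>0$, $\lambda_0<0$ and an analytic local diffeomorphism $K:\mathbb T\times[-1,1]\to\mathbb R^2$ with $X_0(K(\theta,s))=DK(\theta,s)(\omega_0,\lambda_0 s)^T$; $\theta\mapsto K(\theta,0)$ parameterizes the limit cycle. For each $\eta\in I$, $r_\eta:\mathbb R^2\to[0,h]$ is a delay function and $Y_\eta:(\mathbb T\times[-1,1])^2\times\mathbb R_+\to\mathbb R^2$ is a perturbation term; it arises from an SDDE $\dot x(t)=X_0(x(t))+\varepsilon P_\eta(x(t),x(t-r_\eta(x(t))),\varepsilon)$ as $Y_\eta(u,v,\varepsilon)=(DK(u))^{-1}P_\eta(K(u),K(v),\varepsilon)$. Let $\phi:\mathbb R\to[0,1]$ be $C^\infty$ with $\phi(x)=1$ for $|x|\le\frac12$ and $\phi(x)=0$ for $|x|>1$. Put $\rho_\eta(\theta,s)=r_\eta(K(\theta,s))\phi(s)$ (zero for $|s|>1$), and $\overline Y_\eta(u,v,\varepsilon)=Y_\eta(u,v,\varepsilon)\phi(u_2)\phi(v_2)$ (zero if $|u_2|>1$ or $|v_2|>1$). Subscripts $1,2$ on $\mathbb R^2$-valued quantities denote components. The assumption is that $(\eta,\cdot)\mapsto Y_\eta(\cdot)$ and $(\eta,\cdot)\mapsto r_\eta(\cdot)$, hence also $\overline Y_\eta$ and $\rho_\eta$, are $C^\infty$ jointly in $\eta$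 and their inputs, bounded with all derivatives bounded (uniformly in $\eta\in I$). Maps into $\mathbb T\times\mathbb R$ are identified with their lifts. $C^{L+Lip}$: $L$ times continuously differentiable with bounded derivatives up to order $L$ (for the periodic part) and Lipschitz $L$-th derivative. *)

theory Defs
  imports "HOL-Analysis.Analysis"
begin

text \<open>
  The circle \<open>\<real>/\<int>\<close> is handled through lifts: a function on it is a 1-periodic function
  of a real variable, and a degree-one map of it into circle times line is a function \<open>w\<close> on the
  reals with \<open>w (\<theta> + 1) = w \<theta> + (1, 0)\<close>.
\<close>

abbreviation strip :: "(real \<times> real) set"
  where "strip \<equiv> UNIV \<times> {-1..1}"

text \<open>
  Real analyticity: locally the sum of a convergent double power series
  (\<open>has_sum\<close> is unordered, hence absolute, summation).
\<close>

definition real_analytic_on :: "(real \<times> real \<Rightarrow> real \<times> real) \<Rightarrow> (real \<times> real) set \<Rightarrow> bool"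
  where "real_analytic_on f U \<longleftrightarrow>
    (\<forall>p\<in>U. \<exists>a :: nat \<times> nat \<Rightarrow> real \<times> real. \<exists>\<delta>>0. \<forall>x\<in>U.
      \<bar>fst x - fst p\<bar> < \<delta> \<and> \<bar>snd x - snd p\<bar> < \<delta> \<longrightarrow>
      ((\<lambda>(i, j). ((fst x - fst p) ^ i * (snd x - snd p) ^ j) *\<^sub>R a (i, j)) has_sum f x) UNIV)"

text \<open>
  Since the strip has boundary points, being an analytic local diffeomorphism on it means to agree,
  near each of its points, with an analytic diffeomorphism between open subsets of the plane.
\<close>

definition analytic_local_diffeo_on :: "(real \<times> real \<Rightarrow> real \<times> real) \<Rightarrow> (real \<times> real) set \<Rightarrow> bool"
  where "analytic_local_diffeo_on K A \<longleftrightarrow>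
    (\<forall>p\<in>A. \<exists>U V f g. open U \<and> open V \<and> p \<in> U \<and> (\<forall>x\<in>U \<inter> A. f x = K x) \<and>
      homeomorphism U V f g \<and> real_analytic_on f U \<and> real_analytic_on g V)"

text \<open>
  The data \<open>\<omega>0, lam0, K\<close> attached to a planar analytic vector field \<open>X0\<close>.
  The conditions make \<open>K (\<omega>0 * t, 0)\<close> a nonconstant periodic solution of the ODE, and, as
  \<open>K (\<theta> + \<omega>0 * t, s * exp (lam0 * t))\<close> solves it for \<open>t \<ge> 0\<close> and \<open>lam0 < 0\<close>, an attracting one: the
  stable limit cycle is the range of \<open>\<lambda>\<theta>. K (\<theta>, 0)\<close>. The derivative \<open>D\<close> is unique because
  the strip is convex with nonempty interior.
\<close>

definition limit_cycle_data ::
    "(real \<times> real \<Rightarrow> real \<times> real) \<Rightarrow> real \<Rightarrow> real \<Rightarrow> (real \<times> real \<Rightarrow> real \<times> real) \<Rightarrow> bool"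
  where "limit_cycle_data X0 \<omega>0 lam0 K \<longleftrightarrow>
    real_analytic_on X0 UNIV \<and> \<omega>0 > 0 \<and> lam0 < 0 \<and>
    (\<forall>\<theta>. \<forall>s\<in>{-1..1}. K (\<theta> + 1, s) = K (\<theta>, s)) \<and>
    analytic_local_diffeo_on K strip \<and>
    (\<forall>\<theta>. \<forall>s\<in>{-1..1}. \<exists>D. (K has_derivative D) (at (\<theta>, s) within strip) \<and>
        X0 (K (\<theta>, s)) = D (\<omega>0, lam0 * s))"

text \<open>
  Differentiability classes on a set \<open>S\<close>, by recursion on the order: the components \<open>D b\<close> of the
  Frechet derivative (the partial derivatives) must be of the class one order lower. All
  derivatives are relative to \<open>S\<close>; they are unique when \<open>S\<close> is convex with nonempty interior, which
  is the only case used. The first predicate is the class \<open>C\<^sup>k\<close> with bounded derivatives of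
  orders 0 to \<open>k\<close>; the second demands in addition that the derivatives of order \<open>k\<close> are Lipschitz.
\<close>

primrec Cb_on :: "nat \<Rightarrow> ('a::euclidean_space \<Rightarrow> 'b::real_normed_vector) \<Rightarrow> 'a set \<Rightarrow> bool"
  where
    "Cb_on 0 f S \<longleftrightarrow> bounded (f ` S) \<and> continuous_on S f"
  | "Cb_on (Suc k) f S \<longleftrightarrow> bounded (f ` S) \<and>
      (\<exists>D. (\<forall>x\<in>S. (f has_derivative (\<lambda>h. \<Sum>b\<in>Basis. (h \<bullet> b) *\<^sub>R D b x)) (at x within S)) \<and>
           (\<forall>b\<in>Basis. Cb_on k (D b) S))"

primrec CLip_on :: "nat \<Rightarrow> ('a::euclidean_space \<Rightarrow> 'b::real_normed_vector) \<Rightarrow> 'a set \<Rightarrow> bool"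
  where
    "CLip_on 0 f S \<longleftrightarrow> bounded (f ` S) \<and> (\<exists>C. C-lipschitz_on S f)"
  | "CLip_on (Suc k) f S \<longleftrightarrow> bounded (f ` S) \<and>
      (\<exists>D. (\<forall>x\<in>S. (f has_derivative (\<lambda>h. \<Sum>b\<in>Basis. (h \<bullet> b) *\<^sub>R D b x)) (at x within S)) \<and>
           (\<forall>b\<in>Basis. CLip_on k (D b) S))"

definition smooth_bounded_on :: "('a::euclidean_space \<Rightarrow> 'b::real_normed_vector) \<Rightarrow> 'a set \<Rightarrow> bool"
  where "smooth_bounded_on f S \<longleftrightarrow> (\<forall>k. Cb_on k f S)"

definition cutoff :: "(real \<Rightarrow> real) \<Rightarrow> bool"
  where "cutoff \<phi> \<longleftrightarrow>
    (\<forall>k x. (deriv ^^ k) \<phi> differentiable at x) \<and> (\<forall>x. 0 \<le> \<phi> x \<and> \<phi> x \<le> 1) \<and>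
    (\<forall>x. \<bar>x\<bar> \<le> 1/2 \<longrightarrow> \<phi> x = 1) \<and> (\<forall>x. \<bar>x\<bar> > 1 \<longrightarrow> \<phi> x = 0)"

text \<open>
  The extended delay and perturbation. As \<open>\<phi>\<close> vanishes outside \<open>[-1, 1]\<close>, the products are zero
  off the strip, whatever values \<open>K\<close> and \<open>Y\<close> take there.
\<close>

definition rho_ext ::
    "(real \<Rightarrow> real) \<Rightarrow> (real \<times> real \<Rightarrow> real \<times> real) \<Rightarrow> (real \<times> real \<Rightarrow> real) \<Rightarrow> real \<times> real \<Rightarrow> real"
  where "rho_ext \<phi> K r u = r (K u) * \<phi> (snd u)"

definition Y_ext ::
    "(real \<Rightarrow> real) \<Rightarrow> (real \<times> real \<Rightarrow> real \<times> real \<Rightarrow> real \<Rightarrow> real \<times> real) \<Rightarrow>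
     real \<times> real \<Rightarrow> real \<times> real \<Rightarrow> real \<Rightarrow> real \<times> real"
  where "Y_ext \<phi> Y u v \<epsilon> = (\<phi> (snd u) * \<phi> (snd v)) *\<^sub>R Y u v \<epsilon>"

end

theory Submission
  imports Defs
begin

text \<open>
  Write \<open>W(\<theta>) = (\<theta> + u(\<theta>), s(\<theta>))\<close> and take the right-hand side \<open>f\<close> of the equation, as a function of
  \<open>(\<eta>, \<theta>)\<close>, as the unknown. For periodic \<open>f\<close> the linear equations for \<open>u\<close> and \<open>s\<close> have periodic
  solutions given by integrals of \<open>f\<close> over one period, with \<open>\<omega> = \<omega>0 + (mean of f\<^sub>1)\<close>; so one has to
  solve \<open>f = \<epsilon> R(f)\<close>, where \<open>R\<close> inserts \<open>W\<close> into \<open>Y\<close>. All operations involved preserve the class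
  \<open>C\<^sup>k\<close> plus Lipschitz, with bounds depending only on the bounds of the inputs. Hence for small \<open>\<epsilon>\<close> the map
  \<open>f \<mapsto> \<epsilon> R(f)\<close> leaves a ball of this class invariant; it contracts the sup norm, and the ball is
  closed under pointwise limits. As \<open>\<bar>s\<bar> \<le> 1/2\<close> throughout, the cutoff always equals 1.
\<close>

section \<open>Uniform families of functions with bounded Lipschitz derivatives\<close>

text \<open>The obstacle is the state-dependent delay: the unknown is composed with a function of
  itself, so contracting in a norm with all derivatives would need one derivative more than the
  class has. Derivatives are therefore only kept bounded, and distances are measured in the sup
  norm, where comparing two delayed times costs one Lipschitz constant. Regularity of the limit must
  then come from uniform bounds alone, hence a notion of derivative that passes to pointwise limits.
  Taking the forcing as unknown puts the factor \<open>\<epsilon>\<close> in front of everything to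
  be estimated, so no smallness is required of the linear solution operator. It also makes the
  frequency a functional of the unknown: the mean is the obstruction to a periodic phase, and the
  freedom of translating a solution in time is removed by a kernel of mean zero. With
  \<open>\<eta>\<close> as a coordinate beside \<open>\<theta>\<close>, joint regularity needs no
  argument of its own. Amplitudes at most 1/2 also keep the argument of \<open>K\<close> off the
  edge of the strip, where periodicity and compactness make the bounds on the analytic
  \<open>K\<close> uniform.\<close>

text \<open>
  The derivative enters through a quadratic remainder estimate, which survives pointwise limits. The
  function itself may be unbounded, as for lifts of maps into the circle; its partial derivatives \<open>D b\<close> may not.
\<close>

primrec lipC :: "nat \<Rightarrow> real \<Rightarrow> 'a::euclidean_space set \<Rightarrow> ('a \<Rightarrow> 'b::real_normed_vector) \<Rightarrow> bool"
  where
    "lipC 0 M S f \<longleftrightarrow> (\<forall>x\<in>S. \<forall>y\<in>S. norm (f y - f x) \<le> M * norm (y - x))"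
  | "lipC (Suc k) M S f \<longleftrightarrow> (\<forall>x\<in>S. \<forall>y\<in>S. norm (f y - f x) \<le> M * norm (y - x)) \<and>
      (\<exists>D. (\<forall>x\<in>S. \<forall>y\<in>S. norm (f y - f x - (\<Sum>b\<in>Basis. ((y - x) \<bullet> b) *\<^sub>R D b x))
               \<le> M * (norm (y - x))\<^sup>2) \<and>
           (\<forall>b\<in>Basis. (\<forall>x\<in>S. norm (D b x) \<le> M) \<and> lipC k M S (D b)))"

definition ubd :: "'i set \<Rightarrow> ('i \<Rightarrow> 'a set) \<Rightarrow> ('i \<Rightarrow> 'a \<Rightarrow> 'b::real_normed_vector) \<Rightarrow> bool"
  where "ubd J S f \<longleftrightarrow> (\<exists>M. \<forall>i\<in>J. \<forall>x\<in>S i. norm (f i x) \<le> M)"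

text \<open>
  Families with a common bound: stating closure properties for families (indexed by arbitrary \<open>J\<close>, with
  domains \<open>S i\<close>) makes all constants uniform without ever computing them.
\<close>

definition ulipC ::
    "nat \<Rightarrow> 'i set \<Rightarrow> ('i \<Rightarrow> 'a::euclidean_space set) \<Rightarrow> ('i \<Rightarrow> 'a \<Rightarrow> 'b::real_normed_vector) \<Rightarrow> bool"
  where "ulipC k J S f \<longleftrightarrow> (\<exists>M. \<forall>i\<in>J. lipC k M (S i) (f i))"

text \<open>The direction is the first argument of \<open>D\<close>, so that each \<open>D b\<close>
  is itself a family to which \<open>ubd\<close> and \<open>ulipC\<close> apply.\<close>

definition utaylor ::
    "'i set \<Rightarrow> ('i \<Rightarrow> 'a::euclidean_space set) \<Rightarrow> ('i \<Rightarrow> 'a \<Rightarrow> 'b::real_normed_vector) \<Rightarrow> ('a \<Rightarrow> 'i \<Rightarrow> 'a \<Rightarrow> 'b) \<Rightarrow> bool"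
  where "utaylor J S f D \<longleftrightarrow> (\<exists>M. \<forall>i\<in>J. \<forall>x\<in>S i. \<forall>y\<in>S i.
    norm (f i y - f i x - (\<Sum>b\<in>Basis. ((y - x) \<bullet> b) *\<^sub>R D b i x)) \<le> M * (norm (y - x))\<^sup>2)"

lemma utaylorI:
  assumes "\<And>i x y. i \<in> J \<Longrightarrow> x \<in> S i \<Longrightarrow> y \<in> S i \<Longrightarrow>
      norm (f i y - f i x - (\<Sum>b\<in>Basis. ((y - x) \<bullet> b) *\<^sub>R D b i x)) \<le> M * (norm (y - x))\<^sup>2"
  shows "utaylor J S f D"
  unfolding utaylor_def by (rule exI[of _ M]) (intro ballI assms)

lemma utaylorE:
  assumes "utaylor J S f D"
  obtains M where "M \<ge> 0" "\<And>i x y. i \<in> J \<Longrightarrow> x \<in> S i \<Longrightarrow> y \<in> S i \<Longrightarrow>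
      norm (f i y - f i x - (\<Sum>b\<in>Basis. ((y - x) \<bullet> b) *\<^sub>R D b i x)) \<le> M * (norm (y - x))\<^sup>2"
proof -
  obtain M where M: "\<forall>i\<in>J. \<forall>x\<in>S i. \<forall>y\<in>S i.
    norm (f i y - f i x - (\<Sum>b\<in>Basis. ((y - x) \<bullet> b) *\<^sub>R D b i x)) \<le> M * (norm (y - x))\<^sup>2"
    using assms unfolding utaylor_def by (rule exE)
  show thesis
  proof (rule that[of "max M 0"])
    fix i x y assume *: "i \<in> J" "x \<in> S i" "y \<in> S i"
    show "norm (f i y - f i x - (\<Sum>b\<in>Basis. ((y - x) \<bullet> b) *\<^sub>R D b i x)) \<le> max M 0 * (norm (y - x))\<^sup>2"
      by (rule order_trans[OF M[rule_format, OF *] mult_right_mono]) auto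
  qed simp
qed

lemma lipC_lip: "lipC k M S f \<Longrightarrow> lipC 0 M S f"
  by (cases k) simp_all

lemma lipC_mono:
  assumes "lipC k M S f" "M \<le> M'"
  shows "lipC k M' S f"
  using assms(1)
proof (induction k arbitrary: f)
  have lip: "lipC 0 M' S f" if f: "lipC 0 M S f" for f :: "'a \<Rightarrow> 'b"
    unfolding lipC.simps
  proof (intro ballI)
    fix x y assume "x \<in> S" "y \<in> S"
    then have "norm (f y - f x) \<le> M * norm (y - x)" using f by simp
    also have "\<dots> \<le> M' * norm (y - x)" by (rule mult_right_mono[OF assms(2)]) simp
    finally show "norm (f y - f x) \<le> M' * norm (y - x)" .
  qed
  {
    case 0
    then show ?case by (rule lip)
  next
    case (Suc k)
    then obtain D where D: "\<forall>x\<in>S. \<forall>y\<in>S. norm (f y - f x - (\<Sum>b\<in>Basis. ((y - x) \<bullet> b) *\<^sub>R D b x))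
                 \<le> M * (norm (y - x))\<^sup>2"
        "\<forall>b\<in>Basis. (\<forall>x\<in>S. norm (D b x) \<le> M) \<and> lipC k M S (D b)"
      by auto
    have "norm (f y - f x - (\<Sum>b\<in>Basis. ((y - x) \<bullet> b) *\<^sub>R D b x)) \<le> M' * (norm (y - x))\<^sup>2"
      if "x \<in> S" "y \<in> S" for x y
      by (rule order_trans[OF D(1)[rule_format, OF that] mult_right_mono[OF assms(2)]]) simp
    moreover have "norm (D b x) \<le> M'" if "b \<in> Basis" "x \<in> S" for b x
      using D(2) that assms(2) by (meson order_trans)
    moreover have "lipC k M' S (D b)" if "b \<in> Basis" for b
      using D(2) that Suc.IH by blast
    ultimately show ?case using lip[OF lipC_lip[OF Suc.prems]] unfolding lipC.simps by blast
  }
qed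

lemma ubdI: "(\<And>i x. i \<in> J \<Longrightarrow> x \<in> S i \<Longrightarrow> norm (f i x) \<le> M) \<Longrightarrow> ubd J S f"
  unfolding ubd_def by blast

lemma ubdE:
  assumes "ubd J S f"
  obtains M where "M \<ge> 0" "\<And>i x. i \<in> J \<Longrightarrow> x \<in> S i \<Longrightarrow> norm (f i x) \<le> M"
proof -
  obtain M where "\<forall>i\<in>J. \<forall>x\<in>S i. norm (f i x) \<le> M" using assms unfolding ubd_def by blast
  then show thesis by (intro that[of "max M 0"]) (auto simp: le_max_iff_disj)
qed

lemma ulipC_0E:
  assumes "ulipC 0 J S f"
  obtains M where "M \<ge> 0"
    "\<And>i x y. i \<in> J \<Longrightarrow> x \<in> S i \<Longrightarrow> y \<in> S i \<Longrightarrow> norm (f i y - f i x) \<le> M * norm (y - x)"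
proof -
  obtain M where M: "\<forall>i\<in>J. lipC 0 M (S i) (f i)" using assms unfolding ulipC_def by blast
  have "\<forall>i\<in>J. lipC 0 (max M 0) (S i) (f i)" using M lipC_mono[of 0 M _ _ "max M 0"] max.cobounded1 by blast
  then show thesis by (intro that[of "max M 0"]) (auto simp del: max.bounded_iff)
qed

lemma ulipC_0I:
  "(\<And>i x y. i \<in> J \<Longrightarrow> x \<in> S i \<Longrightarrow> y \<in> S i \<Longrightarrow> norm (f i y - f i x) \<le> M * norm (y - x)) \<Longrightarrow> ulipC 0 J S f"
  unfolding ulipC_def by auto

lemma ulipC_imp_0: "ulipC k J S f \<Longrightarrow> ulipC 0 J S f"
  unfolding ulipC_def using lipC_lip by blast

text \<open>Each member of the family comes with its own partial derivatives; choice over the index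
  set collects them into families that share the bound \<open>M\<close>.\<close>

lemma ulipC_SucE:
  assumes "ulipC (Suc k) J S f"
  obtains D where "utaylor J S f D"
    "\<And>b. b \<in> Basis \<Longrightarrow> ubd J S (D b)" "\<And>b. b \<in> Basis \<Longrightarrow> ulipC k J S (D b)"
proof -
  obtain M where "\<forall>i\<in>J. lipC (Suc k) M (S i) (f i)" using assms unfolding ulipC_def by blast
  then have "\<forall>i\<in>J. \<exists>D. (\<forall>x\<in>S i. \<forall>y\<in>S i. norm (f i y - f i x - (\<Sum>b\<in>Basis. ((y - x) \<bullet> b) *\<^sub>R D b x))
               \<le> M * (norm (y - x))\<^sup>2) \<and>
           (\<forall>b\<in>Basis. (\<forall>x\<in>S i. norm (D b x) \<le> M) \<and> lipC k M (S i) (D b))"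
    by simp
  from bchoice[OF this] obtain D where D: "\<forall>i\<in>J. (\<forall>x\<in>S i. \<forall>y\<in>S i. norm (f i y - f i x - (\<Sum>b\<in>Basis. ((y - x) \<bullet> b) *\<^sub>R D i b x))
               \<le> M * (norm (y - x))\<^sup>2) \<and>
           (\<forall>b\<in>Basis. (\<forall>x\<in>S i. norm (D i b x) \<le> M) \<and> lipC k M (S i) (D i b))"
    by (rule exE)
  show thesis
  proof (rule that[of "\<lambda>b i. D i b"])
    show "utaylor J S f (\<lambda>b i. D i b)"
      by (rule utaylorI[of _ _ _ _ M]) (rule D[rule_format, THEN conjunct1, rule_format])
    show "ubd J S (\<lambda>i. D i b)" if "b \<in> Basis" for b
      by (rule ubdI[of _ _ _ M]) (use D that in blast)
    show "ulipC k J S (\<lambda>i. D i b)" if "b \<in> Basis" for b unfolding ulipC_def using D that by blast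
  qed
qed

lemma ulipC_SucI:
  assumes "ulipC 0 J S f" and "utaylor J S f D"
    and "\<And>b. b \<in> Basis \<Longrightarrow> ubd J S (D b)" and "\<And>b. b \<in> Basis \<Longrightarrow> ulipC k J S (D b)"
  shows "ulipC (Suc k) J S f"
proof -
  obtain M0 where M0: "\<forall>i\<in>J. lipC 0 M0 (S i) (f i)" using assms(1) unfolding ulipC_def by blast
  obtain M where "M \<ge> 0" and M: "\<And>i x y. i \<in> J \<Longrightarrow> x \<in> S i \<Longrightarrow> y \<in> S i \<Longrightarrow>
      norm (f i y - f i x - (\<Sum>b\<in>Basis. ((y - x) \<bullet> b) *\<^sub>R D b i x)) \<le> M * (norm (y - x))\<^sup>2"
    by (rule utaylorE[OF assms(2)]) (rule that)
  have "\<forall>b\<in>Basis. \<exists>M. \<forall>i\<in>J. \<forall>x\<in>S i. norm (D b i x) \<le> M" using assms(3) unfolding ubd_def by blast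
  from bchoice[OF this] obtain M1 where M1: "\<forall>b\<in>Basis. \<forall>i\<in>J. \<forall>x\<in>S i. norm (D b i x) \<le> M1 b" by blast
  have "\<forall>b\<in>Basis. \<exists>M. \<forall>i\<in>J. lipC k M (S i) (D b i)" using assms(4) unfolding ulipC_def by blast
  from bchoice[OF this] obtain M2 where M2: "\<forall>b\<in>Basis. \<forall>i\<in>J. lipC k (M2 b) (S i) (D b i)" by blast
  \<comment> \<open>One constant has to serve all parts of \<open>lipC\<close>; it exists because
    there are finitely many directions.\<close>
  define N where "N = Max (insert M0 (insert M (M1 ` Basis \<union> M2 ` Basis)))"
  have N: "M0 \<le> N" "M \<le> N" "\<And>b. b \<in> Basis \<Longrightarrow> M1 b \<le> N" "\<And>b. b \<in> Basis \<Longrightarrow> M2 b \<le> N"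
    unfolding N_def by (rule Max_ge; simp)+
  have "lipC (Suc k) N (S i) (f i)" if i: "i \<in> J" for i
    unfolding lipC.simps(2)
  proof (intro conjI exI[of _ "\<lambda>b. D b i"] ballI)
    fix x y assume xy: "x \<in> S i" "y \<in> S i"
    have "lipC 0 N (S i) (f i)" using M0 i lipC_mono N(1) by blast
    then show "norm (f i y - f i x) \<le> N * norm (y - x)" using xy by simp
    show "norm (f i y - f i x - (\<Sum>b\<in>Basis. ((y - x) \<bullet> b) *\<^sub>R D b i x)) \<le> N * (norm (y - x))\<^sup>2"
      by (rule order_trans[OF M[OF i xy] mult_right_mono[OF N(2)]]) simp
  next
    fix b :: 'b and x assume b: "b \<in> Basis" "x \<in> S i"
    show "norm (D b i x) \<le> N" using M1 N(3)[of b] i b by (blast intro: order_trans)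
  next
    fix b :: 'b assume b: "b \<in> Basis"
    show "lipC k N (S i) (D b i)" using M2 N(4)[of b] i b by (blast intro: lipC_mono)
  qed
  then show ?thesis unfolding ulipC_def by blast
qed

text \<open>The product and chain rules pair a derivative of order \<open>k\<close> with the
  function itself, known to order \<open>Suc k\<close>; this brings both to the same order.\<close>

lemma ulipC_SucD: "ulipC (Suc k) J S f \<Longrightarrow> ulipC k J S f"
proof (induction k arbitrary: f)
  case 0
  then show ?case by (rule ulipC_imp_0)
next
  case (Suc k)
  obtain D where D: "utaylor J S f D"
      "\<And>b. b \<in> Basis \<Longrightarrow> ubd J S (D b)" "\<And>b. b \<in> Basis \<Longrightarrow> ulipC (Suc k) J S (D b)"
      by (rule ulipC_SucE[OF Suc.prems]) (rule that)
  show ?case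
    by (rule ulipC_SucI[OF ulipC_imp_0[OF Suc.prems] D(1)]) (use D Suc.IH in blast)+
qed

section \<open>Closure under change of index and domain, linear maps, sums, products and
  composition\<close>

lemma ulipC_reindex:
  assumes "ulipC k J S f" and g: "\<And>i. i \<in> J' \<Longrightarrow> g i \<in> J" and S': "\<And>i. i \<in> J' \<Longrightarrow> S' i \<subseteq> S (g i)"
    and "\<And>i x. i \<in> J' \<Longrightarrow> x \<in> S' i \<Longrightarrow> f' i x = f (g i) x"
  shows "ulipC k J' S' f'"
  using assms(1,4)
proof (induction k arbitrary: f f')
  have lip: "ulipC 0 J' S' f'"
    if f: "ulipC 0 J S f" "\<And>i x. i \<in> J' \<Longrightarrow> x \<in> S' i \<Longrightarrow> f' i x = f (g i) x" for f f'
  proof -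
    obtain M where M: "M \<ge> 0" "\<And>i x y. i \<in> J \<Longrightarrow> x \<in> S i \<Longrightarrow> y \<in> S i \<Longrightarrow> norm (f i y - f i x) \<le> M * norm (y - x)"
      by (rule ulipC_0E[OF f(1)]) (rule that)
    show ?thesis
    proof (rule ulipC_0I)
      fix i x y assume *: "i \<in> J'" "x \<in> S' i" "y \<in> S' i"
      show "norm (f' i y - f' i x) \<le> M * norm (y - x)"
        unfolding f(2)[OF *(1,2)] f(2)[OF *(1,3)] by (rule M(2)) (use * g S' in auto)
    qed
  qed
  {
    case 0
    then show ?case by (rule lip)
  next
    case (Suc k)
    obtain D where D: "utaylor J S f D"
        "\<And>b. b \<in> Basis \<Longrightarrow> ubd J S (D b)" "\<And>b. b \<in> Basis \<Longrightarrow> ulipC k J S (D b)"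
      by (rule ulipC_SucE[OF Suc.prems(1)]) (rule that)
    obtain M where Dq: "M \<ge> 0" "\<And>i x y. i \<in> J \<Longrightarrow> x \<in> S i \<Longrightarrow> y \<in> S i \<Longrightarrow>
        norm (f i y - f i x - (\<Sum>b\<in>Basis. ((y - x) \<bullet> b) *\<^sub>R D b i x)) \<le> M * (norm (y - x))\<^sup>2"
      by (rule utaylorE[OF D(1)]) (rule that)
    show ?case
    proof (rule ulipC_SucI[where D = "\<lambda>b i. D b (g i)", OF _ utaylorI[where M = M]])
      show "ulipC 0 J' S' f'" by (rule lip[OF ulipC_imp_0[OF Suc.prems(1)] Suc.prems(2)])
      show "ubd J' S' (\<lambda>i. D b (g i))" if b: "b \<in> Basis" for b
      proof -
        obtain A where A: "A \<ge> 0" "\<And>i x. i \<in> J \<Longrightarrow> x \<in> S i \<Longrightarrow> norm (D b i x) \<le> A"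
          by (rule ubdE[OF D(2)[OF b]]) (rule that)
        show ?thesis by (rule ubdI[of _ _ _ A], rule A(2)) (use g S' in auto)
      qed
      show "ulipC k J' S' (\<lambda>i. D b (g i))" if "b \<in> Basis" for b
        by (rule Suc.IH[OF D(3)[OF that]]) simp
      fix i x y assume *: "i \<in> J'" "x \<in> S' i" "y \<in> S' i"
      show "norm (f' i y - f' i x - (\<Sum>b\<in>Basis. ((y - x) \<bullet> b) *\<^sub>R D b (g i) x)) \<le> M * (norm (y - x))\<^sup>2"
        unfolding Suc.prems(2)[OF *(1,2)] Suc.prems(2)[OF *(1,3)] by (rule Dq(2)) (use * g S' in auto)
    qed
  }
qed

lemma ubd_reindex:
  assumes "ubd J S f" and "\<And>i. i \<in> J' \<Longrightarrow> g i \<in> J" and "\<And>i. i \<in> J' \<Longrightarrow> S' i \<subseteq> S (g i)"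
    and "\<And>i x. i \<in> J' \<Longrightarrow> x \<in> S' i \<Longrightarrow> f' i x = f (g i) x"
  shows "ubd J' S' f'"
  using assms unfolding ubd_def by (metis subsetD)

text \<open>The constants \<open>c i\<close> need no common bound, since \<open>ulipC\<close>
  measures only increments and derivatives. Translations and unbounded parameters can thus occur in
  a uniform family.\<close>

lemma ulipC_const: "ulipC k J S (\<lambda>i x. c i)"
proof (induction k arbitrary: c)
  case 0
  then show ?case by (intro ulipC_0I[of _ _ _ 0]) simp
next
  case (Suc k)
  show ?case
    by (rule ulipC_SucI[where D = "\<lambda>b i x. 0", OF _ utaylorI[where M = 0]])
      (auto intro: ulipC_0I[of _ _ _ 0] ubdI[of _ _ _ 0] Suc)
qed

lemma ubd_linear:
  assumes "ubd J S f" "bounded_linear A"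
  shows "ubd J S (\<lambda>i x. A (f i x))"
proof -
  interpret A: bounded_linear A by fact
  obtain C where C: "C \<ge> 0" "\<And>x. norm (A x) \<le> norm x * C" using A.nonneg_bounded by blast
  obtain M where M: "\<And>i x. i \<in> J \<Longrightarrow> x \<in> S i \<Longrightarrow> norm (f i x) \<le> M" using ubdE[OF assms(1)] by blast
  show ?thesis
    by (rule ubdI[of _ _ _ "M * C"]) (meson C M mult_right_mono order_trans)
qed

lemma ulipC_linear:
  assumes "ulipC k J S f" "bounded_linear A"
  shows "ulipC k J S (\<lambda>i x. A (f i x))"
  using assms(1)
proof (induction k arbitrary: f)
  interpret A: bounded_linear A by fact
  obtain C where C: "C \<ge> 0" "\<And>x. norm (A x) \<le> norm x * C" using A.nonneg_bounded by blast
  have lip: "ulipC 0 J S (\<lambda>i x. A (f i x))" if "ulipC 0 J S f" for f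
  proof -
    obtain M where M: "M \<ge> 0" "\<And>i x y. i \<in> J \<Longrightarrow> x \<in> S i \<Longrightarrow> y \<in> S i \<Longrightarrow> norm (f i y - f i x) \<le> M * norm (y - x)"
      using ulipC_0E[OF \<open>ulipC 0 J S f\<close>] by blast
    show ?thesis
    proof (rule ulipC_0I[of _ _ _ "M * C"])
      fix i x y assume *: "i \<in> J" "x \<in> S i" "y \<in> S i"
      have "norm (A (f i y) - A (f i x)) \<le> norm (f i y - f i x) * C" using C(2)[of "f i y - f i x"] by (simp add: A.diff)
      also have "\<dots> \<le> (M * norm (y - x)) * C" by (rule mult_right_mono[OF M(2)[OF *] C(1)])
      finally show "norm (A (f i y) - A (f i x)) \<le> M * C * norm (y - x)" by (simp add: ac_simps)
    qed
  qed
  {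
    case 0
    then show ?case by (rule lip)
  next
    case (Suc k)
    obtain D where D: "utaylor J S f D"
      "\<And>b. b \<in> Basis \<Longrightarrow> ubd J S (D b)" "\<And>b. b \<in> Basis \<Longrightarrow> ulipC k J S (D b)"
      by (rule ulipC_SucE[OF Suc.prems]) (rule that)
    obtain M where Dq: "M \<ge> 0" "\<And>i x y. i \<in> J \<Longrightarrow> x \<in> S i \<Longrightarrow> y \<in> S i \<Longrightarrow>
        norm (f i y - f i x - (\<Sum>b\<in>Basis. ((y - x) \<bullet> b) *\<^sub>R D b i x)) \<le> M * (norm (y - x))\<^sup>2"
      by (rule utaylorE[OF D(1)]) (rule that)
    show ?case
    proof (rule ulipC_SucI[where D = "\<lambda>b i x. A (D b i x)", OF _ utaylorI[where M = "M * C"]])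
      show "ulipC 0 J S (\<lambda>i x. A (f i x))" by (rule lip[OF ulipC_imp_0[OF Suc.prems]])
      show "ubd J S (\<lambda>i x. A (D b i x))" if "b \<in> Basis" for b by (rule ubd_linear[OF D(2)[OF that] assms(2)])
      show "ulipC k J S (\<lambda>i x. A (D b i x))" if "b \<in> Basis" for b by (rule Suc.IH[OF D(3)[OF that]])
      fix i x y assume *: "i \<in> J" "x \<in> S i" "y \<in> S i"
      have "norm (A (f i y) - A (f i x) - (\<Sum>b\<in>Basis. ((y - x) \<bullet> b) *\<^sub>R A (D b i x)))
          = norm (A (f i y - f i x - (\<Sum>b\<in>Basis. ((y - x) \<bullet> b) *\<^sub>R D b i x)))"
        by (simp add: A.diff A.sum A.scaleR)
      also have "\<dots> \<le> norm (f i y - f i x - (\<Sum>b\<in>Basis. ((y - x) \<bullet> b) *\<^sub>R D b i x)) * C" by (rule C(2))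
      also have "\<dots> \<le> (M * (norm (y - x))\<^sup>2) * C" by (rule mult_right_mono[OF Dq(2)[OF *] C(1)])
      finally show "norm (A (f i y) - A (f i x) - (\<Sum>b\<in>Basis. ((y - x) \<bullet> b) *\<^sub>R A (D b i x)))
        \<le> M * C * (norm (y - x))\<^sup>2" by (simp add: ac_simps)
    qed
  }
qed

lemma ulipC_linear_map:
  assumes "bounded_linear A"
  shows "ulipC k J S (\<lambda>i x. A x)"
proof -
  have id0: "ulipC 0 J S (\<lambda>i x. x)" by (rule ulipC_0I[of _ _ _ 1]) simp
  have "ulipC k J S (\<lambda>i x. x)"
  proof (cases k)
    case (Suc k')
    show ?thesis unfolding Suc
      by (rule ulipC_SucI[where D = "\<lambda>b i x. b", OF _ utaylorI[where M = 0]])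
        (auto intro: id0 ulipC_const ubdI[of _ _ _ 1] simp: euclidean_representation)
  qed (simp add: id0)
  from ulipC_linear[OF this assms] show ?thesis .
qed

lemma ubd_add: "ubd J S f \<Longrightarrow> ubd J S g \<Longrightarrow> ubd J S (\<lambda>i x. f i x + g i x)"
  unfolding ubd_def by (meson add_mono norm_triangle_le)

lemma ulipC_add:
  assumes "ulipC k J S f" "ulipC k J S g"
  shows "ulipC k J S (\<lambda>i x. f i x + g i x)"
  using assms
proof (induction k arbitrary: f g)
  have lip: "ulipC 0 J S (\<lambda>i x. f i x + g i x)" if fg: "ulipC 0 J S f" "ulipC 0 J S g" for f g
  proof -
    obtain M where M: "M \<ge> 0" "\<And>i x y. i \<in> J \<Longrightarrow> x \<in> S i \<Longrightarrow> y \<in> S i \<Longrightarrow> norm (f i y - f i x) \<le> M * norm (y - x)"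
      using ulipC_0E[OF fg(1)] by blast
    obtain N where N: "N \<ge> 0" "\<And>i x y. i \<in> J \<Longrightarrow> x \<in> S i \<Longrightarrow> y \<in> S i \<Longrightarrow> norm (g i y - g i x) \<le> N * norm (y - x)"
      using ulipC_0E[OF fg(2)] by blast
    show ?thesis
    proof (rule ulipC_0I[of _ _ _ "M + N"])
      fix i x y assume *: "i \<in> J" "x \<in> S i" "y \<in> S i"
      show "norm (f i y + g i y - (f i x + g i x)) \<le> (M + N) * norm (y - x)"
        using norm_diff_triangle_ineq[of "f i y" "g i y" "f i x" "g i x"] M(2)[OF *] N(2)[OF *]
        by (simp add: algebra_simps)
    qed
  qed
  {
    case 0
    then show ?case by (rule lip)
  next
    case (Suc k)
    obtain D where D: "utaylor J S f D"
      "\<And>b. b \<in> Basis \<Longrightarrow> ubd J S (D b)" "\<And>b. b \<in> Basis \<Longrightarrow> ulipC k J S (D b)"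
      by (rule ulipC_SucE[OF Suc.prems(1)]) (rule that)
    obtain M where Dq: "M \<ge> 0" "\<And>i x y. i \<in> J \<Longrightarrow> x \<in> S i \<Longrightarrow> y \<in> S i \<Longrightarrow>
        norm (f i y - f i x - (\<Sum>b\<in>Basis. ((y - x) \<bullet> b) *\<^sub>R D b i x)) \<le> M * (norm (y - x))\<^sup>2"
      by (rule utaylorE[OF D(1)]) (rule that)
    obtain E where E: "utaylor J S g E"
      "\<And>b. b \<in> Basis \<Longrightarrow> ubd J S (E b)" "\<And>b. b \<in> Basis \<Longrightarrow> ulipC k J S (E b)"
      by (rule ulipC_SucE[OF Suc.prems(2)]) (rule that)
    obtain N where Eq: "N \<ge> 0" "\<And>i x y. i \<in> J \<Longrightarrow> x \<in> S i \<Longrightarrow> y \<in> S i \<Longrightarrow>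
        norm (g i y - g i x - (\<Sum>b\<in>Basis. ((y - x) \<bullet> b) *\<^sub>R E b i x)) \<le> N * (norm (y - x))\<^sup>2"
      by (rule utaylorE[OF E(1)]) (rule that)
    show ?case
    proof (rule ulipC_SucI[where D = "\<lambda>b i x. D b i x + E b i x", OF _ utaylorI[where M = "M + N"]])
      show "ulipC 0 J S (\<lambda>i x. f i x + g i x)" by (rule lip[OF Suc.prems[THEN ulipC_imp_0]])
      show "ubd J S (\<lambda>i x. D b i x + E b i x)" if "b \<in> Basis" for b by (rule ubd_add[OF D(2)[OF that] E(2)[OF that]])
      show "ulipC k J S (\<lambda>i x. D b i x + E b i x)" if "b \<in> Basis" for b by (rule Suc.IH[OF D(3)[OF that] E(3)[OF that]])
      fix i x y assume *: "i \<in> J" "x \<in> S i" "y \<in> S i"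
      have "f i y + g i y - (f i x + g i x) - (\<Sum>b\<in>Basis. ((y - x) \<bullet> b) *\<^sub>R (D b i x + E b i x))
        = (f i y - f i x - (\<Sum>b\<in>Basis. ((y - x) \<bullet> b) *\<^sub>R D b i x)) + (g i y - g i x - (\<Sum>b\<in>Basis. ((y - x) \<bullet> b) *\<^sub>R E b i x))"
        by (simp add: scaleR_add_right sum.distrib)
      also have "norm \<dots> \<le> M * (norm (y - x))\<^sup>2 + N * (norm (y - x))\<^sup>2"
        by (rule norm_add_rule_thm[OF Dq(2)[OF *] Eq(2)[OF *]])
      finally show "norm (f i y + g i y - (f i x + g i x) - (\<Sum>b\<in>Basis. ((y - x) \<bullet> b) *\<^sub>R (D b i x + E b i x)))
        \<le> (M + N) * (norm (y - x))\<^sup>2" by (simp only: distrib_right)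
    qed
  }
qed

lemma ulipC_sum:
  assumes "finite B" "\<And>b. b \<in> B \<Longrightarrow> ulipC k J S (f b)"
  shows "ulipC k J S (\<lambda>i x. \<Sum>b\<in>B. f b i x)"
  using assms by (induction B rule: finite_induct) (auto intro: ulipC_add ulipC_const)

lemma ubd_sum:
  assumes "finite B" "\<And>b. b \<in> B \<Longrightarrow> ubd J S (f b)"
  shows "ubd J S (\<lambda>i x. \<Sum>b\<in>B. f b i x)"
  using assms by (induction B rule: finite_induct) (auto intro: ubd_add ubdI[of _ _ _ 0])

lemma ulipC_Pair:
  assumes "ulipC k J S f" "ulipC k J S g"
  shows "ulipC k J S (\<lambda>i x. (f i x, g i x))"
proof -
  have "ulipC k J S (\<lambda>i x. (f i x, 0) + (0, g i x))"
    by (intro ulipC_add ulipC_linear[OF assms(1)] ulipC_linear[OF assms(2)])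
      (auto intro: bounded_linear_Pair bounded_linear_ident bounded_linear_zero)
  then show ?thesis by simp
qed

lemma ubd_scaleR:
  assumes "ubd J S f" "ubd J S g"
  shows "ubd J S (\<lambda>i x. f i x *\<^sub>R g i x)"
proof -
  obtain M where M: "M \<ge> 0" "\<And>i x. i \<in> J \<Longrightarrow> x \<in> S i \<Longrightarrow> norm (f i x) \<le> M" using ubdE[OF assms(1)] by blast
  obtain N where N: "N \<ge> 0" "\<And>i x. i \<in> J \<Longrightarrow> x \<in> S i \<Longrightarrow> norm (g i x) \<le> N" using ubdE[OF assms(2)] by blast
  show ?thesis
    by (rule ubdI[of _ _ _ "M * N"]) (use M N in \<open>force intro: mult_mono\<close>)
qed

lemma ulipC_scaleR:
  assumes "ulipC k J S f" "ulipC k J S g" "ubd J S f" "ubd J S g"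
  shows "ulipC k J S (\<lambda>i x. f i x *\<^sub>R g i x)"
  using assms
proof (induction k arbitrary: f g)
  have lip: "ulipC 0 J S (\<lambda>i x. f i x *\<^sub>R g i x)"
    if fg: "ulipC 0 J S f" "ulipC 0 J S g" "ubd J S f" "ubd J S g" for f :: "'a \<Rightarrow> 'b \<Rightarrow> real" and g :: "'a \<Rightarrow> 'b \<Rightarrow> 'c"
  proof -
    obtain M where M: "M \<ge> 0" "\<And>i x y. i \<in> J \<Longrightarrow> x \<in> S i \<Longrightarrow> y \<in> S i \<Longrightarrow> norm (f i y - f i x) \<le> M * norm (y - x)"
      using ulipC_0E[OF fg(1)] by blast
    obtain N where N: "N \<ge> 0" "\<And>i x y. i \<in> J \<Longrightarrow> x \<in> S i \<Longrightarrow> y \<in> S i \<Longrightarrow> norm (g i y - g i x) \<le> N * norm (y - x)"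
      using ulipC_0E[OF fg(2)] by blast
    obtain A where A: "A \<ge> 0" "\<And>i x. i \<in> J \<Longrightarrow> x \<in> S i \<Longrightarrow> norm (f i x) \<le> A" using ubdE[OF fg(3)] by blast
    obtain B where B: "B \<ge> 0" "\<And>i x. i \<in> J \<Longrightarrow> x \<in> S i \<Longrightarrow> norm (g i x) \<le> B" using ubdE[OF fg(4)] by blast
    show ?thesis
    proof (rule ulipC_0I[of _ _ _ "M * B + A * N"])
      fix i x y assume *: "i \<in> J" "x \<in> S i" "y \<in> S i"
      have "f i y *\<^sub>R g i y - f i x *\<^sub>R g i x = (f i y - f i x) *\<^sub>R g i x + f i y *\<^sub>R (g i y - g i x)"
        by (simp add: algebra_simps)
      also have "norm \<dots> \<le> (M * norm (y - x)) * B + A * (N * norm (y - x))"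
        unfolding norm_scaleR
        by (intro norm_triangle_le add_mono mult_mono order_trans[OF norm_scaleR[THEN eq_refl]])
          (use * M(1) M(2)[OF *] N(1) N(2)[OF *] A(1) A(2)[of i y] B(1) B(2)[of i x] in auto)
      finally show "norm (f i y *\<^sub>R g i y - f i x *\<^sub>R g i x) \<le> (M * B + A * N) * norm (y - x)"
        by (simp add: algebra_simps)
    qed
  qed
  {
    case 0
    then show ?case by (rule lip)
  next
    case (Suc k)
    obtain D where D: "utaylor J S f D"
      "\<And>b. b \<in> Basis \<Longrightarrow> ubd J S (D b)" "\<And>b. b \<in> Basis \<Longrightarrow> ulipC k J S (D b)"
      by (rule ulipC_SucE[OF Suc.prems(1)]) (rule that)
    obtain M where Dq: "M \<ge> 0" "\<And>i x y. i \<in> J \<Longrightarrow> x \<in> S i \<Longrightarrow> y \<in> S i \<Longrightarrow>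
        norm (f i y - f i x - (\<Sum>b\<in>Basis. ((y - x) \<bullet> b) *\<^sub>R D b i x)) \<le> M * (norm (y - x))\<^sup>2"
      by (rule utaylorE[OF D(1)]) (rule that)
    obtain E where E: "utaylor J S g E"
      "\<And>b. b \<in> Basis \<Longrightarrow> ubd J S (E b)" "\<And>b. b \<in> Basis \<Longrightarrow> ulipC k J S (E b)"
      by (rule ulipC_SucE[OF Suc.prems(2)]) (rule that)
    obtain N where Eq: "N \<ge> 0" "\<And>i x y. i \<in> J \<Longrightarrow> x \<in> S i \<Longrightarrow> y \<in> S i \<Longrightarrow>
        norm (g i y - g i x - (\<Sum>b\<in>Basis. ((y - x) \<bullet> b) *\<^sub>R E b i x)) \<le> N * (norm (y - x))\<^sup>2"
      by (rule utaylorE[OF E(1)]) (rule that)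
    obtain M' where M': "M' \<ge> 0" "\<And>i x y. i \<in> J \<Longrightarrow> x \<in> S i \<Longrightarrow> y \<in> S i \<Longrightarrow> norm (f i y - f i x) \<le> M' * norm (y - x)"
      using ulipC_0E[OF ulipC_imp_0[OF Suc.prems(1)]] by blast
    obtain N' where N': "N' \<ge> 0" "\<And>i x y. i \<in> J \<Longrightarrow> x \<in> S i \<Longrightarrow> y \<in> S i \<Longrightarrow> norm (g i y - g i x) \<le> N' * norm (y - x)"
      using ulipC_0E[OF ulipC_imp_0[OF Suc.prems(2)]] by blast
    obtain A where A: "A \<ge> 0" "\<And>i x. i \<in> J \<Longrightarrow> x \<in> S i \<Longrightarrow> norm (f i x) \<le> A" using ubdE[OF Suc.prems(3)] by blast
    obtain B where B: "B \<ge> 0" "\<And>i x. i \<in> J \<Longrightarrow> x \<in> S i \<Longrightarrow> norm (g i x) \<le> B" using ubdE[OF Suc.prems(4)] by blast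
    show ?case
    \<comment> \<open>The first two summands of the constant come from the remainders of the
      factors; the third bounds the product of the two increments, which is itself
      quadratic.\<close>
    proof (rule ulipC_SucI[where D = "\<lambda>b i x. D b i x *\<^sub>R g i x + f i x *\<^sub>R E b i x", OF _ utaylorI[where M = "M * B + A * N + M' * N'"]])
      show "ulipC 0 J S (\<lambda>i x. f i x *\<^sub>R g i x)" by (rule lip[OF Suc.prems(1,2)[THEN ulipC_imp_0] Suc.prems(3,4)])
      show "ubd J S (\<lambda>i x. D b i x *\<^sub>R g i x + f i x *\<^sub>R E b i x)" if "b \<in> Basis" for b
        by (intro ubd_add ubd_scaleR D(2)[OF that] E(2)[OF that] Suc.prems)
      show "ulipC k J S (\<lambda>i x. D b i x *\<^sub>R g i x + f i x *\<^sub>R E b i x)" if "b \<in> Basis" for b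
        by (intro ulipC_add Suc.IH D(2,3)[OF that] E(2,3)[OF that] Suc.prems Suc.prems(1,2)[THEN ulipC_SucD])
      fix i x y assume *: "i \<in> J" "x \<in> S i" "y \<in> S i"
      let ?d = "\<Sum>b\<in>Basis. ((y - x) \<bullet> b) *\<^sub>R D b i x" and ?e = "\<Sum>b\<in>Basis. ((y - x) \<bullet> b) *\<^sub>R E b i x"
      have "(\<Sum>b\<in>Basis. ((y - x) \<bullet> b) *\<^sub>R (D b i x *\<^sub>R g i x + f i x *\<^sub>R E b i x)) = ?d *\<^sub>R g i x + f i x *\<^sub>R ?e"
        by (simp add: scaleR_add_right sum.distrib scaleR_sum_left scaleR_sum_right ac_simps)
      then have "f i y *\<^sub>R g i y - f i x *\<^sub>R g i x - (\<Sum>b\<in>Basis. ((y - x) \<bullet> b) *\<^sub>R (D b i x *\<^sub>R g i x + f i x *\<^sub>R E b i x))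
        = (f i y - f i x - ?d) *\<^sub>R g i x + f i x *\<^sub>R (g i y - g i x - ?e) + (f i y - f i x) *\<^sub>R (g i y - g i x)"
        by (simp add: algebra_simps)
      also have "norm \<dots> \<le> (M * (norm (y - x))\<^sup>2) * B + A * (N * (norm (y - x))\<^sup>2) + (M' * norm (y - x)) * (N' * norm (y - x))"
        by (intro norm_triangle_le add_mono mult_mono order_trans[OF norm_scaleR[THEN eq_refl]])
          (use * M'(1) M'(2)[OF *] N'(1) N'(2)[OF *] Dq(1) Dq(2)[OF *] Eq(1) Eq(2)[OF *] A(1) A(2)[of i x] B(1) B(2)[of i x] in auto)
      finally show "norm (f i y *\<^sub>R g i y - f i x *\<^sub>R g i x - (\<Sum>b\<in>Basis. ((y - x) \<bullet> b) *\<^sub>R (D b i x *\<^sub>R g i x + f i x *\<^sub>R E b i x)))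
        \<le> (M * B + A * N + M' * N') * (norm (y - x))\<^sup>2" by (simp add: algebra_simps power2_eq_square)
    qed
  }
qed

lemma ubd_compose:
  assumes "ubd J T f" "\<And>i x. i \<in> J \<Longrightarrow> x \<in> S i \<Longrightarrow> g i x \<in> T i"
  shows "ubd J S (\<lambda>i x. f i (g i x))"
  using assms unfolding ubd_def by blast

text \<open>The chain rule in coordinates. Neither \<open>f\<close> nor \<open>g\<close> has to be
  bounded: the derivative of the composition involves only derivatives of both, and these are
  bounded by definition of the class.\<close>

lemma ulipC_compose:
  fixes g :: "'i \<Rightarrow> 'a::euclidean_space \<Rightarrow> 'b::euclidean_space"
  assumes "ulipC k J T f" "ulipC k J S g" and into: "\<And>i x. i \<in> J \<Longrightarrow> x \<in> S i \<Longrightarrow> g i x \<in> T i"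
  shows "ulipC k J S (\<lambda>i x. f i (g i x))"
  using assms(1,2)
proof (induction k arbitrary: f)
  have lip: "ulipC 0 J S (\<lambda>i x. f i (g i x))" if fg: "ulipC 0 J T f" "ulipC 0 J S g" for f
  proof -
    obtain M where M: "M \<ge> 0" "\<And>i x y. i \<in> J \<Longrightarrow> x \<in> T i \<Longrightarrow> y \<in> T i \<Longrightarrow> norm (f i y - f i x) \<le> M * norm (y - x)"
      using ulipC_0E[OF fg(1)] by blast
    obtain N where N: "N \<ge> 0" "\<And>i x y. i \<in> J \<Longrightarrow> x \<in> S i \<Longrightarrow> y \<in> S i \<Longrightarrow> norm (g i y - g i x) \<le> N * norm (y - x)"
      using ulipC_0E[OF fg(2)] by blast
    show ?thesis
    proof (rule ulipC_0I[of _ _ _ "M * N"])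
      fix i x y assume *: "i \<in> J" "x \<in> S i" "y \<in> S i"
      show "norm (f i (g i y) - f i (g i x)) \<le> M * N * norm (y - x)"
        using M(2)[of i "g i x" "g i y"] mult_left_mono[OF N(2)[OF *] M(1)] into * by fastforce
    qed
  qed
  {
    case 0
    then show ?case by (rule lip)
  next
    case (Suc k)
    obtain D where D: "utaylor J T f D"
      "\<And>b. b \<in> Basis \<Longrightarrow> ubd J T (D b)" "\<And>b. b \<in> Basis \<Longrightarrow> ulipC k J T (D b)"
      by (rule ulipC_SucE[OF Suc.prems(1)]) (rule that)
    obtain M where Dq: "M \<ge> 0" "\<And>i x y. i \<in> J \<Longrightarrow> x \<in> T i \<Longrightarrow> y \<in> T i \<Longrightarrow>
        norm (f i y - f i x - (\<Sum>b\<in>Basis. ((y - x) \<bullet> b) *\<^sub>R D b i x)) \<le> M * (norm (y - x))\<^sup>2"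
      by (rule utaylorE[OF D(1)]) (rule that)
    obtain E where E: "utaylor J S g E"
      "\<And>b. b \<in> Basis \<Longrightarrow> ubd J S (E b)" "\<And>b. b \<in> Basis \<Longrightarrow> ulipC k J S (E b)"
      by (rule ulipC_SucE[OF Suc.prems(2)]) (rule that)
    obtain N where Eq: "N \<ge> 0" "\<And>i x y. i \<in> J \<Longrightarrow> x \<in> S i \<Longrightarrow> y \<in> S i \<Longrightarrow>
        norm (g i y - g i x - (\<Sum>b\<in>Basis. ((y - x) \<bullet> b) *\<^sub>R E b i x)) \<le> N * (norm (y - x))\<^sup>2"
      by (rule utaylorE[OF E(1)]) (rule that)
    obtain N' where N': "N' \<ge> 0" "\<And>i x y. i \<in> J \<Longrightarrow> x \<in> S i \<Longrightarrow> y \<in> S i \<Longrightarrow> norm (g i y - g i x) \<le> N' * norm (y - x)"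
      using ulipC_0E[OF ulipC_imp_0[OF Suc.prems(2)]] by blast
    have "\<forall>c\<in>Basis. \<exists>A\<ge>0. \<forall>i\<in>J. \<forall>x\<in>T i. norm (D c i x) \<le> A"
      using D(2) by (meson ubdE)
    from bchoice[OF this] obtain A where A: "\<And>c. c \<in> Basis \<Longrightarrow> A c \<ge> 0"
        "\<And>c i x. c \<in> Basis \<Longrightarrow> i \<in> J \<Longrightarrow> x \<in> T i \<Longrightarrow> norm (D c i x) \<le> A c" by blast
    show ?case
    proof (rule ulipC_SucI[where D = "\<lambda>b i x. \<Sum>c\<in>Basis. (E b i x \<bullet> c) *\<^sub>R D c i (g i x)", OF _ utaylorI[where M = "M * N'\<^sup>2 + (\<Sum>c\<in>Basis. N * A c)"]])
      show "ulipC 0 J S (\<lambda>i x. f i (g i x))" by (rule lip[OF Suc.prems[THEN ulipC_imp_0]])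
      show "ubd J S (\<lambda>i x. \<Sum>c\<in>Basis. (E b i x \<bullet> c) *\<^sub>R D c i (g i x))" if b: "b \<in> Basis" for b
        by (intro ubd_sum ubd_scaleR ubd_linear[OF E(2)[OF b]] ubd_compose[OF D(2)] bounded_linear_inner_left into) auto
      show "ulipC k J S (\<lambda>i x. \<Sum>c\<in>Basis. (E b i x \<bullet> c) *\<^sub>R D c i (g i x))" if b: "b \<in> Basis" for b
        by (intro ulipC_sum ulipC_scaleR ulipC_linear[OF E(3)[OF b]] ubd_linear[OF E(2)[OF b]] ubd_compose[OF D(2)]
             Suc.IH D(3) ulipC_SucD[OF Suc.prems(2)] bounded_linear_inner_left into) auto
      fix i x y assume *: "i \<in> J" "x \<in> S i" "y \<in> S i"
      \<comment> \<open>The Taylor remainder of the inner function. Sent through the derivative of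
        \<open>f\<close>, it gives the sum over \<open>c\<close> in the constant; the first term of
        the constant is the remainder of \<open>f\<close> at an increment of size at most
        \<open>N' * norm (y - x)\<close>.\<close>
      let ?e = "g i y - g i x - (\<Sum>b\<in>Basis. ((y - x) \<bullet> b) *\<^sub>R E b i x)"
      have "(\<Sum>b\<in>Basis. ((y - x) \<bullet> b) *\<^sub>R (\<Sum>c\<in>Basis. (E b i x \<bullet> c) *\<^sub>R D c i (g i x)))
        = (\<Sum>b\<in>Basis. \<Sum>c\<in>Basis. (((y - x) \<bullet> b) * (E b i x \<bullet> c)) *\<^sub>R D c i (g i x))"
        by (simp add: scaleR_sum_right)
      also have "\<dots> = (\<Sum>c\<in>Basis. \<Sum>b\<in>Basis. (((y - x) \<bullet> b) * (E b i x \<bullet> c)) *\<^sub>R D c i (g i x))"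
        by (rule sum.swap)
      also have "\<dots> = (\<Sum>c\<in>Basis. ((\<Sum>b\<in>Basis. ((y - x) \<bullet> b) *\<^sub>R E b i x) \<bullet> c) *\<^sub>R D c i (g i x))"
        by (simp add: inner_sum_left scaleR_sum_left)
      also have "\<dots> = (\<Sum>c\<in>Basis. ((g i y - g i x) \<bullet> c) *\<^sub>R D c i (g i x)) - (\<Sum>c\<in>Basis. (?e \<bullet> c) *\<^sub>R D c i (g i x))"
        by (simp add: inner_diff_left sum_subtractf scaleR_left.diff)
      finally have eq: "f i (g i y) - f i (g i x) - (\<Sum>b\<in>Basis. ((y - x) \<bullet> b) *\<^sub>R (\<Sum>c\<in>Basis. (E b i x \<bullet> c) *\<^sub>R D c i (g i x)))
        = (f i (g i y) - f i (g i x) - (\<Sum>c\<in>Basis. ((g i y - g i x) \<bullet> c) *\<^sub>R D c i (g i x))) + (\<Sum>c\<in>Basis. (?e \<bullet> c) *\<^sub>R D c i (g i x))"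
        by simp
      have n1: "norm (f i (g i y) - f i (g i x) - (\<Sum>c\<in>Basis. ((g i y - g i x) \<bullet> c) *\<^sub>R D c i (g i x))) \<le> M * (N' * norm (y - x))\<^sup>2"
        by (rule order_trans[OF Dq(2)]) (use * into Dq(1) N' in \<open>auto intro!: mult_left_mono power_mono\<close>)
      have n2: "norm (\<Sum>c\<in>Basis. (?e \<bullet> c) *\<^sub>R D c i (g i x)) \<le> (\<Sum>c\<in>Basis. (N * (norm (y - x))\<^sup>2) * A c)"
      proof (rule sum_norm_le)
        fix c :: 'b assume c: "c \<in> Basis"
        have "\<bar>?e \<bullet> c\<bar> \<le> N * (norm (y - x))\<^sup>2" using Eq(2)[OF *] Basis_le_norm[OF c, of ?e] by linarith
        moreover have "norm (D c i (g i x)) \<le> A c" using A(2) c * into by blast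
        ultimately show "norm ((?e \<bullet> c) *\<^sub>R D c i (g i x)) \<le> (N * (norm (y - x))\<^sup>2) * A c"
          by (simp add: mult_mono' )
      qed
      have "norm (f i (g i y) - f i (g i x) - (\<Sum>b\<in>Basis. ((y - x) \<bullet> b) *\<^sub>R (\<Sum>c\<in>Basis. (E b i x \<bullet> c) *\<^sub>R D c i (g i x))))
        \<le> M * (N' * norm (y - x))\<^sup>2 + (\<Sum>c\<in>Basis. (N * (norm (y - x))\<^sup>2) * A c)"
        unfolding eq by (rule norm_add_rule_thm[OF n1 n2])
      also have "\<dots> = (M * N'\<^sup>2 + (\<Sum>c\<in>Basis. N * A c)) * (norm (y - x))\<^sup>2"
        unfolding sum_distrib_right distrib_right power_mult_distrib by (simp add: mult_ac)
      finally show "norm (f i (g i y) - f i (g i x) - (\<Sum>b\<in>Basis. ((y - x) \<bullet> b) *\<^sub>R (\<Sum>c\<in>Basis. (E b i x \<bullet> c) *\<^sub>R D c i (g i x))))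
        \<le> (M * N'\<^sup>2 + (\<Sum>c\<in>Basis. N * A c)) * (norm (y - x))\<^sup>2" .
    qed
  }
qed

section \<open>Limits, weighted sums and integrals\<close>

text \<open>Serves to interchange two limits: derivatives are approximated, uniformly in
  \<open>n\<close>, by difference quotients whose convergence is already known.\<close>

lemma Cauchy_if_approx:
  fixes X :: "nat \<Rightarrow> 'a::metric_space"
  assumes "\<And>e. e > 0 \<Longrightarrow> \<exists>a. Cauchy a \<and> (\<forall>n. dist (X n) (a n) \<le> e)"
  shows "Cauchy X"
proof (rule metric_CauchyI)
  fix e :: real assume "e > 0"
  then obtain a where a: "Cauchy a" "\<And>n. dist (X n) (a n) \<le> e / 3" using assms[of "e / 3"] by auto
  obtain N where N: "\<And>m n. m \<ge> N \<Longrightarrow> n \<ge> N \<Longrightarrow> dist (a m) (a n) < e / 3"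
    using metric_CauchyD[OF a(1), of "e / 3"] \<open>e > 0\<close> by auto
  have "dist (X m) (X n) < e" if "m \<ge> N" "n \<ge> N" for m n
  proof -
    have "dist (X m) (X n) \<le> dist (X m) (a m) + (dist (a m) (a n) + dist (a n) (X n))"
      by (meson add_left_mono dist_triangle order_trans)
    also have "\<dots> < e" using a(2)[of m] a(2)[of n] N[OF that] by (simp add: dist_commute)
    finally show ?thesis .
  qed
  then show "\<exists>N. \<forall>m\<ge>N. \<forall>n\<ge>N. dist (X m) (X n) < e" by blast
qed

lemma sum_Basis_direction:
  fixes D :: "'a::euclidean_space \<Rightarrow> 'b::real_vector"
  assumes "b \<in> Basis"
  shows "(\<Sum>c\<in>Basis. ((t *\<^sub>R b) \<bullet> c) *\<^sub>R D c) = t *\<^sub>R D b"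
proof -
  have "(\<Sum>c\<in>Basis. ((t *\<^sub>R b) \<bullet> c) *\<^sub>R D c) = (\<Sum>c\<in>Basis. if b = c then t *\<^sub>R D c else 0)"
    by (rule sum.cong) (auto simp: inner_Basis assms)
  then show ?thesis using assms by simp
qed

text \<open>Convergence of the derivatives is not assumed but follows: for a fixed step
  \<open>t\<close> the difference quotients converge, and the common remainder bound puts them
  within \<open>M * t\<close> of the derivatives for every \<open>n\<close>. Openness of the domain
  leaves room for the step; order zero involves no step and allows any domain.\<close>

lemma ulipC_lim:
  fixes f :: "nat \<Rightarrow> 'i \<Rightarrow> 'a::euclidean_space \<Rightarrow> 'b::banach"
  assumes "ulipC k (UNIV \<times> J) (\<lambda>q. S (snd q)) (\<lambda>q. f (fst q) (snd q))"
    and "\<And>i x. i \<in> J \<Longrightarrow> x \<in> S i \<Longrightarrow> (\<lambda>n. f n i x) \<longlonglongrightarrow> g i x"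
    and "k = 0 \<or> (\<forall>i\<in>J. open (S i))"
  shows "ulipC k J S g"
  using assms
proof (induction k arbitrary: f g)
  have lip: "ulipC 0 J S g"
    if f: "ulipC 0 (UNIV \<times> J) (\<lambda>q. S (snd q)) (\<lambda>q. f (fst q) (snd q))"
      and lim: "\<And>i x. i \<in> J \<Longrightarrow> x \<in> S i \<Longrightarrow> (\<lambda>n. f n i x) \<longlonglongrightarrow> g i x"
    for f :: "nat \<Rightarrow> 'i \<Rightarrow> 'a \<Rightarrow> 'b" and g
  proof -
    obtain M where M: "M \<ge> 0" "\<And>q x y. q \<in> UNIV \<times> J \<Longrightarrow> x \<in> S (snd q) \<Longrightarrow> y \<in> S (snd q) \<Longrightarrow>
        norm (f (fst q) (snd q) y - f (fst q) (snd q) x) \<le> M * norm (y - x)"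
      by (rule ulipC_0E[OF f]) (rule that)
    show ?thesis
    proof (rule ulipC_0I)
      fix i x y assume *: "i \<in> J" "x \<in> S i" "y \<in> S i"
      have "(\<lambda>n. norm (f n i y - f n i x)) \<longlonglongrightarrow> norm (g i y - g i x)"
        by (intro tendsto_intros lim *)
      then show "norm (g i y - g i x) \<le> M * norm (y - x)"
        by (rule Lim_bounded) (use M(2)[of "(_, i)"] * in auto)
    qed
  qed
  {
    case 0
    then show ?case using lip by blast
  next
    case (Suc k)
    obtain D where D: "utaylor (UNIV \<times> J) (\<lambda>q. S (snd q)) (\<lambda>q. f (fst q) (snd q)) D"
        "\<And>b. b \<in> Basis \<Longrightarrow> ubd (UNIV \<times> J) (\<lambda>q. S (snd q)) (D b)"
        "\<And>b. b \<in> Basis \<Longrightarrow> ulipC k (UNIV \<times> J) (\<lambda>q. S (snd q)) (D b)"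
      by (rule ulipC_SucE[OF Suc.prems(1)]) (rule that)
    obtain M where M: "M \<ge> 0" "\<And>q x y. q \<in> UNIV \<times> J \<Longrightarrow> x \<in> S (snd q) \<Longrightarrow> y \<in> S (snd q) \<Longrightarrow>
        norm (f (fst q) (snd q) y - f (fst q) (snd q) x - (\<Sum>b\<in>Basis. ((y - x) \<bullet> b) *\<^sub>R D b q x)) \<le> M * (norm (y - x))\<^sup>2"
      by (rule utaylorE[OF D(1)]) (rule that)
    have opn: "open (S i)" if "i \<in> J" for i using Suc.prems(3) that by auto
    have conv: "convergent (\<lambda>n. D b (n, i) x)" if *: "b \<in> Basis" "i \<in> J" "x \<in> S i" for b i x
    proof (rule Cauchy_convergent, rule Cauchy_if_approx)
      fix e :: real assume "e > 0"
      obtain r where r: "r > 0" "ball x r \<subseteq> S i" using opn[OF *(2)] *(3) open_contains_ball by blast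
      \<comment> \<open>The first entry keeps the shifted point in the ball, the second makes the
        error \<open>M * t\<close> at most \<open>e\<close>; adding 1 covers
        \<open>M = 0\<close>.\<close>
      define t where "t = min (r / 2) (e / (M + 1))"
      have t: "0 < t" "t < r" "M * t \<le> e"
      proof -
        show "0 < t" "t < r" using r \<open>e > 0\<close> M(1) by (auto simp: t_def)
        have "M * t \<le> (M + 1) * (e / (M + 1))"
          by (rule mult_mono) (use M(1) \<open>e > 0\<close> r in \<open>auto simp: t_def\<close>)
        then show "M * t \<le> e" using M(1) by simp
      qed
      let ?y = "x + t *\<^sub>R b"
      have y: "?y \<in> S i" using t r *(1) by (intro subsetD[OF r(2)]) (simp add: dist_norm)
      let ?a = "\<lambda>n. (1 / t) *\<^sub>R (f n i ?y - f n i x)"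
      have "?a \<longlonglongrightarrow> (1 / t) *\<^sub>R (g i ?y - g i x)"
        by (intro tendsto_intros Suc.prems(2) * y)
      then have "Cauchy ?a" by (rule LIMSEQ_imp_Cauchy)
      moreover have "dist (D b (n, i) x) (?a n) \<le> e" for n
      proof -
        have "norm (f n i ?y - f n i x - t *\<^sub>R D b (n, i) x) \<le> M * t\<^sup>2"
          using M(2)[of "(n, i)" x ?y, unfolded add_diff_cancel_left' sum_Basis_direction[OF *(1)] fst_conv snd_conv]
            * y t(1) by simp
        moreover have "?a n - D b (n, i) x = (1 / t) *\<^sub>R (f n i ?y - f n i x - t *\<^sub>R D b (n, i) x)"
          using t(1) by (simp add: scaleR_diff_right)
        ultimately have "norm (?a n - D b (n, i) x) \<le> (1 / t) * (M * t\<^sup>2)"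
          using t(1) by (simp add: divide_right_mono)
        also have "\<dots> = M * t" using t(1) by (simp add: power2_eq_square)
        finally show ?thesis using t(3) by (simp add: dist_norm norm_minus_commute)
      qed
      ultimately show "\<exists>a. Cauchy a \<and> (\<forall>n. dist (D b (n, i) x) (a n) \<le> e)" by blast
    qed
    define E where "E = (\<lambda>b i x. lim (\<lambda>n. D b (n, i) x))"
    have limE: "(\<lambda>n. D b (n, i) x) \<longlonglongrightarrow> E b i x" if "b \<in> Basis" "i \<in> J" "x \<in> S i" for b i x
      unfolding E_def using conv[OF that] by (simp add: convergent_LIMSEQ_iff)
    show ?case
    proof (rule ulipC_SucI[where D = E, OF _ utaylorI[where M = M]])
      show "ulipC 0 J S g" by (rule lip[OF ulipC_imp_0[OF Suc.prems(1)] Suc.prems(2)])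
      show "ulipC k J S (E b)" if b: "b \<in> Basis" for b
        by (rule Suc.IH[of "\<lambda>n i. D b (n, i)"]) (use b D(3) limE opn in auto)
      show "ubd J S (E b)" if b: "b \<in> Basis" for b
      proof -
        obtain A where A: "A \<ge> 0" "\<And>q x. q \<in> UNIV \<times> J \<Longrightarrow> x \<in> S (snd q) \<Longrightarrow> norm (D b q x) \<le> A"
          by (rule ubdE[OF D(2)[OF b]]) (rule that)
        show ?thesis
        proof (rule ubdI)
          fix i x assume *: "i \<in> J" "x \<in> S i"
          show "norm (E b i x) \<le> A"
            by (rule Lim_bounded[OF tendsto_norm[OF limE[OF b *]]]) (use A(2)[of "(_, i)"] * in auto)
        qed
      qed
      fix i x y assume *: "i \<in> J" "x \<in> S i" "y \<in> S i"
      have "(\<lambda>n. norm (f n i y - f n i x - (\<Sum>b\<in>Basis. ((y - x) \<bullet> b) *\<^sub>R D b (n, i) x)))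
          \<longlonglongrightarrow> norm (g i y - g i x - (\<Sum>b\<in>Basis. ((y - x) \<bullet> b) *\<^sub>R E b i x))"
        by (intro tendsto_intros Suc.prems(2) limE *)
      then show "norm (g i y - g i x - (\<Sum>b\<in>Basis. ((y - x) \<bullet> b) *\<^sub>R E b i x)) \<le> M * (norm (y - x))\<^sup>2"
        by (rule Lim_bounded) (use M(2)[of "(_, i)"] * in auto)
    qed
  }
qed

lemma norm_weighted_sum_le:
  fixes v :: "'a \<Rightarrow> 'b::real_normed_vector"
  assumes "\<And>a. a \<in> A \<Longrightarrow> norm (v a) \<le> M" "(\<Sum>a\<in>A. \<bar>c a\<bar>) \<le> C" "M \<ge> 0"
  shows "norm (\<Sum>a\<in>A. c a *\<^sub>R v a) \<le> C * M"
proof -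
  have "norm (\<Sum>a\<in>A. c a *\<^sub>R v a) \<le> (\<Sum>a\<in>A. \<bar>c a\<bar> * M)"
    by (rule sum_norm_le) (simp add: assms(1) mult_left_mono)
  also have "\<dots> = (\<Sum>a\<in>A. \<bar>c a\<bar>) * M" by (simp add: sum_distrib_right)
  also have "\<dots> \<le> C * M" using assms by (intro mult_right_mono)
  finally show ?thesis .
qed

text \<open>The bound depends on the total absolute weight \<open>C\<close> and not on the number of
  terms. This one statement covers Riemann sums, with equal weights, and partial sums of power
  series, with summable coefficients.\<close>

lemma ulipC_weighted_sum:
  fixes f :: "'j \<Rightarrow> 'i \<Rightarrow> 'a::euclidean_space \<Rightarrow> 'b::real_normed_vector"
    and p :: "'n \<Rightarrow> 'c \<Rightarrow> 'j" and c :: "'n \<Rightarrow> 'c \<Rightarrow> real"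
  assumes "ulipC k (B \<times> J) (\<lambda>q. S (snd q)) (\<lambda>q. f (fst q) (snd q))"
    and p: "\<And>n a. n \<in> N \<Longrightarrow> a \<in> A n \<Longrightarrow> p n a \<in> B"
    and C: "\<And>n. n \<in> N \<Longrightarrow> (\<Sum>a\<in>A n. \<bar>c n a\<bar>) \<le> C"
  shows "ulipC k (N \<times> J) (\<lambda>q. S (snd q)) (\<lambda>q x. \<Sum>a\<in>A (fst q). c (fst q) a *\<^sub>R f (p (fst q) a) (snd q) x)"
  using assms(1)
proof (induction k arbitrary: f)
  have lip: "ulipC 0 (N \<times> J) (\<lambda>q. S (snd q)) (\<lambda>q x. \<Sum>a\<in>A (fst q). c (fst q) a *\<^sub>R f (p (fst q) a) (snd q) x)"
    if f: "ulipC 0 (B \<times> J) (\<lambda>q. S (snd q)) (\<lambda>q. f (fst q) (snd q))" for f :: "'j \<Rightarrow> 'i \<Rightarrow> 'a \<Rightarrow> 'b"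
  proof -
    obtain M where M: "M \<ge> 0" "\<And>q x y. q \<in> B \<times> J \<Longrightarrow> x \<in> S (snd q) \<Longrightarrow> y \<in> S (snd q) \<Longrightarrow>
        norm (f (fst q) (snd q) y - f (fst q) (snd q) x) \<le> M * norm (y - x)"
      by (rule ulipC_0E[OF f]) (rule that)
    show ?thesis
    proof (rule ulipC_0I[of _ _ _ "C * M"])
      fix q x y assume *: "q \<in> N \<times> J" "x \<in> S (snd q)" "y \<in> S (snd q)"
      obtain n i where q: "q = (n, i)" by (cases q)
      have "norm (\<Sum>a\<in>A n. c n a *\<^sub>R (f (p n a) i y - f (p n a) i x)) \<le> C * (M * norm (y - x))"
        by (rule norm_weighted_sum_le) (use * q p M(1) M(2)[of "(p n _, i)"] C in auto)
      then show "norm ((\<Sum>a\<in>A (fst q). c (fst q) a *\<^sub>R f (p (fst q) a) (snd q) y)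
            - (\<Sum>a\<in>A (fst q). c (fst q) a *\<^sub>R f (p (fst q) a) (snd q) x)) \<le> C * M * norm (y - x)"
        by (simp add: q sum_subtractf[symmetric] scaleR_diff_right[symmetric] mult.assoc)
    qed
  qed
  {
    case 0
    then show ?case by (rule lip)
  next
    case (Suc k)
    obtain D where D: "utaylor (B \<times> J) (\<lambda>q. S (snd q)) (\<lambda>q. f (fst q) (snd q)) D"
        "\<And>b. b \<in> Basis \<Longrightarrow> ubd (B \<times> J) (\<lambda>q. S (snd q)) (D b)"
        "\<And>b. b \<in> Basis \<Longrightarrow> ulipC k (B \<times> J) (\<lambda>q. S (snd q)) (D b)"
      by (rule ulipC_SucE[OF Suc.prems(1)]) (rule that)
    obtain M where M: "M \<ge> 0" "\<And>q x y. q \<in> B \<times> J \<Longrightarrow> x \<in> S (snd q) \<Longrightarrow> y \<in> S (snd q) \<Longrightarrow>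
        norm (f (fst q) (snd q) y - f (fst q) (snd q) x - (\<Sum>b\<in>Basis. ((y - x) \<bullet> b) *\<^sub>R D b q x)) \<le> M * (norm (y - x))\<^sup>2"
      by (rule utaylorE[OF D(1)]) (rule that)
    show ?case
    proof (rule ulipC_SucI[where D = "\<lambda>b q x. \<Sum>a\<in>A (fst q). c (fst q) a *\<^sub>R D b (p (fst q) a, snd q) x",
            OF _ utaylorI[where M = "C * M"]])
      show "ulipC 0 (N \<times> J) (\<lambda>q. S (snd q)) (\<lambda>q x. \<Sum>a\<in>A (fst q). c (fst q) a *\<^sub>R f (p (fst q) a) (snd q) x)"
        by (rule lip[OF ulipC_imp_0[OF Suc.prems]])
      show "ulipC k (N \<times> J) (\<lambda>q. S (snd q)) (\<lambda>q x. \<Sum>a\<in>A (fst q). c (fst q) a *\<^sub>R D b (p (fst q) a, snd q) x)"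
        if b: "b \<in> Basis" for b
        by (rule Suc.IH[of "\<lambda>j i. D b (j, i)"]) (use b D(3) in auto)
      show "ubd (N \<times> J) (\<lambda>q. S (snd q)) (\<lambda>q x. \<Sum>a\<in>A (fst q). c (fst q) a *\<^sub>R D b (p (fst q) a, snd q) x)"
        if b: "b \<in> Basis" for b
      proof -
        obtain L where L: "L \<ge> 0" "\<And>q x. q \<in> B \<times> J \<Longrightarrow> x \<in> S (snd q) \<Longrightarrow> norm (D b q x) \<le> L"
          by (rule ubdE[OF D(2)[OF b]]) (rule that)
        show ?thesis
        proof (rule ubdI)
          fix q x assume *: "q \<in> N \<times> J" "x \<in> S (snd q)"
          show "norm (\<Sum>a\<in>A (fst q). c (fst q) a *\<^sub>R D b (p (fst q) a, snd q) x) \<le> C * L"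
            by (rule norm_weighted_sum_le) (use * p L C in auto)
        qed
      qed
      fix q x y assume *: "q \<in> N \<times> J" "x \<in> S (snd q)" "y \<in> S (snd q)"
      obtain n i where q: "q = (n, i)" by (cases q)
      have "(\<Sum>b\<in>Basis. ((y - x) \<bullet> b) *\<^sub>R (\<Sum>a\<in>A n. c n a *\<^sub>R D b (p n a, i) x))
        = (\<Sum>b\<in>Basis. \<Sum>a\<in>A n. c n a *\<^sub>R ((y - x) \<bullet> b) *\<^sub>R D b (p n a, i) x)"
        by (simp add: scaleR_sum_right mult.commute)
      also have "\<dots> = (\<Sum>a\<in>A n. c n a *\<^sub>R (\<Sum>b\<in>Basis. ((y - x) \<bullet> b) *\<^sub>R D b (p n a, i) x))"
        by (subst sum.swap) (simp add: scaleR_sum_right)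
      finally have eq: "(\<Sum>a\<in>A n. c n a *\<^sub>R f (p n a) i y) - (\<Sum>a\<in>A n. c n a *\<^sub>R f (p n a) i x)
          - (\<Sum>b\<in>Basis. ((y - x) \<bullet> b) *\<^sub>R (\<Sum>a\<in>A n. c n a *\<^sub>R D b (p n a, i) x))
        = (\<Sum>a\<in>A n. c n a *\<^sub>R (f (p n a) i y - f (p n a) i x - (\<Sum>b\<in>Basis. ((y - x) \<bullet> b) *\<^sub>R D b (p n a, i) x)))"
        by (simp only: sum_subtractf scaleR_diff_right)
      have "norm (\<Sum>a\<in>A n. c n a *\<^sub>R (f (p n a) i y - f (p n a) i x - (\<Sum>b\<in>Basis. ((y - x) \<bullet> b) *\<^sub>R D b (p n a, i) x)))
          \<le> C * (M * (norm (y - x))\<^sup>2)"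
        by (rule norm_weighted_sum_le) (use * q p M(1) M(2)[of "(p n _, i)"] C in auto)
      then show "norm ((\<Sum>a\<in>A (fst q). c (fst q) a *\<^sub>R f (p (fst q) a) (snd q) y)
            - (\<Sum>a\<in>A (fst q). c (fst q) a *\<^sub>R f (p (fst q) a) (snd q) x)
            - (\<Sum>b\<in>Basis. ((y - x) \<bullet> b) *\<^sub>R (\<Sum>a\<in>A (fst q). c (fst q) a *\<^sub>R D b (p (fst q) a, snd q) x)))
          \<le> C * M * (norm (y - x))\<^sup>2"
        unfolding q fst_conv snd_conv eq by (simp add: mult.assoc)
    qed
  }
qed

text \<open>By uniform continuity each subinterval contributes an error of at most its length times
  \<open>e / 2\<close>. The induction over the subintervals compares partial sums with integrals
  over initial segments.\<close>

lemma riemann_sum_tendsto: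
  fixes g :: "real \<Rightarrow> 'b::banach"
  assumes cont: "continuous_on {0..1} g"
  shows "(\<lambda>n. \<Sum>j<Suc n. (1 / real (Suc n)) *\<^sub>R g (real j / real (Suc n))) \<longlonglongrightarrow> integral {0..1} g"
proof (rule LIMSEQ_I)
  fix e :: real assume "e > 0"
  have "uniformly_continuous_on {0..1} g" using cont by (rule compact_uniformly_continuous) simp
  then obtain d where d: "d > 0" "\<And>s t. s \<in> {0..1} \<Longrightarrow> t \<in> {0..1} \<Longrightarrow> dist t s < d \<Longrightarrow> dist (g t) (g s) < e / 2"
    unfolding uniformly_continuous_on_def using \<open>e > 0\<close> by (metis half_gt_zero)
  obtain N where N: "1 / real (Suc N) < d" using d(1) nat_approx_posE by blast
  have "norm ((\<Sum>j<Suc n. (1 / real (Suc n)) *\<^sub>R g (real j / real (Suc n))) - integral {0..1} g) < e" if "n \<ge> N" for n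
  proof -
    define h where "h = 1 / real (Suc n)"
    have h: "0 < h" "h < d" "h * real (Suc n) = 1"
    proof -
      show "0 < h" "h * real (Suc n) = 1" by (auto simp: h_def)
      have "h \<le> 1 / real (Suc N)" using that by (auto simp: h_def intro!: divide_left_mono)
      then show "h < d" using N by linarith
    qed
    have "norm ((\<Sum>j<m. h *\<^sub>R g (real j * h)) - integral {0..real m * h} g) \<le> real m * h * (e / 2)" if "m \<le> Suc n" for m
      using that
    proof (induction m)
      case 0
      then show ?case by simp
    next
      case (Suc m)
      let ?a = "real m * h" and ?b = "real (Suc m) * h"
      have b1: "?b \<le> 1"
        using mult_right_mono[of "real (Suc m)" "real (Suc n)" h] Suc.prems h(1) h(3)[unfolded mult.commute[of h]]
        by linarith
      have ab: "0 \<le> ?a" "?a \<le> ?b" "?b - ?a = h" using h by (auto simp: algebra_simps)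
      have c: "continuous_on {0..?b} g" "continuous_on {?a..?b} g"
        by (rule continuous_on_subset[OF cont]; use b1 ab(1,2) h(1) in simp)+
      have comb: "integral {0..?a} g + integral {?a..?b} g = integral {0..?b} g"
        by (rule Henstock_Kurzweil_Integration.integral_combine[OF ab(1,2) integrable_continuous_interval[OF c(1)]])
      have "integral {?a..?b} (\<lambda>t. g ?a - g t) = integral {?a..?b} (\<lambda>t. g ?a) - integral {?a..?b} g"
        by (rule Henstock_Kurzweil_Integration.integral_diff[OF integrable_const_ivl
              integrable_continuous_interval[OF c(2)]])
      then have "h *\<^sub>R g ?a - integral {?a..?b} g = integral {?a..?b} (\<lambda>t. g ?a - g t)"
        using ab by simp
      also have "norm \<dots> \<le> e / 2 * (?b - ?a)"
      proof (rule integral_bound[OF ab(2)])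
        show "continuous_on {?a..?b} (\<lambda>t. g ?a - g t)" by (intro continuous_intros c)
        fix t assume t: "t \<in> {?a..?b}"
        have "\<bar>?a - t\<bar> < d" using t ab(3) h(2) unfolding atLeastAtMost_iff by linarith
        moreover have "?a \<in> {0..1}" "t \<in> {0..1}" using t b1 ab(1,2) unfolding atLeastAtMost_iff by linarith+
        ultimately have "dist (g ?a) (g t) < e / 2" by (intro d(2)) (simp_all add: dist_real_def)
        then show "norm (g ?a - g t) \<le> e / 2" by (simp add: dist_norm)
      qed
      finally have n2: "norm (h *\<^sub>R g ?a - integral {?a..?b} g) \<le> h * (e / 2)" using ab(3) by (simp add: mult.commute)
      have n1: "norm ((\<Sum>j<m. h *\<^sub>R g (real j * h)) - integral {0..?a} g) \<le> ?a * (e / 2)" using Suc by simp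
      have "(\<Sum>j<Suc m. h *\<^sub>R g (real j * h)) - integral {0..?b} g
        = ((\<Sum>j<m. h *\<^sub>R g (real j * h)) - integral {0..?a} g) + (h *\<^sub>R g ?a - integral {?a..?b} g)"
        unfolding comb[symmetric] by simp
      then have "norm ((\<Sum>j<Suc m. h *\<^sub>R g (real j * h)) - integral {0..?b} g) \<le> ?a * (e / 2) + h * (e / 2)"
        using norm_add_rule_thm[OF n1 n2] by (simp only:)
      also have "\<dots> = ?b * (e / 2)" by (simp add: algebra_simps)
      finally show ?case .
    qed
    from this[of "Suc n"] have "norm ((\<Sum>j<Suc n. h *\<^sub>R g (real j * h)) - integral {0..1} g) \<le> e / 2"
      using h(3) by (simp add: mult.commute del: sum.lessThan_Suc)
    then show ?thesis using \<open>e > 0\<close> by (simp add: h_def del: sum.lessThan_Suc of_nat_Suc)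
  qed
  then show "\<exists>N. \<forall>n\<ge>N. norm ((\<Sum>j<Suc n. (1 / real (Suc n)) *\<^sub>R g (real j / real (Suc n))) - integral {0..1} g) < e"
    by blast
qed

text \<open>As limits of Riemann sums, integrals need no differentiation under the integral sign.\<close>

lemma ulipC_integral:
  fixes f :: "real \<Rightarrow> 'i \<Rightarrow> 'a::euclidean_space \<Rightarrow> 'b::banach"
  assumes f: "ulipC k ({0..1} \<times> J) (\<lambda>q. S (snd q)) (\<lambda>q. f (fst q) (snd q))"
    and cont: "\<And>i x. i \<in> J \<Longrightarrow> x \<in> S i \<Longrightarrow> continuous_on {0..1} (\<lambda>t. f t i x)"
    and opn: "k = 0 \<or> (\<forall>i\<in>J. open (S i))"
  shows "ulipC k J S (\<lambda>i x. integral {0..1} (\<lambda>t. f t i x))"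
proof (rule ulipC_lim[OF _ riemann_sum_tendsto[OF cont] opn])
  show "ulipC k (UNIV \<times> J) (\<lambda>q. S (snd q)) (\<lambda>q x. \<Sum>j<Suc (fst q). (1 / real (Suc (fst q))) *\<^sub>R f (real j / real (Suc (fst q))) (snd q) x)"
    \<comment> \<open>The nodes are left endpoints, hence in the unit interval, and the weights add
      up to the final argument 1.\<close>
    by (rule ulipC_weighted_sum[OF f, of UNIV "\<lambda>n. {..<Suc n}" "\<lambda>n j. real j / real (Suc n)" "\<lambda>n j. 1 / real (Suc n)" 1])
      (auto simp del: sum.lessThan_Suc simp: field_simps)
qed

section \<open>Criteria on convex domains\<close>

lemma onorm_coordinates_le:
  fixes D :: "'a::euclidean_space \<Rightarrow> 'b::real_normed_vector"
  assumes "\<And>b. b \<in> Basis \<Longrightarrow> norm (D b) \<le> A b"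
  shows "onorm (\<lambda>h. \<Sum>b\<in>Basis. (h \<bullet> b) *\<^sub>R D b) \<le> (\<Sum>b\<in>Basis. A b)"
proof (rule onorm_le)
  fix h :: 'a
  have "norm (\<Sum>b\<in>Basis. (h \<bullet> b) *\<^sub>R D b) \<le> (\<Sum>b\<in>Basis. norm h * A b)"
    by (rule sum_norm_le) (auto intro!: mult_mono assms Basis_le_norm)
  then show "norm (\<Sum>b\<in>Basis. (h \<bullet> b) *\<^sub>R D b) \<le> (\<Sum>b\<in>Basis. A b) * norm h"
    by (simp add: sum_distrib_left mult.commute)
qed

lemma ulipC_0_convexI:
  assumes conv: "\<And>i. i \<in> J \<Longrightarrow> convex (S i)"
    and der: "\<And>i x. i \<in> J \<Longrightarrow> x \<in> S i \<Longrightarrow>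
      (f i has_derivative (\<lambda>h. \<Sum>b\<in>Basis. (h \<bullet> b) *\<^sub>R D b i x)) (at x within S i)"
    and bd: "\<And>b. b \<in> Basis \<Longrightarrow> ubd J S (D b)"
  shows "ulipC 0 J S f"
proof -
  have "\<forall>b\<in>Basis. \<exists>A. \<forall>i\<in>J. \<forall>x\<in>S i. norm (D b i x) \<le> A" using bd unfolding ubd_def by blast
  from bchoice[OF this] obtain A where A: "\<And>b i x. b \<in> Basis \<Longrightarrow> i \<in> J \<Longrightarrow> x \<in> S i \<Longrightarrow> norm (D b i x) \<le> A b"
    by blast
  show ?thesis
  proof (rule ulipC_0I)
    fix i x y assume *: "i \<in> J" "x \<in> S i" "y \<in> S i"
    show "norm (f i y - f i x) \<le> (\<Sum>b\<in>Basis. A b) * norm (y - x)"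
      by (rule differentiable_bound[OF conv[OF *(1)] der[OF *(1)] onorm_coordinates_le])
        (use * A in auto)
  qed
qed

text \<open>The derivative is Lipschitz, so along the segment from \<open>x\<close> to
  \<open>y\<close> it deviates from its value at \<open>x\<close> by a multiple of
  \<open>norm (y - x)\<close>; the mean value inequality for the linearized function then gives a
  quadratic remainder.\<close>

lemma ulipC_Suc_convexI:
  assumes conv: "\<And>i. i \<in> J \<Longrightarrow> convex (S i)"
    and der: "\<And>i x. i \<in> J \<Longrightarrow> x \<in> S i \<Longrightarrow>
      (f i has_derivative (\<lambda>h. \<Sum>b\<in>Basis. (h \<bullet> b) *\<^sub>R D b i x)) (at x within S i)"
    and bd: "\<And>b. b \<in> Basis \<Longrightarrow> ubd J S (D b)"
    and D: "\<And>b. b \<in> Basis \<Longrightarrow> ulipC k J S (D b)"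
  shows "ulipC (Suc k) J S f"
proof -
  have "\<forall>b\<in>Basis. \<exists>A\<ge>0. \<forall>i\<in>J. \<forall>x\<in>S i. \<forall>y\<in>S i. norm (D b i y - D b i x) \<le> A * norm (y - x)"
    using ulipC_0E[OF ulipC_imp_0[OF D]] by metis
  from bchoice[OF this] obtain A where A: "\<And>b. b \<in> Basis \<Longrightarrow> A b \<ge> 0"
    "\<And>b i x y. b \<in> Basis \<Longrightarrow> i \<in> J \<Longrightarrow> x \<in> S i \<Longrightarrow> y \<in> S i \<Longrightarrow> norm (D b i y - D b i x) \<le> A b * norm (y - x)"
    by blast
  show ?thesis
  proof (rule ulipC_SucI[where D = D, OF _ utaylorI[where M = "\<Sum>b\<in>Basis. A b"]])
    show "ubd J S (D b)" "ulipC k J S (D b)" if "b \<in> Basis" for b by (rule bd[OF that], rule D[OF that])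
    show "ulipC 0 J S f" by (rule ulipC_0_convexI[OF conv der bd])
    fix i x y assume *: "i \<in> J" "x \<in> S i" "y \<in> S i"
    have seg: "closed_segment x y \<subseteq> S i" using conv[OF *(1)] * by (simp add: convex_contains_segment)
    have "norm (f i y - f i x - (\<Sum>b\<in>Basis. ((y - x) \<bullet> b) *\<^sub>R D b i x))
      \<le> norm (y - x) * (\<Sum>b\<in>Basis. A b * norm (y - x))"
    proof (rule differentiable_bound_linearization[where S = "closed_segment x y" and ?x0.0 = x
          and f' = "\<lambda>x h. \<Sum>b\<in>Basis. (h \<bullet> b) *\<^sub>R D b i x"])
      show "x + t *\<^sub>R (y - x) \<in> closed_segment x y" if "t \<in> {0..1}" for t
      proof -
        have "x + t *\<^sub>R (y - x) = (1 - t) *\<^sub>R x + t *\<^sub>R y" by (simp add: algebra_simps)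
        then show ?thesis using that unfolding closed_segment_def by auto
      qed
      show "(f i has_derivative (\<lambda>h. \<Sum>b\<in>Basis. (h \<bullet> b) *\<^sub>R D b i z)) (at z within closed_segment x y)"
        if "z \<in> closed_segment x y" for z
        by (rule has_derivative_subset[OF der[OF *(1)] seg]) (use that seg in auto)
      fix z assume z: "z \<in> closed_segment x y"
      have "(\<lambda>h. \<Sum>b\<in>Basis. (h \<bullet> b) *\<^sub>R D b i z) - (\<lambda>h. \<Sum>b\<in>Basis. (h \<bullet> b) *\<^sub>R D b i x)
        = (\<lambda>h. \<Sum>b\<in>Basis. (h \<bullet> b) *\<^sub>R (D b i z - D b i x))"
        by (simp add: fun_eq_iff scaleR_diff_right sum_subtractf)
      moreover have "onorm \<dots> \<le> (\<Sum>b\<in>Basis. A b * norm (y - x))"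
      proof (rule onorm_coordinates_le)
        fix b :: 'b assume b: "b \<in> Basis"
        have "norm (D b i z - D b i x) \<le> A b * norm (z - x)" using A(2) b * z seg by blast
        also have "\<dots> \<le> A b * norm (y - x)"
          using segment_bound(1)[OF z] A(1)[OF b] by (simp add: mult_left_mono norm_minus_commute)
        finally show "norm (D b i z - D b i x) \<le> A b * norm (y - x)" .
      qed
      ultimately show "onorm ((\<lambda>h. \<Sum>b\<in>Basis. (h \<bullet> b) *\<^sub>R D b i z) - (\<lambda>h. \<Sum>b\<in>Basis. (h \<bullet> b) *\<^sub>R D b i x))
          \<le> (\<Sum>b\<in>Basis. A b * norm (y - x))" by simp
    qed simp
    also have "\<dots> = (\<Sum>b\<in>Basis. A b) * (norm (y - x))\<^sup>2"
      by (simp add: sum_distrib_right sum_distrib_left power2_eq_square mult_ac)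
    finally show "norm (f i y - f i x - (\<Sum>b\<in>Basis. ((y - x) \<bullet> b) *\<^sub>R D b i x)) \<le> (\<Sum>b\<in>Basis. A b) * (norm (y - x))\<^sup>2" .
  qed
qed

lemma ulipC_real_convexI:
  fixes f :: "'i \<Rightarrow> real \<Rightarrow> real"
  assumes conv: "\<And>i. i \<in> J \<Longrightarrow> convex (S i)"
    and der: "\<And>i x. i \<in> J \<Longrightarrow> x \<in> S i \<Longrightarrow> (f i has_real_derivative D i x) (at x within S i)"
    and bd: "ubd J S D"
    and D: "k > 0 \<Longrightarrow> ulipC (k - 1) J S D"
  shows "ulipC k J S f"
proof -
  have der': "(f i has_derivative (\<lambda>h. \<Sum>b\<in>Basis. (h \<bullet> b) *\<^sub>R D i x)) (at x within S i)"
    if "i \<in> J" "x \<in> S i" for i x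
    using der[OF that] by (simp add: has_field_derivative_def mult.commute[of _ "D i x"])
  show ?thesis
  proof (cases k)
    case 0
    show ?thesis unfolding 0 by (rule ulipC_0_convexI[where D = "\<lambda>b. D", OF conv der' bd])
  next
    case (Suc k')
    show ?thesis unfolding Suc
      by (rule ulipC_Suc_convexI[where D = "\<lambda>b. D", OF conv der' bd]) (use D Suc in auto)
  qed
qed

text \<open>One order is spent: on a convex set the bound on the derivatives of order
  \<open>Suc k\<close> is a Lipschitz constant for those of order \<open>k\<close>.\<close>

lemma Cb_on_imp_ulipC:
  fixes f :: "'a::euclidean_space \<Rightarrow> 'b::real_normed_vector"
  assumes "convex S" "Cb_on (Suc k) f S"
  shows "ulipC k J (\<lambda>_. S) (\<lambda>_. f)"
  using assms(2)
proof (induction k arbitrary: f)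
  have bdd: "bounded (f ` S)" if "Cb_on k f S" for k and f :: "'a \<Rightarrow> 'b"
    using that by (cases k) auto
  have ubd: "ubd J (\<lambda>_. S) (\<lambda>_. f)" if "Cb_on k f S" for k and f :: "'a \<Rightarrow> 'b"
    using bdd[OF that] unfolding ubd_def bounded_iff by auto
  {
    case 0
    then obtain D where D: "\<forall>x\<in>S. (f has_derivative (\<lambda>h. \<Sum>b\<in>Basis. (h \<bullet> b) *\<^sub>R D b x)) (at x within S)"
      "\<forall>b\<in>Basis. Cb_on 0 (D b) S" unfolding Cb_on.simps(2) by (elim conjE exE) (rule that)
    show ?case
    proof (rule ulipC_0_convexI[where D = "\<lambda>b _. D b"])
      show "ubd J (\<lambda>_. S) (\<lambda>_. D b)" if "b \<in> Basis" for b by (rule ubd) (use D(2) that in blast)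
    qed (use assms(1) D(1) in auto)
  next
    case (Suc k)
    then obtain D where D: "\<forall>x\<in>S. (f has_derivative (\<lambda>h. \<Sum>b\<in>Basis. (h \<bullet> b) *\<^sub>R D b x)) (at x within S)"
      "\<forall>b\<in>Basis. Cb_on (Suc k) (D b) S" unfolding Cb_on.simps(2)[of "Suc k"] by (elim conjE exE) (rule that)
    show ?case
    proof (rule ulipC_Suc_convexI[where D = "\<lambda>b _. D b"])
      show "ubd J (\<lambda>_. S) (\<lambda>_. D b)" if "b \<in> Basis" for b by (rule ubd) (use D(2) that in blast)
      show "ulipC k J (\<lambda>_. S) (\<lambda>_. D b)" if "b \<in> Basis" for b by (rule Suc.IH) (use D(2) that in blast)
    qed (use assms(1) D(1) in auto)
  }
qed

lemma has_derivative_if_quadratic: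
  fixes f :: "'a::euclidean_space \<Rightarrow> 'b::real_normed_vector"
  assumes "\<And>y. y \<in> S \<Longrightarrow> norm (f y - f x - (\<Sum>b\<in>Basis. ((y - x) \<bullet> b) *\<^sub>R D b x)) \<le> M * (norm (y - x))\<^sup>2"
  shows "(f has_derivative (\<lambda>h. \<Sum>b\<in>Basis. (h \<bullet> b) *\<^sub>R D b x)) (at x within S)"
proof (rule has_derivativeI_sandwich[where e = 1 and H = "\<lambda>y. M * norm (y - x)"])
  show "bounded_linear (\<lambda>h. \<Sum>b\<in>Basis. (h \<bullet> b) *\<^sub>R D b x)"
    by (intro bounded_linear_sum bounded_linear_scaleR_const bounded_linear_inner_left)
  have "((\<lambda>y. M * norm (y - x)) \<longlongrightarrow> M * norm (x - x)) (at x within S)"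
    by (intro tendsto_intros)
  then show "((\<lambda>y. M * norm (y - x)) \<longlongrightarrow> 0) (at x within S)" by simp
  fix y assume y: "y \<in> S" "y \<noteq> x"
  have "norm (f y - f x - (\<Sum>b\<in>Basis. ((y - x) \<bullet> b) *\<^sub>R D b x)) / norm (y - x) \<le> M * (norm (y - x))\<^sup>2 / norm (y - x)"
    by (rule divide_right_mono[OF assms[OF y(1)]]) simp
  then show "norm (f y - f x - (\<Sum>b\<in>Basis. ((y - x) \<bullet> b) *\<^sub>R D b x)) / norm (y - x) \<le> M * norm (y - x)"
    using y by (simp add: power2_eq_square)
qed simp

text \<open>Boundedness is a separate hypothesis only for \<open>f\<close> itself;
  \<open>lipC\<close> already bounds all derivatives, so the induction supplies it below the top
  level.\<close>

lemma lipC_imp_CLip_on: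
  assumes "lipC k M S f" "bounded (f ` S)"
  shows "CLip_on k f S"
  using assms
proof (induction k arbitrary: f)
  case 0
  \<comment> \<open>\<open>lipschitz_on\<close> demands a nonnegative constant, while
    \<open>M\<close> may be negative when \<open>S\<close> has at most one point.\<close>
  then have "lipC 0 (max M 0) S f" using lipC_mono max.cobounded1 by blast
  then have "(max M 0)-lipschitz_on S f"
    by (intro lipschitz_onI) (auto simp: dist_norm simp del: max.bounded_iff)
  then show ?case using 0 by auto
next
  case (Suc k)
  then obtain D where D: "\<And>x y. x \<in> S \<Longrightarrow> y \<in> S \<Longrightarrow> norm (f y - f x - (\<Sum>b\<in>Basis. ((y - x) \<bullet> b) *\<^sub>R D b x))
               \<le> M * (norm (y - x))\<^sup>2"
      "\<And>b x. b \<in> Basis \<Longrightarrow> x \<in> S \<Longrightarrow> norm (D b x) \<le> M" "\<And>b. b \<in> Basis \<Longrightarrow> lipC k M S (D b)"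
    unfolding lipC.simps by blast
  have "(f has_derivative (\<lambda>h. \<Sum>b\<in>Basis. (h \<bullet> b) *\<^sub>R D b x)) (at x within S)" if x: "x \<in> S" for x
    by (rule has_derivative_if_quadratic) (rule D(1)[OF x])
  moreover have "CLip_on k (D b) S" if b: "b \<in> Basis" for b
    by (rule Suc.IH[OF D(3)[OF b]]) (use D(2)[OF b] in \<open>auto simp: bounded_iff\<close>)
  ultimately show ?case using Suc.prems(2) by auto
qed

text \<open>Here the constant stays explicit, because a small factor has to bring a given bound
  below 1; the existential constant in \<open>ulipC\<close> would hide this.\<close>

lemma lipC_scaleR_const:
  assumes "lipC k M S f"
  shows "lipC k (\<bar>c\<bar> * M) S (\<lambda>x. c *\<^sub>R f x)"
  using assms
proof (induction k arbitrary: f)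
  have lip: "lipC 0 (\<bar>c\<bar> * M) S (\<lambda>x. c *\<^sub>R f x)" if f: "lipC 0 M S f" for f :: "'a \<Rightarrow> 'b"
    unfolding lipC.simps
  proof (intro ballI)
    fix x y assume "x \<in> S" "y \<in> S"
    then have "norm (f y - f x) \<le> M * norm (y - x)" using f by simp
    then have "\<bar>c\<bar> * norm (f y - f x) \<le> \<bar>c\<bar> * (M * norm (y - x))" by (rule mult_left_mono) simp
    then show "norm (c *\<^sub>R f y - c *\<^sub>R f x) \<le> \<bar>c\<bar> * M * norm (y - x)"
      by (simp add: scaleR_diff_right[symmetric] mult.assoc)
  qed
  {
    case 0
    then show ?case by (rule lip)
  next
    case (Suc k)
    then obtain D where D: "\<And>x y. x \<in> S \<Longrightarrow> y \<in> S \<Longrightarrow> norm (f y - f x - (\<Sum>b\<in>Basis. ((y - x) \<bullet> b) *\<^sub>R D b x))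
                 \<le> M * (norm (y - x))\<^sup>2"
        "\<And>b x. b \<in> Basis \<Longrightarrow> x \<in> S \<Longrightarrow> norm (D b x) \<le> M" "\<And>b. b \<in> Basis \<Longrightarrow> lipC k M S (D b)"
      unfolding lipC.simps by blast
    show ?case
      unfolding lipC.simps(2)
    proof (intro conjI exI[of _ "\<lambda>b x. c *\<^sub>R D b x"] ballI)
      fix x y assume xy: "x \<in> S" "y \<in> S"
      show "norm (c *\<^sub>R f y - c *\<^sub>R f x) \<le> \<bar>c\<bar> * M * norm (y - x)"
        using lip[OF lipC_lip[OF Suc.prems]] xy by simp
      have "c *\<^sub>R f y - c *\<^sub>R f x - (\<Sum>b\<in>Basis. ((y - x) \<bullet> b) *\<^sub>R c *\<^sub>R D b x)
        = c *\<^sub>R (f y - f x - (\<Sum>b\<in>Basis. ((y - x) \<bullet> b) *\<^sub>R D b x))"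
        by (simp add: scaleR_diff_right scaleR_sum_right mult.commute)
      also have "norm \<dots> \<le> \<bar>c\<bar> * (M * (norm (y - x))\<^sup>2)"
        unfolding norm_scaleR by (rule mult_left_mono[OF D(1)[OF xy]]) simp
      finally show "norm (c *\<^sub>R f y - c *\<^sub>R f x - (\<Sum>b\<in>Basis. ((y - x) \<bullet> b) *\<^sub>R c *\<^sub>R D b x))
          \<le> \<bar>c\<bar> * M * (norm (y - x))\<^sup>2" by (simp only: mult.assoc)
    next
      fix b :: 'a and x assume "b \<in> Basis" "x \<in> S"
      then show "norm (c *\<^sub>R D b x) \<le> \<bar>c\<bar> * M" using D(2) by (simp add: mult_left_mono)
    next
      fix b :: 'a assume "b \<in> Basis"
      then show "lipC k (\<bar>c\<bar> * M) S (\<lambda>x. c *\<^sub>R D b x)" using D(3) Suc.IH by blast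
    qed
  }
qed

text \<open>The derivative is minus the square of the function itself, so each order follows from
  the preceding one by the product rule. The distance \<open>c\<close> from zero makes the bounds
  uniform.\<close>

lemma
  assumes "c > 0"
  shows ulipC_inverse: "ulipC k J (\<lambda>_. {c..}) (\<lambda>_ x::real. inverse x)" and ubd_inverse: "ubd J (\<lambda>_. {c..}) (\<lambda>_ x::real. inverse x)"
proof -
  show ub: "ubd J (\<lambda>_. {c..}) (\<lambda>_ x::real. inverse x)"
    by (rule ubdI[of _ _ _ "inverse c"]) (use assms in \<open>auto intro: le_imp_inverse_le\<close>)
  have ub2: "ubd J (\<lambda>_. {c..}) (\<lambda>_ x::real. - (inverse x *\<^sub>R inverse x))"
    by (intro ubd_linear[OF _ bounded_linear_minus[OF bounded_linear_ident]] ubd_scaleR ub)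
  show "ulipC k J (\<lambda>_. {c..}) (\<lambda>_ x::real. inverse x)"
  proof (induction k)
    case 0
    show ?case
      by (rule ulipC_real_convexI[where D = "\<lambda>_ x. - (inverse x *\<^sub>R inverse x)", OF _ _ ub2])
        (use assms in \<open>auto intro!: derivative_eq_intros\<close>)
  next
    case (Suc k)
    have *: "ulipC k J (\<lambda>_. {c..}) (\<lambda>_ x::real. - (inverse x *\<^sub>R inverse x))"
      by (intro ulipC_linear[OF _ bounded_linear_minus[OF bounded_linear_ident]] ulipC_scaleR Suc ub)
    show ?case
      by (rule ulipC_real_convexI[where D = "\<lambda>_ x. - (inverse x *\<^sub>R inverse x)", OF _ _ ub2])
        (use assms * in \<open>auto intro!: derivative_eq_intros\<close>)
  qed
qed

lemma ubd_exp: "ubd J (\<lambda>_. {..c}) (\<lambda>_ x::real. exp x)"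
  by (rule ubdI[of _ _ _ "exp c"]) auto

lemma ulipC_exp: "ulipC k J (\<lambda>_. {..c}) (\<lambda>_ x::real. exp x)"
proof (induction k)
  case 0
  show ?case
    by (rule ulipC_real_convexI[where D = "\<lambda>_ x. exp x", OF _ _ ubd_exp]) (auto intro!: derivative_eq_intros)
next
  case (Suc k)
  show ?case
    by (rule ulipC_real_convexI[where D = "\<lambda>_ x. exp x", OF _ _ ubd_exp])
      (use Suc in \<open>auto intro!: derivative_eq_intros\<close>)
qed

section \<open>Analytic parameterizations\<close>

text \<open>Uniformity in the exponent is the point: differentiation produces a factor
  \<open>n\<close>, which is absorbed by enlarging the growth rate \<open>R\<close> of the
  coefficients. On an interval of radius 1/2 every rate below 2 still leaves bounded terms.\<close>

lemma ulipC_power: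
  assumes "1 \<le> R" "R < 2" "C \<ge> 0"
  shows "ulipC k {q :: nat \<times> real. \<bar>snd q\<bar> \<le> C * R ^ fst q} (\<lambda>_. {-1/2..1/2}) (\<lambda>q x. snd q * x ^ fst q)"
  using assms
proof (induction k arbitrary: R C rule: less_induct)
  case (less k)
  let ?J = "{q :: nat \<times> real. \<bar>snd q\<bar> \<le> C * R ^ fst q}"
  let ?S = "\<lambda>_ :: nat \<times> real. {-1/2..1/2 :: real}"
  let ?D = "\<lambda>q x :: real. (snd q * real (fst q)) * x ^ (fst q - 1)"
  \<comment> \<open>The midpoint between \<open>R\<close> and 2, so that there is again room for the
    next differentiation.\<close>
  define R' where "R' = (R + 2) / 2"
  have R': "1 \<le> R'" "R < R'" "R' < 2" using less.prems by (auto simp: R'_def)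
  have "Bseq (\<lambda>n. real n * (R / R') ^ n)"
    by (rule convergent_imp_Bseq, rule convergentI, rule powser_times_n_limit_0) (use R' less.prems in auto)
  then obtain B where B: "B > 0" "\<And>n. real n * (R / R') ^ n \<le> B"
    using R' less.prems unfolding Bseq_def by (auto dest: spec order_trans[OF abs_ge_self])
  define C' where "C' = C * B * R'"
  have C': "C' \<ge> 0" using B R' less.prems by (simp add: C'_def)
  have coeff: "\<bar>c * real n\<bar> \<le> C' * R' ^ (n - 1)" if c: "\<bar>c\<bar> \<le> C * R ^ n" for c :: real and n
  proof (cases n)
    case 0
    then show ?thesis using C' by simp
  next
    case (Suc m)
    have "\<bar>c * real n\<bar> \<le> C * R ^ n * real n" using c by (simp add: abs_mult mult_right_mono)
    also have "\<dots> = C * (real n * (R / R') ^ n) * R' ^ n" using R' by (simp add: power_divide)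
    also have "\<dots> \<le> C * B * R' ^ n"
      using B(2)[of n] less.prems(3) R' by (intro mult_right_mono mult_left_mono) auto
    finally show ?thesis by (simp add: Suc C'_def mult_ac)
  qed
  have hp: "\<bar>c * x ^ n\<bar> \<le> A" if "\<bar>c\<bar> \<le> A * R' ^ n" "x \<in> {-1/2..1/2}" "A \<ge> 0" for c x A :: real and n
  proof -
    have "\<bar>x\<bar> \<le> 1 / 2" using that(2) by auto
    then have "\<bar>x\<bar> ^ n \<le> (1 / 2) ^ n" by (rule power_mono) simp
    then have "\<bar>c * x ^ n\<bar> \<le> (A * R' ^ n) * (1 / 2) ^ n"
      unfolding abs_mult power_abs using that R' by (intro mult_mono) auto
    also have "\<dots> = A * (R' / 2) ^ n" by (simp add: power_divide)
    also have "\<dots> \<le> A * 1" using R' that(3) by (intro mult_left_mono power_le_one) auto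
    finally show ?thesis by simp
  qed
  show ?case
  proof (rule ulipC_real_convexI[where D = ?D])
    show "((\<lambda>x. snd q * x ^ fst q) has_real_derivative ?D q x) (at x within {-1/2..1/2})" for q :: "nat \<times> real" and x
      by (auto intro!: derivative_eq_intros simp: mult_ac)
    show "ubd ?J ?S ?D"
      by (rule ubdI[of _ _ _ C']) (use hp coeff C' in auto)
    show "ulipC (k - 1) ?J ?S ?D" if "k > 0"
      \<comment> \<open>The derivative is a monomial of the same kind with new index. For exponent 0
        the truncated \<open>fst q - 1\<close> is harmless, as the new coefficient is then
        zero.\<close>
      by (rule ulipC_reindex[OF less.IH[of "k - 1" R' C'], of _ "\<lambda>q. (fst q - 1, snd q * real (fst q))"])
        (use that R' C' coeff in auto)
  qed auto
qed

text \<open>Each term is split into a summable weight \<open>c n\<close> and a normalized monomial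
  \<open>m n\<close> in variables of modulus at most 1/2. The monomials form one uniform family, so
  the partial sums do too, and \<open>ulipC_lim\<close> passes to the sum without termwise
  differentiation.\<close>

lemma power_series_ulipC:
  fixes f :: "real \<times> real \<Rightarrow> real \<times> real"
  assumes "\<rho> > 0"
    and sums: "\<And>x. \<bar>fst x - fst p\<bar> \<le> \<rho> \<Longrightarrow> \<bar>snd x - snd p\<bar> \<le> \<rho> \<Longrightarrow>
      ((\<lambda>(i, j). ((fst x - fst p) ^ i * (snd x - snd p) ^ j) *\<^sub>R a (i, j)) has_sum f x) UNIV"
    and box: "\<And>x. x \<in> U \<Longrightarrow> \<bar>fst x - fst p\<bar> \<le> \<rho> / 2 \<and> \<bar>snd x - snd p\<bar> \<le> \<rho> / 2" and "open U"
  shows "ulipC k {()} (\<lambda>_. U) (\<lambda>_. f)"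
proof -
  define c where "c = (\<lambda>(i, j). \<rho> ^ (i + j) * norm (a (i, j)))"
  have c0: "c n \<ge> 0" for n using assms(1) by (auto simp: c_def split: prod.split)
  \<comment> \<open>At the corner of the square the series is summed with the largest monomials; its
    absolute summability, obtained from the two real components, provides the weights.\<close>
  have "((\<lambda>(i, j). (\<rho> ^ i * \<rho> ^ j) *\<^sub>R a (i, j)) has_sum f (p + (\<rho>, \<rho>))) UNIV"
    using sums[of "p + (\<rho>, \<rho>)"] assms(1) by simp
  then have "((\<lambda>n. (\<rho> ^ (fst n + snd n)) *\<^sub>R a n) has_sum f (p + (\<rho>, \<rho>))) UNIV"
    by (simp only: case_prod_beta' power_add prod.collapse)
  then have s: "(\<lambda>n. (\<rho> ^ (fst n + snd n)) *\<^sub>R a n) summable_on UNIV"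
    by (rule has_sum_imp_summable)
  have "(\<lambda>n. \<bar>fst ((\<rho> ^ (fst n + snd n)) *\<^sub>R a n)\<bar>) summable_on UNIV"
    "(\<lambda>n. \<bar>snd ((\<rho> ^ (fst n + snd n)) *\<^sub>R a n)\<bar>) summable_on UNIV"
    using summable_on_bounded_linear[OF bounded_linear_fst s, THEN summable_on_iff_abs_summable_on_real[THEN iffD1]]
      summable_on_bounded_linear[OF bounded_linear_snd s, THEN summable_on_iff_abs_summable_on_real[THEN iffD1]]
    by (simp_all only: real_norm_def)
  from summable_on_add[OF this] have s2: "(\<lambda>n. \<bar>fst ((\<rho> ^ (fst n + snd n)) *\<^sub>R a n)\<bar> + \<bar>snd ((\<rho> ^ (fst n + snd n)) *\<^sub>R a n)\<bar>) summable_on UNIV" .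
  have cle: "c n \<le> \<bar>fst ((\<rho> ^ (fst n + snd n)) *\<^sub>R a n)\<bar> + \<bar>snd ((\<rho> ^ (fst n + snd n)) *\<^sub>R a n)\<bar>" for n
  proof -
    have "c n = norm ((\<rho> ^ (fst n + snd n)) *\<^sub>R a n)" using assms(1) by (simp add: c_def case_prod_beta)
    then show ?thesis by (simp add: norm_prod_def sqrt_sum_squares_le_sum_abs)
  qed
  obtain C where C: "\<And>F. finite F \<Longrightarrow> (\<Sum>n\<in>F. c n) \<le> C"
  proof
    fix F :: "(nat \<times> nat) set" assume F: "finite F"
    have "(\<Sum>n\<in>F. c n) \<le> (\<Sum>n\<in>F. \<bar>fst ((\<rho> ^ (fst n + snd n)) *\<^sub>R a n)\<bar> + \<bar>snd ((\<rho> ^ (fst n + snd n)) *\<^sub>R a n)\<bar>)"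
      by (rule sum_mono) (rule cle)
    also have "\<dots> \<le> (\<Sum>\<^sub>\<infinity>n. \<bar>fst ((\<rho> ^ (fst n + snd n)) *\<^sub>R a n)\<bar> + \<bar>snd ((\<rho> ^ (fst n + snd n)) *\<^sub>R a n)\<bar>)"
      by (rule finite_sum_le_infsum[OF s2 F]) auto
    finally show "(\<Sum>n\<in>F. c n) \<le> (\<Sum>\<^sub>\<infinity>n. \<bar>fst ((\<rho> ^ (fst n + snd n)) *\<^sub>R a n)\<bar> + \<bar>snd ((\<rho> ^ (fst n + snd n)) *\<^sub>R a n)\<bar>)" .
  qed
  define X where "X = (\<lambda>x :: real \<times> real. (fst x - fst p) / \<rho>)"
  define Z where "Z = (\<lambda>x :: real \<times> real. (snd x - snd p) / \<rho>)"
  \<comment> \<open>The unit vector \<open>sgn (a n)\<close> carries the direction of the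
    coefficient and the weight its length; zero coefficients are covered by
    \<open>sgn 0 = 0\<close>.\<close>
  define m where "m = (\<lambda>n x. (X x ^ fst n * Z x ^ snd n) *\<^sub>R sgn (a n))"
  have XZ: "X x \<in> {-1/2..1/2}" "Z x \<in> {-1/2..1/2}" if "x \<in> U" for x
    using box[OF that] assms(1) by ((auto simp: X_def Z_def field_simps; linarith)+)
  define J where "J = (UNIV :: (nat \<times> nat) set) \<times> {()}"
  have lX: "ulipC k J (\<lambda>_. U) (\<lambda>_. X)"
  proof -
    have "ulipC k J (\<lambda>_. U) (\<lambda>_ x. (1 / \<rho>) *\<^sub>R fst x + (- (fst p / \<rho>)))"
      by (intro ulipC_add ulipC_const ulipC_linear_map bounded_linear_scaleR_right[THEN bounded_linear_compose] bounded_linear_fst)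
    then show ?thesis by (simp add: X_def diff_divide_distrib)
  qed
  have lZ: "ulipC k J (\<lambda>_. U) (\<lambda>_. Z)"
  proof -
    have "ulipC k J (\<lambda>_. U) (\<lambda>_ x. (1 / \<rho>) *\<^sub>R snd x + (- (snd p / \<rho>)))"
      by (intro ulipC_add ulipC_const ulipC_linear_map bounded_linear_scaleR_right[THEN bounded_linear_compose] bounded_linear_snd)
    then show ?thesis by (simp add: Z_def diff_divide_distrib)
  qed
  have pw: "ulipC k J (\<lambda>_. {-1/2..1/2 :: real}) (\<lambda>q x. x ^ g q)" for g :: "(nat \<times> nat) \<times> unit \<Rightarrow> nat"
    by (rule ulipC_reindex[OF ulipC_power[of 1 1 k], of _ "\<lambda>q. (g q, 1)"]) auto
  have pwb: "ubd J (\<lambda>_. {-1/2..1/2}) (\<lambda>q x. x ^ g q :: real)" for g :: "(nat \<times> nat) \<times> unit \<Rightarrow> nat"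
    by (rule ubdI[of _ _ _ 1]) (auto simp: power_abs intro!: power_le_one)
  have lm: "ulipC k J (\<lambda>_. U) (\<lambda>q. m (fst q))"
  proof -
    have 1: "ulipC k J (\<lambda>_. U) (\<lambda>q x. X x ^ fst (fst q))" "ulipC k J (\<lambda>_. U) (\<lambda>q x. Z x ^ snd (fst q))"
      by (rule ulipC_compose[OF pw lX], use XZ in blast, rule ulipC_compose[OF pw lZ], use XZ in blast)
    have 2: "ubd J (\<lambda>_. U) (\<lambda>q x. X x ^ fst (fst q))" "ubd J (\<lambda>_. U) (\<lambda>q x. Z x ^ snd (fst q))"
      by (rule ubd_compose[OF pwb], use XZ in blast, rule ubd_compose[OF pwb], use XZ in blast)
    have "ulipC k J (\<lambda>_. U) (\<lambda>q x. (X x ^ fst (fst q) *\<^sub>R Z x ^ snd (fst q)) *\<^sub>R sgn (a (fst q)))"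
      by (intro ulipC_scaleR ubd_scaleR 1 2 ulipC_const) (auto intro!: ubdI[of _ _ _ 1] simp: norm_sgn)
    then show ?thesis by (simp add: m_def)
  qed
  show ?thesis
  proof (rule ulipC_lim)
    show "ulipC k (UNIV \<times> {()}) (\<lambda>_. U) (\<lambda>q x. \<Sum>n\<in>{..<fst q} \<times> {..<fst q}. c n *\<^sub>R m n x)"
      using ulipC_weighted_sum[of k UNIV "{()}" "\<lambda>_. U" "\<lambda>n _. m n" UNIV "\<lambda>N. {..<N} \<times> {..<N}" "\<lambda>_ n. n" "\<lambda>_. c" C]
        lm C c0 by (simp add: J_def)
    fix x assume x: "x \<in> U"
    have t: "c n *\<^sub>R m n x = ((fst x - fst p) ^ fst n * (snd x - snd p) ^ snd n) *\<^sub>R a n" for n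
      using assms(1) by (cases "a n = 0")
        (simp_all add: c_def m_def X_def Z_def case_prod_beta power_divide power_add sgn_div_norm)
    have "((\<lambda>n. c n *\<^sub>R m n x) has_sum f x) UNIV"
      using sums[of x] box[OF x] assms(1) unfolding t case_prod_beta' prod.collapse by simp
    \<comment> \<open>Squares of indices eventually contain every finite set, so the unordered sum
      is also the limit along this sequence.\<close>
    moreover have "filterlim (\<lambda>N. {..<N} \<times> {..<N} :: (nat \<times> nat) set) (finite_subsets_at_top UNIV) sequentially"
      unfolding filterlim_finite_subsets_at_top
    proof (intro allI impI)
      fix F :: "(nat \<times> nat) set" assume F: "finite F \<and> F \<subseteq> UNIV"
      obtain N where N: "\<And>n. n \<in> fst ` F \<union> snd ` F \<Longrightarrow> n < N"
        using F finite_nat_set_iff_bounded[of "fst ` F \<union> snd ` F"] by auto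
      show "\<forall>\<^sub>F y in sequentially. finite ({..<y} \<times> {..<y} :: (nat \<times> nat) set) \<and> F \<subseteq> {..<y} \<times> {..<y} \<and> {..<y} \<times> {..<y} \<subseteq> (UNIV :: (nat \<times> nat) set)"
        using eventually_ge_at_top[of N]
        by eventually_elim (use N in \<open>force intro: less_le_trans\<close>)
    qed
    ultimately show "(\<lambda>N. \<Sum>n\<in>{..<N} \<times> {..<N}. c n *\<^sub>R m n x) \<longlonglongrightarrow> f x"
      unfolding has_sum_def by (rule filterlim_compose)
  qed (use assms(4) in auto)
qed

section \<open>From local to uniform regularity by periodicity\<close>

lemma periodic_add_int:
  fixes f :: "real \<times> real \<Rightarrow> 'b"
  assumes "\<And>\<theta>. f (\<theta> + 1, s) = f (\<theta>, s)"
  shows "f (\<theta> + of_int n, s) = f (\<theta>, s)"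
proof (induction n rule: int_induct[where k = 0])
  case (step1 i)
  then show ?case using assms[of "\<theta> + of_int i"] by (simp add: add.assoc)
next
  case (step2 i)
  then show ?case using assms[of "\<theta> + of_int (i - 1)"] by (simp add: add.assoc)
qed simp

text \<open>Compactness of one period of the closed half-width strip bounds the function, and
  periodicity extends the bound. Locality and periodicity pass to the Frechet derivatives, so the
  same holds for them, and convexity of the strip then yields Taylor estimates also for distant
  points. The hypotheses live on the wider open strip so that all derivatives are two-sided.\<close>

lemma ulipC_periodic_if_local:
  fixes f :: "real \<times> real \<Rightarrow> 'b::banach"
  assumes "\<forall>x\<in>UNIV \<times> {-1<..<1}. \<exists>U. open U \<and> x \<in> U \<and> (\<forall>k. ulipC k {()} (\<lambda>_. U) (\<lambda>_. f))"
    and "\<forall>\<theta>. \<forall>s\<in>{-1<..<1}. f (\<theta> + 1, s) = f (\<theta>, s)"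
  shows "ulipC k J (\<lambda>_. UNIV \<times> {-1/2..1/2}) (\<lambda>_. f) \<and> ubd J (\<lambda>_. UNIV \<times> {-1/2..1/2}) (\<lambda>_. f)"
  using assms
proof (induction k arbitrary: f)
  let ?O = "UNIV \<times> {-1<..<1} :: (real \<times> real) set" and ?S = "UNIV \<times> {-1/2..1/2} :: (real \<times> real) set"
  have SO: "?S \<subseteq> ?O" by auto
  have ub: "ubd J (\<lambda>_. ?S) (\<lambda>_. f)"
    if loc: "\<forall>x\<in>?O. \<exists>U. open U \<and> x \<in> U \<and> (\<forall>k. ulipC k {()} (\<lambda>_. U) (\<lambda>_. f))"
      and per: "\<forall>\<theta>. \<forall>s\<in>{-1<..<1}. f (\<theta> + 1, s) = f (\<theta>, s)" for f :: "real \<times> real \<Rightarrow> 'b"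
  proof -
    have "isCont f x" if x: "x \<in> ?O" for x
    proof -
      obtain U where U: "open U" "x \<in> U" "\<And>k. ulipC k {()} (\<lambda>_. U) (\<lambda>_. f)" using bspec[OF loc x] by (elim exE conjE) (rule that, auto)
      obtain M where M: "M \<ge> 0" "\<And>i x y. i \<in> {()} \<Longrightarrow> x \<in> U \<Longrightarrow> y \<in> U \<Longrightarrow> norm (f y - f x) \<le> M * norm (y - x)"
        by (rule ulipC_0E[OF U(3)]) (rule that)
      have "M-lipschitz_on U f" using M by (auto intro!: lipschitz_onI simp: dist_norm)
      then have "continuous_on U f" by (rule lipschitz_on_continuous_on)
      then show ?thesis using U continuous_on_eq_continuous_at by blast
    qed
    then have "continuous_on ({0..1} \<times> {-1/2..1/2}) f"
      by (intro continuous_at_imp_continuous_on) auto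
    then have "compact (f ` ({0..1} \<times> {-1/2..1/2}))"
      by (rule compact_continuous_image) (auto intro: compact_Times)
    then obtain B where B: "\<And>x. x \<in> {0..1} \<times> {-1/2..1/2} \<Longrightarrow> norm (f x) \<le> B"
      using compact_imp_bounded bounded_iff by (metis imageI)
    show ?thesis
    proof (rule ubdI)
      fix x assume x: "x \<in> ?S"
      obtain \<theta> s where xs: "x = (\<theta>, s)" by (cases x)
      have "f (\<theta>, s) = f (frac \<theta>, s)"
        using periodic_add_int[of f s "frac \<theta>" "\<lfloor>\<theta>\<rfloor>"] per x xs by (simp add: frac_def)
      then show "norm (f x) \<le> B" using B[of "(frac \<theta>, s)"] x xs by (simp add: frac_ge_0 less_imp_le[OF frac_lt_1])
    qed
  qed
  have step: "(f has_derivative (\<lambda>h. \<Sum>b\<in>Basis. (h \<bullet> b) *\<^sub>R frechet_derivative f (at x) b)) (at x)"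
      and loc': "\<And>b. b \<in> Basis \<Longrightarrow> \<exists>U. open U \<and> x \<in> U \<and> (\<forall>k. ulipC k {()} (\<lambda>_. U) (\<lambda>_ x. frechet_derivative f (at x) b))"
    if loc: "\<forall>x\<in>?O. \<exists>U. open U \<and> x \<in> U \<and> (\<forall>k. ulipC k {()} (\<lambda>_. U) (\<lambda>_. f))"
      and x: "x \<in> ?O" for f :: "real \<times> real \<Rightarrow> 'b" and x
  proof -
    obtain U where U: "open U" "x \<in> U" "\<And>k. ulipC k {()} (\<lambda>_. U) (\<lambda>_. f)" using bspec[OF loc x] by (elim exE conjE) (rule that, auto)
    \<comment> \<open>The families obtained for different \<open>k\<close> may differ as functions,
      but on \<open>U\<close> all of them equal the Frechet derivative, which therefore has every
      order.\<close>
    have D: "\<exists>D. (\<forall>z\<in>U. (f has_derivative (\<lambda>h. \<Sum>b\<in>Basis. (h \<bullet> b) *\<^sub>R frechet_derivative f (at z) b)) (at z))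
        \<and> (\<forall>z\<in>U. \<forall>b\<in>Basis. frechet_derivative f (at z) b = D b z)
        \<and> (\<forall>b\<in>Basis. ulipC k {()} (\<lambda>_. U) (\<lambda>_. D b))" for k
    proof -
      obtain D where D: "utaylor {()} (\<lambda>_. U) (\<lambda>_. f) D" "\<And>b. b \<in> Basis \<Longrightarrow> ubd {()} (\<lambda>_. U) (D b)"
        "\<And>b. b \<in> Basis \<Longrightarrow> ulipC k {()} (\<lambda>_. U) (D b)"
        by (rule ulipC_SucE[OF U(3)]) (rule that)
      obtain M where M: "M \<ge> 0" "\<And>i x y. i \<in> {()} \<Longrightarrow> x \<in> U \<Longrightarrow> y \<in> U \<Longrightarrow>
          norm (f y - f x - (\<Sum>b\<in>Basis. ((y - x) \<bullet> b) *\<^sub>R D b i x)) \<le> M * (norm (y - x))\<^sup>2"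
        by (rule utaylorE[OF D(1)]) (rule that)
      have d: "(f has_derivative (\<lambda>h. \<Sum>b\<in>Basis. (h \<bullet> b) *\<^sub>R D b () z)) (at z)" if z: "z \<in> U" for z
        using has_derivative_if_quadratic[of U f z "\<lambda>b. D b ()", OF M(2)[of "()", OF _ z]]
        by (simp add: at_within_open[OF z U(1)])
      have fd: "frechet_derivative f (at z) b = D b () z" if "z \<in> U" "b \<in> Basis" for z b
        using sum_Basis_direction[OF that(2), of 1 "\<lambda>b. D b () z"]
        unfolding frechet_derivative_at[OF d[OF that(1)], symmetric] by simp
      have "(f has_derivative (\<lambda>h. \<Sum>b\<in>Basis. (h \<bullet> b) *\<^sub>R frechet_derivative f (at z) b)) (at z)" if z: "z \<in> U" for z
      proof -
        have "(\<lambda>h. \<Sum>b\<in>Basis. (h \<bullet> b) *\<^sub>R frechet_derivative f (at z) b) = (\<lambda>h. \<Sum>b\<in>Basis. (h \<bullet> b) *\<^sub>R D b () z)"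
          by (intro ext sum.cong refl) (simp only: fd[OF z])
        then show ?thesis using d[OF z] by (simp only:)
      qed
      then show ?thesis using D(3) fd by (intro exI[of _ "\<lambda>b. D b ()"] conjI ballI) (auto simp: unit_eq)
    qed
    show "(f has_derivative (\<lambda>h. \<Sum>b\<in>Basis. (h \<bullet> b) *\<^sub>R frechet_derivative f (at x) b)) (at x)"
      using D[of 0] by (elim exE conjE) (erule bspec, rule U(2))
    show "\<exists>U. open U \<and> x \<in> U \<and> (\<forall>k. ulipC k {()} (\<lambda>_. U) (\<lambda>_ x. frechet_derivative f (at x) b))"
      if b: "b \<in> Basis" for b
    proof (intro exI[of _ U] conjI allI U)
      fix k
      from D[of k] obtain D where "\<forall>z\<in>U. \<forall>b\<in>Basis. frechet_derivative f (at z) b = D b z"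
          "\<forall>b\<in>Basis. ulipC k {()} (\<lambda>_. U) (\<lambda>_. D b)"
        by (elim exE conjE) (rule that)
      with b show "ulipC k {()} (\<lambda>_. U) (\<lambda>_ x. frechet_derivative f (at x) b)"
        using ulipC_reindex[of k "{()}" "\<lambda>_. U" "\<lambda>_. D b" "{()}" "\<lambda>i. i" "\<lambda>_. U"] by simp
    qed
  qed
  have per': "frechet_derivative f (at (\<theta> + 1, s)) b = frechet_derivative f (at (\<theta>, s)) b"
    if loc: "\<forall>x\<in>?O. \<exists>U. open U \<and> x \<in> U \<and> (\<forall>k. ulipC k {()} (\<lambda>_. U) (\<lambda>_. f))"
      and per: "\<forall>\<theta>. \<forall>s\<in>{-1<..<1}. f (\<theta> + 1, s) = f (\<theta>, s)"
      and s: "s \<in> {-1<..<1}" for f :: "real \<times> real \<Rightarrow> 'b" and \<theta> s b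
  proof -
    have "(\<theta> + 1, s) \<in> ?O" using s by simp
    then obtain F where F: "(f has_derivative F) (at (\<theta> + 1, s))" by (rule that[OF step(1)[OF loc]])
    have "((\<lambda>x. f (x + (1, 0))) has_derivative (\<lambda>h. F h)) (at (\<theta>, s))"
      by (rule has_derivative_compose[of "\<lambda>x. x + (1, 0)" "\<lambda>h. h" "(\<theta>, s)" UNIV f F])
        (use F in \<open>auto intro!: derivative_eq_intros\<close>)
    then have "(f has_derivative (\<lambda>h. F h)) (at (\<theta>, s))"
      by (rule has_derivative_transform_within_open[of _ _ _ _ ?O]) (use s per in \<open>auto intro: open_Times\<close>)
    then show ?thesis using frechet_derivative_at[OF F] frechet_derivative_at by metis
  qed
  {
    case 0
    have "ulipC 0 J (\<lambda>_. ?S) (\<lambda>_. f)"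
    proof (rule ulipC_0_convexI[where D = "\<lambda>b _ x. frechet_derivative f (at x) b"])
      show "ubd J (\<lambda>_. ?S) (\<lambda>_ x. frechet_derivative f (at x) b)" if "b \<in> Basis" for b
        by (rule ub) (intro ballI allI loc'[OF 0(1)] per'[OF 0] that; assumption)+
      show "(f has_derivative (\<lambda>h. \<Sum>b\<in>Basis. (h \<bullet> b) *\<^sub>R frechet_derivative f (at x) b)) (at x within ?S)"
        if "x \<in> ?S" for x
        by (rule has_derivative_at_withinI[OF step(1)[OF 0(1)]]) (use that SO in blast)
    qed (auto intro: convex_Times)
    then show ?case using ub[OF 0] by blast
  next
    case (Suc k)
    have IH: "ulipC k J (\<lambda>_. ?S) (\<lambda>_ x. frechet_derivative f (at x) b) \<and> ubd J (\<lambda>_. ?S) (\<lambda>_ x. frechet_derivative f (at x) b)"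
      if "b \<in> Basis" for b
      by (rule Suc.IH) (intro ballI allI loc'[OF Suc.prems(1)] per'[OF Suc.prems] that; assumption)+
    have "ulipC (Suc k) J (\<lambda>_. ?S) (\<lambda>_. f)"
    proof (rule ulipC_Suc_convexI[where D = "\<lambda>b _ x. frechet_derivative f (at x) b"])
      show "(f has_derivative (\<lambda>h. \<Sum>b\<in>Basis. (h \<bullet> b) *\<^sub>R frechet_derivative f (at x) b)) (at x within ?S)"
        if "x \<in> ?S" for x
        by (rule has_derivative_at_withinI[OF step(1)[OF Suc.prems(1)]]) (use that SO in blast)
    qed (use IH in \<open>auto intro: convex_Times\<close>)
    then show ?case using ub[OF Suc.prems] by blast
  }
qed

text \<open>The analytic representative \<open>f\<close> agrees with \<open>K\<close> only on the
  strip, so the expansion is used on squares inside the open strip, where it is an expansion of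
  \<open>K\<close> itself.\<close>

lemma limit_cycle_ulipC:
  assumes "limit_cycle_data X0 \<omega>0 lam0 K"
  shows "ulipC k J (\<lambda>_. UNIV \<times> {-1/2..1/2}) (\<lambda>_. K)"
proof -
  have "\<exists>U. open U \<and> p \<in> U \<and> (\<forall>k. ulipC k {()} (\<lambda>_. U) (\<lambda>_. K))" if p: "p \<in> UNIV \<times> {-1<..<1}" for p
  proof -
    have "p \<in> strip" using p by auto
    have "analytic_local_diffeo_on K strip" using assms by (simp add: limit_cycle_data_def)
    from bspec[OF this[unfolded analytic_local_diffeo_on_def] \<open>p \<in> strip\<close>]
    obtain U f where U: "open U" "p \<in> U" "\<forall>x\<in>U \<inter> strip. f x = K x" "real_analytic_on f U"
      by (elim exE conjE) (rule that)
    from bspec[OF U(4)[unfolded real_analytic_on_def] U(2)]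
    obtain a \<delta> where a: "\<delta> > 0" "\<forall>x\<in>U. \<bar>fst x - fst p\<bar> < \<delta> \<and> \<bar>snd x - snd p\<bar> < \<delta> \<longrightarrow>
      ((\<lambda>(i, j). ((fst x - fst p) ^ i * (snd x - snd p) ^ j) *\<^sub>R a (i, j)) has_sum f x) UNIV"
      by (elim exE conjE) (rule that)
    have "open (U \<inter> UNIV \<times> {-1<..<1})" using U(1) by (intro open_Int open_Times) simp_all
    then obtain e where e: "e > 0" "ball p e \<subseteq> U \<inter> UNIV \<times> {-1<..<1}"
      using U(2) p open_contains_ball by (metis IntI)
    \<comment> \<open>Points of the closed square of half-side \<open>\<rho>\<close> are within
      \<open>2 * \<rho>\<close> of \<open>p\<close>, hence in the ball, and also within the range
      \<open>\<delta>\<close> of the expansion.\<close>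
    define \<rho> where "\<rho> = min (\<delta> / 2) (e / 3)"
    have \<rho>: "0 < \<rho>" "\<rho> < \<delta>" "2 * \<rho> < e" using a(1) e(1) by (auto simp: \<rho>_def)
    have inU: "x \<in> U \<inter> UNIV \<times> {-1<..<1}" if "\<bar>fst x - fst p\<bar> \<le> \<rho>" "\<bar>snd x - snd p\<bar> \<le> \<rho>" for x
    proof -
      have "dist p x \<le> \<bar>fst x - fst p\<bar> + \<bar>snd x - snd p\<bar>"
        unfolding dist_norm norm_prod_def
        by (rule order_trans[OF sqrt_sum_squares_le_sum_abs[of "norm (fst (p - x))" "norm (snd (p - x))", unfolded power2_abs]])
          (simp add: abs_minus_commute)
      then show ?thesis using that \<rho> e(2) by auto
    qed
    define V where "V = ball (fst p) (\<rho> / 2) \<times> ball (snd p) (\<rho> / 2)"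
    have V: "\<bar>fst x - fst p\<bar> \<le> \<rho> / 2 \<and> \<bar>snd x - snd p\<bar> \<le> \<rho> / 2" if "x \<in> V" for x
      using that by (auto simp: V_def dist_real_def abs_minus_commute)
    have "open V" by (auto simp: V_def intro!: open_Times)
    have "ulipC k {()} (\<lambda>_. V) (\<lambda>_. K)" for k
    proof (rule power_series_ulipC[OF \<rho>(1) _ V \<open>open V\<close>])
      fix x assume x: "\<bar>fst x - fst p\<bar> \<le> \<rho>" "\<bar>snd x - snd p\<bar> \<le> \<rho>"
      have "f x = K x" using U(3) inU[OF x] by auto
      then show "((\<lambda>(i, j). ((fst x - fst p) ^ i * (snd x - snd p) ^ j) *\<^sub>R a (i, j)) has_sum K x) UNIV"
        using a(2) inU[OF x] x \<rho> by auto
    qed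
    then show ?thesis using \<open>open V\<close> \<rho>(1) by (intro exI[of _ V]) (auto simp: V_def mem_Times_iff)
  qed
  moreover have "K (\<theta> + 1, s) = K (\<theta>, s)" if "s \<in> {-1<..<1}" for \<theta> s
    using assms that unfolding limit_cycle_data_def by auto
  ultimately show ?thesis using ulipC_periodic_if_local[of K] by blast
qed

section \<open>The linear equation\<close>

text \<open>In terms of an antiderivative \<open>G\<close> the window integral is
  \<open>G z - G (z - 1)\<close>. Thus it is differentiable for merely continuous \<open>F\<close>,
  and the forcing itself never has to be differentiated.\<close>

lemma sliding_integral_derivative:
  fixes F :: "real \<Rightarrow> real"
  assumes F: "continuous_on UNIV F"
  shows "((\<lambda>\<theta>. integral {0..1} (\<lambda>t. F (\<theta> - t))) has_real_derivative F \<theta> - F (\<theta> - 1)) (at \<theta>)"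
proof -
  \<comment> \<open>Radius 3 suffices for all windows from \<open>z - 1\<close> to \<open>z\<close>
    with \<open>z\<close> within distance 1 of \<open>\<theta>\<close>.\<close>
  have "continuous_on {\<theta> - 3..\<theta> + 3} F" using F by (rule continuous_on_subset) simp
  from antiderivative_continuous[OF this] obtain G where
    G: "\<And>x. x \<in> {\<theta> - 3..\<theta> + 3} \<Longrightarrow> (G has_vector_derivative F x) (at x within {\<theta> - 3..\<theta> + 3})"
    by metis
  have G': "(G has_real_derivative F x) (at x)" if "x \<in> {\<theta> - 3<..<\<theta> + 3}" for x
    using G[of x] that at_within_Icc_at[of "\<theta> - 3" x "\<theta> + 3"]
    by (simp add: has_real_derivative_iff_has_vector_derivative)
  have I: "integral {0..1} (\<lambda>t. F (z - t)) = G z - G (z - 1)" if z: "z \<in> {\<theta> - 1<..<\<theta> + 1}" for z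
  proof -
    have "((\<lambda>t. F (z - t)) has_integral (- G (z - 1)) - (- G (z - 0))) {0..1}"
    proof (rule fundamental_theorem_of_calculus)
      fix t :: real assume "t \<in> {0..1}"
      then have "(G has_real_derivative F (z - t)) (at (z - t))" using z by (intro G') auto
      then have "((\<lambda>t. G (z - t)) has_real_derivative F (z - t) * - 1) (at t)"
        by (rule DERIV_chain2) (auto intro!: derivative_eq_intros)
      from DERIV_minus[OF this] have "((\<lambda>t. - G (z - t)) has_real_derivative F (z - t)) (at t)" by simp
      then show "((\<lambda>t. - G (z - t)) has_vector_derivative F (z - t)) (at t within {0..1})"
        by (simp add: has_real_derivative_iff_has_vector_derivative has_vector_derivative_at_within)
    qed simp
    then show ?thesis by (simp add: integral_unique)
  qed
  have "((\<lambda>z. G z - G (z - 1)) has_real_derivative F \<theta> - F (\<theta> - 1)) (at \<theta>)"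
  proof -
    have "(G has_real_derivative F (\<theta> - 1)) (at (\<theta> - 1))" by (rule G') simp
    then have "((\<lambda>z. G (z - 1)) has_real_derivative F (\<theta> - 1) * 1) (at \<theta>)"
      by (rule DERIV_chain2) (auto intro!: derivative_eq_intros)
    then have "((\<lambda>z. G (z - 1)) has_real_derivative F (\<theta> - 1)) (at \<theta>)" by simp
    moreover have "(G has_real_derivative F \<theta>) (at \<theta>)" by (rule G') simp
    ultimately show ?thesis by (intro DERIV_diff)
  qed
  then show ?thesis
    by (rule has_field_derivative_transform_within_open[where S = "{\<theta> - 1<..<\<theta> + 1}"]) (auto simp: I)
qed

text \<open>The window ending at 0 is a normalization: for continuous periodic \<open>g\<close>
  every other window gives the same value, by \<open>freq_eq\<close>.\<close>

definition freq :: "real \<Rightarrow> (real \<Rightarrow> real \<times> real) \<Rightarrow> real"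
  where "freq w0 g = w0 + integral {0..1} (\<lambda>t. fst (g (0 - t)))"

text \<open>
  With \<open>w = freq w0 g\<close>, the kernels below are the Green's functions, for period 1, of
  \<open>w u' = fst g - mean\<close> and \<open>w s' = lam s + snd g\<close>.
\<close>

definition phase :: "real \<Rightarrow> (real \<Rightarrow> real \<times> real) \<Rightarrow> real \<Rightarrow> real"
  where "phase w0 g \<theta> = inverse (freq w0 g) * integral {0..1} (\<lambda>t. (1 / 2 - t) * fst (g (\<theta> - t)))"

definition amp_kernel :: "real \<Rightarrow> real \<Rightarrow> real \<Rightarrow> real"
  where "amp_kernel lam w t =
    inverse w * inverse (1 - exp (lam * inverse w)) * exp (lam * t * inverse w)"

definition amp :: "real \<Rightarrow> real \<Rightarrow> (real \<Rightarrow> real \<times> real) \<Rightarrow> real \<Rightarrow> real"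
  where "amp w0 lam g \<theta> = integral {0..1} (\<lambda>t. amp_kernel lam (freq w0 g) t * snd (g (\<theta> - t)))"

definition wave :: "real \<Rightarrow> real \<Rightarrow> (real \<Rightarrow> real \<times> real) \<Rightarrow> real \<Rightarrow> real \<times> real"
  where "wave w0 lam g \<theta> = (\<theta> + phase w0 g \<theta>, amp w0 lam g \<theta>)"

lemma wave_add_1:
  assumes "\<And>\<theta>. g (\<theta> + 1) = g \<theta>"
  shows "wave w0 lam g (\<theta> + 1) = wave w0 lam g \<theta> + (1, 0)"
proof -
  have "g (\<theta> + 1 - t) = g (\<theta> - t)" for t using assms[of "\<theta> - t"] by (simp add: algebra_simps)
  then show ?thesis by (simp add: wave_def phase_def amp_def)
qed

text \<open>By periodicity the derivative of the sliding integral vanishes.\<close>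

lemma freq_eq:
  assumes g: "continuous_on UNIV g" and per: "\<And>\<theta>. g (\<theta> + 1) = g \<theta>"
  shows "freq w0 g = w0 + integral {0..1} (\<lambda>t. fst (g (\<theta> - t)))"
proof -
  have "((\<lambda>\<theta>. integral {0..1} (\<lambda>t. fst (g (\<theta> - t)))) has_real_derivative 0) (at \<theta> within UNIV)" for \<theta>
    using sliding_integral_derivative[of "\<lambda>x. fst (g x)" \<theta>] per[of "\<theta> - 1"]
    by (simp add: continuous_on_fst[OF g])
  from has_field_derivative_zero_constant[OF convex_UNIV this] show ?thesis
    unfolding freq_def by (metis UNIV_I)
qed

text \<open>The kernels are rewritten in \<open>\<theta> - t\<close>: \<open>1 / 2 - t\<close>
  splits into \<open>(1 / 2 - \<theta>) + (\<theta> - t)\<close>, and the exponential factorizes.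
  What remains are sliding integrals of functions that do not depend on \<open>\<theta>\<close>,
  whose derivatives are boundary terms.\<close>

lemma wave_has_vector_derivative:
  assumes g: "continuous_on UNIV g" and per: "\<And>\<theta>. g (\<theta> + 1) = g \<theta>"
    and "freq w0 g > 0" "lam < 0"
  shows "(wave w0 lam g has_vector_derivative
    inverse (freq w0 g) *\<^sub>R (g \<theta> + (w0, lam * snd (wave w0 lam g \<theta>)))) (at \<theta>)"
proof -
  define w where "w = freq w0 g"
  have w: "w > 0" using assms(3) by (simp add: w_def)
  define c where "c = lam / w"
  have c: "c < 0" using w assms(4) by (simp add: c_def divide_neg_pos)
  have g1: "continuous_on UNIV (\<lambda>x. fst (g x))" and g2: "continuous_on UNIV (\<lambda>x. snd (g x))"
    by (rule continuous_on_fst[OF g], rule continuous_on_snd[OF g])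
  have gper: "g (\<theta> - 1) = g \<theta>" for \<theta> using per[of "\<theta> - 1"] by simp
  have int: "(\<lambda>t. F (\<theta> - t)) integrable_on {0..1}" if "continuous_on UNIV F" for F :: "real \<Rightarrow> real" and \<theta>
    by (rule integrable_continuous_interval) (intro continuous_on_compose2[OF that] continuous_intros; simp)
  have cont: "continuous_on UNIV (\<lambda>x. x * fst (g x))" "continuous_on UNIV (\<lambda>x. exp (- c * x) * snd (g x))"
    by (intro continuous_intros g1 g2)+
  define I where "I = (\<lambda>F (\<theta> :: real). integral {0..1} (\<lambda>t. F (\<theta> - t)) :: real)"
  have dI: "(I F has_real_derivative F \<theta> - F (\<theta> - 1)) (at \<theta>)" if "continuous_on UNIV F" for F \<theta>
    unfolding I_def by (rule sliding_integral_derivative[OF that])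
  have phase_eq: "phase w0 g \<theta> = inverse w * ((1 / 2 - \<theta>) * I (\<lambda>x. fst (g x)) \<theta> + I (\<lambda>x. x * fst (g x)) \<theta>)" for \<theta>
  proof -
    have "integral {0..1} (\<lambda>t. (1 / 2 - t) * fst (g (\<theta> - t)))
      = integral {0..1} (\<lambda>t. (1 / 2 - \<theta>) * fst (g (\<theta> - t)) + (\<theta> - t) * fst (g (\<theta> - t)))"
      by (simp add: algebra_simps)
    also have "\<dots> = (1 / 2 - \<theta>) * I (\<lambda>x. fst (g x)) \<theta> + I (\<lambda>x. x * fst (g x)) \<theta>"
      unfolding I_def
      by (subst Henstock_Kurzweil_Integration.integral_add)
        (use int[OF continuous_on_mult_left[OF g1, of "1 / 2 - \<theta>"]] int[OF cont(1)] in auto)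
    finally show ?thesis by (simp add: phase_def w_def)
  qed
  \<comment> \<open>Periodicity cancels the boundary terms of the first sliding integral. In the
    second the weight \<open>x\<close> grows by 1 across a period, which leaves
    \<open>fst (g \<theta>)\<close>.\<close>
  have "(phase w0 g has_real_derivative
      inverse w * (- I (\<lambda>x. fst (g x)) \<theta> + fst (g \<theta>))) (at \<theta>)"
    unfolding phase_eq[abs_def]
    by (auto intro!: derivative_eq_intros dI g1 cont simp: gper algebra_simps)
  moreover have "w = w0 + I (\<lambda>x. fst (g x)) \<theta>" unfolding w_def I_def by (rule freq_eq[OF g per])
  ultimately have d1: "((\<lambda>\<theta>. \<theta> + phase w0 g \<theta>) has_real_derivative inverse w * (fst (g \<theta>) + w0)) (at \<theta>)"
    using w by (auto intro!: derivative_eq_intros simp: field_simps)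
  define A where "A = inverse w * inverse (1 - exp c)"
  have amp_eq: "amp w0 lam g \<theta> = A * (exp (c * \<theta>) * I (\<lambda>x. exp (- c * x) * snd (g x)) \<theta>)" for \<theta>
  proof -
    have "amp_kernel lam w t * snd (g (\<theta> - t)) = (A * exp (c * \<theta>)) * (exp (- c * (\<theta> - t)) * snd (g (\<theta> - t)))" for t
      by (simp add: amp_kernel_def A_def c_def divide_inverse exp_add[symmetric] algebra_simps)
    then show ?thesis
      unfolding amp_def I_def w_def[symmetric] by (simp only: integral_mult_right mult.assoc)
  qed
  have "(amp w0 lam g has_real_derivative
      A * (c * exp (c * \<theta>) * I (\<lambda>x. exp (- c * x) * snd (g x)) \<theta>
        + exp (c * \<theta>) * (exp (- c * \<theta>) * snd (g \<theta>) - exp (- c * (\<theta> - 1)) * snd (g \<theta>)))) (at \<theta>)"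
    unfolding amp_eq[abs_def] using dI[OF cont(2), of \<theta>]
    by (auto intro!: derivative_eq_intros simp: gper algebra_simps)
  \<comment> \<open>The boundary terms combine to the factor \<open>1 - exp c\<close>; the prefactor
    \<open>A\<close> of the kernel is chosen to turn it into \<open>inverse w\<close>.\<close>
  also have "A * (c * exp (c * \<theta>) * I (\<lambda>x. exp (- c * x) * snd (g x)) \<theta>
        + exp (c * \<theta>) * (exp (- c * \<theta>) * snd (g \<theta>) - exp (- c * (\<theta> - 1)) * snd (g \<theta>)))
    = c * amp w0 lam g \<theta> + A * (1 - exp c) * snd (g \<theta>)"
    by (simp add: amp_eq exp_diff exp_minus exp_add field_simps)
  also have "A * (1 - exp c) = inverse w" using c by (simp add: A_def)
  also have "c * amp w0 lam g \<theta> + inverse w * snd (g \<theta>) = inverse w * (snd (g \<theta>) + lam * amp w0 lam g \<theta>)"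
    by (simp add: c_def divide_inverse algebra_simps)
  finally have "((\<lambda>\<theta>. (\<theta> + phase w0 g \<theta>, amp w0 lam g \<theta>)) has_vector_derivative
      (inverse w * (fst (g \<theta>) + w0), inverse w * (snd (g \<theta>) + lam * amp w0 lam g \<theta>))) (at \<theta>)"
    using d1 by (intro has_vector_derivative_Pair) (simp_all add: has_real_derivative_iff_has_vector_derivative)
  moreover have "wave w0 lam g = (\<lambda>\<theta>. (\<theta> + phase w0 g \<theta>, amp w0 lam g \<theta>))" by (simp add: fun_eq_iff wave_def)
  ultimately show ?thesis
    by (simp add: w_def[symmetric] wave_def plus_prod_def scaleR_prod_def)
qed

section \<open>Bounds and regularity for the solution operator of the linear equation\<close>

lemma amp_kernel_bound:
  assumes "w0 > 0" "lam < 0" "w \<ge> w0 / 2" "w \<le> 3 * w0 / 2" "t \<in> {0..1}"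
  shows "\<bar>amp_kernel lam w t\<bar> \<le> (2 / w0) * inverse (1 - exp (lam * (2 / (3 * w0))))"
proof -
  have w: "w > 0" "inverse w \<le> 2 / w0" "2 / (3 * w0) \<le> inverse w" using assms by (auto simp: field_simps)
  have "lam * inverse w \<le> lam * (2 / (3 * w0))" using w assms(2) by (intro mult_left_mono_neg) auto
  \<comment> \<open>As \<open>lam\<close> is negative, the denominator is smallest at the largest
    admissible frequency \<open>3 * w0 / 2\<close>; there it is still positive.\<close>
  then have 1: "1 - exp (lam * (2 / (3 * w0))) \<le> 1 - exp (lam * inverse w)" by simp
  have 2: "0 < 1 - exp (lam * (2 / (3 * w0)))" using assms by (simp add: mult_neg_pos divide_neg_pos)
  have 3: "exp (lam * t * inverse w) \<le> 1" using assms w by (simp add: mult_nonpos_nonneg mult_nonneg_nonneg field_simps)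
  have "\<bar>amp_kernel lam w t\<bar> = inverse w * inverse (1 - exp (lam * inverse w)) * exp (lam * t * inverse w)"
    using w 1 2 by (simp add: amp_kernel_def abs_mult)
  also have "\<dots> \<le> (2 / w0) * inverse (1 - exp (lam * (2 / (3 * w0)))) * 1"
    using w 1 2 3 assms(1) by (intro mult_mono le_imp_inverse_le mult_nonneg_nonneg) auto
  finally show ?thesis by simp
qed

lemma ulipC_snd_index:
  assumes "ulipC k J S f"
  shows "ulipC k (T \<times> J) (\<lambda>q. S (snd q)) (\<lambda>q. f (snd q))"
  by (rule ulipC_reindex[OF assms, of _ snd]) auto

lemma ubd_snd_index:
  assumes "ubd J S f"
  shows "ubd (T \<times> J) (\<lambda>q. S (snd q)) (\<lambda>q. f (snd q))"
  by (rule ubd_reindex[OF assms, of _ snd]) auto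

lemma ulipC_mult:
  fixes f g :: "'i \<Rightarrow> 'a::euclidean_space \<Rightarrow> real"
  assumes "ulipC k J S f" "ulipC k J S g" "ubd J S f" "ubd J S g"
  shows "ulipC k J S (\<lambda>i x. f i x * g i x)"
  using ulipC_scaleR[OF assms] by simp

lemma ubd_mult:
  fixes f g :: "'i \<Rightarrow> 'a \<Rightarrow> real"
  assumes "ubd J S f" "ubd J S g"
  shows "ubd J S (\<lambda>i x. f i x * g i x)"
  using ubd_scaleR[OF assms] by simp

lemma ulipC_single: "ulipC k {()} (\<lambda>_. S) (\<lambda>_. f) \<Longrightarrow> ulipC k J (\<lambda>_. S) (\<lambda>_. f)"
  by (rule ulipC_reindex[of k "{()}" "\<lambda>_. S" "\<lambda>_. f" J "\<lambda>_. ()"]) auto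

definition amp_const :: "real \<Rightarrow> real \<Rightarrow> real"
  where "amp_const w0 lam = (2 / w0) * inverse (1 - exp (lam * (2 / (3 * w0))))"

text \<open>The first entry keeps the frequency between \<open>w0 / 2\<close> and
  \<open>3 * w0 / 2\<close>; the second, the reciprocal of twice the kernel bound, keeps the
  amplitude below 1/2.\<close>

definition forcing_radius :: "real \<Rightarrow> real \<Rightarrow> real"
  where "forcing_radius w0 lam = min (w0 / 2) (1 / (2 * amp_const w0 lam))"

lemma amp_const_pos: "w0 > 0 \<Longrightarrow> lam < 0 \<Longrightarrow> amp_const w0 lam > 0"
  by (simp add: amp_const_def mult_neg_pos divide_neg_pos)

lemma forcing_radius_pos: "w0 > 0 \<Longrightarrow> lam < 0 \<Longrightarrow> forcing_radius w0 lam > 0"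
  using amp_const_pos by (simp add: forcing_radius_def)

lemma freq_bounds:
  assumes "w0 > 0" "continuous_on UNIV g" "\<And>\<theta>. norm (g \<theta>) \<le> forcing_radius w0 lam"
  shows "w0 / 2 \<le> freq w0 g" "freq w0 g \<le> 3 * w0 / 2"
proof -
  have "norm (integral {0..1} (\<lambda>t. fst (g (0 - t)))) \<le> w0 / 2 * (1 - 0)"
  proof (rule integral_bound)
    show "continuous_on {0..1} (\<lambda>t. fst (g (0 - t)))"
      by (intro continuous_on_fst continuous_on_compose2[OF assms(2)] continuous_intros) auto
    show "norm (fst (g (0 - t))) \<le> w0 / 2" for t
      using norm_fst_le[of "fst (g (0 - t))" "snd (g (0 - t))"] assms(3)[of "0 - t"]
      by (simp add: forcing_radius_def)
  qed simp
  then show "w0 / 2 \<le> freq w0 g" "freq w0 g \<le> 3 * w0 / 2" by (auto simp: freq_def abs_le_iff)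
qed

lemma amp_bound:
  assumes "w0 > 0" "lam < 0" "continuous_on UNIV g" "\<And>\<theta>. norm (g \<theta>) \<le> forcing_radius w0 lam"
  shows "\<bar>amp w0 lam g \<theta>\<bar> \<le> 1 / 2"
proof -
  have "norm (amp w0 lam g \<theta>) \<le> 1 / 2 * (1 - 0)"
    unfolding amp_def
  proof (rule integral_bound)
    show "continuous_on {0..1} (\<lambda>t. amp_kernel lam (freq w0 g) t * snd (g (\<theta> - t)))"
      unfolding amp_kernel_def
      by (intro continuous_intros continuous_on_snd continuous_on_compose2[OF assms(3)]) auto
    fix t :: real assume t: "t \<in> {0..1}"
    have "\<bar>amp_kernel lam (freq w0 g) t\<bar> \<le> amp_const w0 lam"
      unfolding amp_const_def by (rule amp_kernel_bound[OF assms(1,2) freq_bounds[OF assms(1,3,4)] t])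
    moreover have "\<bar>snd (g (\<theta> - t))\<bar> \<le> 1 / (2 * amp_const w0 lam)"
      using norm_snd_le[of "snd (g (\<theta> - t))" "fst (g (\<theta> - t))"] assms(4)[of "\<theta> - t"] by (simp add: forcing_radius_def)
    ultimately have "\<bar>amp_kernel lam (freq w0 g) t\<bar> * \<bar>snd (g (\<theta> - t))\<bar> \<le> amp_const w0 lam * (1 / (2 * amp_const w0 lam))"
      by (rule mult_mono) (use amp_const_pos[OF assms(1,2)] in auto)
    then show "norm (amp_kernel lam (freq w0 g) t * snd (g (\<theta> - t))) \<le> 1 / 2"
      using amp_const_pos[OF assms(1,2)] by (simp add: abs_mult)
  qed simp
  then show ?thesis by simp
qed

text \<open>The set \<open>P i\<close> holds a scalar parameter on which the forcing depends: the
  original \<open>\<eta>\<close>, or an interpolation parameter between two forcings. Frequency and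
  kernels vary with it, so their dependence is built from inverse, exponential, products and
  integrals. Only the difference of the wave and the identity is bounded.\<close>

lemma wave_ulipC:
  fixes f :: "'i \<Rightarrow> real \<Rightarrow> real \<Rightarrow> real \<times> real"
  assumes w0: "w0 > 0" and lam: "lam < 0"
    and f: "ulipC k J (\<lambda>i. P i \<times> UNIV) (\<lambda>i x. f i (fst x) (snd x))"
    and bdd: "\<forall>i\<in>J. \<forall>p\<in>P i. \<forall>\<theta>. norm (f i p \<theta>) \<le> forcing_radius w0 lam"
    and opn: "k = 0 \<or> (\<forall>i\<in>J. open (P i))"
  shows "ulipC k J (\<lambda>i. P i \<times> UNIV) (\<lambda>i x :: real \<times> real. freq w0 (f i (fst x)))" (is ?freq)
    and "ubd J (\<lambda>i. P i \<times> UNIV) (\<lambda>i x :: real \<times> real. freq w0 (f i (fst x)))" (is ?freqb)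
    and "ulipC k J (\<lambda>i. P i \<times> UNIV) (\<lambda>i x. wave w0 lam (f i (fst x)) (snd x) - (snd x, 0))" (is ?wave)
    and "ubd J (\<lambda>i. P i \<times> UNIV) (\<lambda>i x. wave w0 lam (f i (fst x)) (snd x) - (snd x, 0))" (is ?waveb)
    and "\<And>i p. i \<in> J \<Longrightarrow> p \<in> P i \<Longrightarrow> continuous_on UNIV (f i p)"
proof -
  let ?S = "\<lambda>i. P i \<times> (UNIV :: real set)" and ?T = "{0..1} :: real set"
  have bd: "norm (f i p \<theta>) \<le> forcing_radius w0 lam" if "i \<in> J" "p \<in> P i" for i p \<theta>
    using bdd that by blast
  have opn': "k = 0 \<or> (\<forall>i\<in>J. open (?S i))" using opn by (auto intro: open_Times)
  show cont: "continuous_on UNIV (f i p)" if ip: "i \<in> J" "p \<in> P i" for i p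
  proof -
    obtain M where M: "M \<ge> 0" "\<And>i x y. i \<in> J \<Longrightarrow> x \<in> ?S i \<Longrightarrow> y \<in> ?S i \<Longrightarrow>
        norm (f i (fst y) (snd y) - f i (fst x) (snd x)) \<le> M * norm (y - x)"
      by (rule ulipC_0E[OF ulipC_imp_0[OF f]]) (rule that)
    have "M-lipschitz_on UNIV (f i p)"
    proof (rule lipschitz_onI)
      fix x y
      show "dist (f i p x) (f i p y) \<le> M * dist x y"
        using M(2)[of i "(p, y)" "(p, x)"] ip by (simp add: dist_norm)
    qed (rule M(1))
    then show ?thesis by (rule lipschitz_on_continuous_on)
  qed
  have contt: "continuous_on A (\<lambda>t. f i p (z - t))" if "i \<in> J" "p \<in> P i" for i p z A
    by (rule continuous_on_compose2[OF cont[OF that]]) (auto intro!: continuous_intros)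
  have fq: "ulipC k (?T \<times> J) (\<lambda>q. ?S (snd q)) (\<lambda>q x. f (snd q) (fst x) (snd x))"
    by (rule ulipC_snd_index[OF f])
  \<comment> \<open>The integration variable becomes part of the index; translations by it form a
    uniform family.\<close>
  have shift: "ulipC k (?T \<times> J) (\<lambda>q. ?S (snd q)) (\<lambda>q x. f (snd q) (fst x) (snd x - fst q))"
  proof -
    have "ulipC k (?T \<times> J) (\<lambda>q. ?S (snd q)) (\<lambda>q x. (fst x, snd x + (- fst q)))"
      by (intro ulipC_Pair ulipC_add ulipC_linear_map ulipC_const bounded_linear_fst bounded_linear_snd)
    from ulipC_compose[OF fq this] show ?thesis by auto
  qed
  have shift0: "ulipC k (?T \<times> J) (\<lambda>q. ?S (snd q)) (\<lambda>q x. f (snd q) (fst x) (0 - fst q))"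
  proof -
    have "ulipC k (?T \<times> J) (\<lambda>q. ?S (snd q)) (\<lambda>q x. (fst x, 0 - fst q))"
      by (intro ulipC_Pair ulipC_linear_map ulipC_const bounded_linear_fst)
    from ulipC_compose[OF fq this] show ?thesis by auto
  qed
  have fb: "ubd (?T \<times> J) (\<lambda>q. ?S (snd q)) (\<lambda>q x. f (snd q) (fst x) (snd x - fst q))"
    by (rule ubdI[of _ _ _ "forcing_radius w0 lam"]) (auto intro: bd)
  have freqB: "w0 / 2 \<le> freq w0 (f i p)" "freq w0 (f i p) \<le> 3 * w0 / 2" if "i \<in> J" "p \<in> P i" for i p
    by (rule freq_bounds[OF w0 cont[OF that]], rule bd[OF that])+
  have "ulipC k J ?S (\<lambda>i x. integral {0..1} (\<lambda>t. fst (f i (fst x) (0 - t))))"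
  proof (rule ulipC_integral[where f = "\<lambda>t i x. fst (f i (fst x) (0 - t))", OF _ _ opn'])
    show "ulipC k (?T \<times> J) (\<lambda>q. ?S (snd q)) (\<lambda>q x. fst (f (snd q) (fst x) (0 - fst q)))"
      by (rule ulipC_linear[OF shift0 bounded_linear_fst])
    show "continuous_on {0..1} (\<lambda>t. fst (f i (fst x) (0 - t)))" if "i \<in> J" "x \<in> ?S i" for i x
      using that by (intro continuous_on_fst contt) auto
  qed
  from ulipC_add[OF ulipC_const[of k J ?S "\<lambda>_. w0"] this] show freq: ?freq unfolding freq_def .
  show ?freqb
    by (rule ubdI[of _ _ _ "3 * w0 / 2"]) (use freqB w0 in \<open>fastforce simp: abs_le_iff\<close>)
  define \<mu> where "\<mu> = (\<lambda>i (x :: real \<times> real). inverse (freq w0 (f i (fst x))))"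
  have \<mu>: "ulipC k J ?S \<mu>" "ubd J ?S \<mu>"
    unfolding \<mu>_def
    by (rule ulipC_compose[OF ulipC_inverse[of "w0 / 2"] freq]; use w0 freqB in auto)
      (rule ubd_compose[OF ubd_inverse[of "w0 / 2"]]; use w0 freqB in auto)
  have \<mu>B: "\<mu> i x \<ge> 2 / (3 * w0)" if "i \<in> J" "x \<in> ?S i" for i x
    using freqB[OF that(1), of "fst x"] that w0 by (auto simp: \<mu>_def field_simps mem_Times_iff)
  have \<mu>0: "\<mu> i x > 0" if "i \<in> J" "x \<in> ?S i" for i x
    using \<mu>B[OF that] w0 by (smt (verit) divide_pos_pos mult_pos_pos)
  have \<mu>q: "ulipC k (?T \<times> J) (\<lambda>q. ?S (snd q)) (\<lambda>q. \<mu> (snd q))" "ubd (?T \<times> J) (\<lambda>q. ?S (snd q)) (\<lambda>q. \<mu> (snd q))"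
    by (rule ulipC_snd_index[OF \<mu>(1)], rule ubd_snd_index[OF \<mu>(2)])
  have tb: "ubd (?T \<times> J) (\<lambda>q. ?S (snd q)) (\<lambda>q x. lam * fst q)"
    by (rule ubdI[of _ _ _ "\<bar>lam\<bar>"]) (auto simp: abs_mult mult_left_le)
  have expq: "ulipC k (?T \<times> J) (\<lambda>q. ?S (snd q)) (\<lambda>q x. exp (lam * fst q * \<mu> (snd q) x))"
    "ubd (?T \<times> J) (\<lambda>q. ?S (snd q)) (\<lambda>q x. exp (lam * fst q * \<mu> (snd q) x))"
  proof -
    have le: "lam * fst q * \<mu> (snd q) x \<in> {..0}" if "q \<in> ?T \<times> J" "x \<in> ?S (snd q)" for q x
      using that lam \<mu>0[of "snd q" x] by (auto intro!: mult_nonpos_nonneg simp: less_imp_le)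
    show "ulipC k (?T \<times> J) (\<lambda>q. ?S (snd q)) (\<lambda>q x. exp (lam * fst q * \<mu> (snd q) x))"
      by (rule ulipC_compose[OF ulipC_exp[of _ _ 0]]) (intro ulipC_mult ulipC_const tb \<mu>q, rule le)
    show "ubd (?T \<times> J) (\<lambda>q. ?S (snd q)) (\<lambda>q x. exp (lam * fst q * \<mu> (snd q) x))"
      by (rule ubd_compose[OF ubd_exp[of _ 0]]) (rule le)
  qed
  define \<nu> where "\<nu> = (\<lambda>i x. inverse (1 - exp (lam * \<mu> i x)))"
  have \<nu>: "ulipC k J ?S \<nu>" "ubd J ?S \<nu>"
  proof -
    define c where "c = 1 - exp (lam * (2 / (3 * w0)))"
    have c: "c > 0" using w0 lam by (simp add: c_def mult_neg_pos divide_neg_pos)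
    \<comment> \<open>The lower bound on \<open>\<mu>\<close>, multiplied by the negative
      \<open>lam\<close>, keeps the exponential away from 1, so the reciprocal is taken on a
      half-line \<open>{c..}\<close> with \<open>c > 0\<close>.\<close>
    have ge: "1 + - exp (lam * \<mu> i x) \<in> {c..}" if "i \<in> J" "x \<in> ?S i" for i x
      using mult_left_mono_neg[OF \<mu>B[OF that], of lam] lam by (simp add: c_def)
    have "ulipC k J ?S (\<lambda>i x. exp (lam * \<mu> i x))"
    proof (rule ulipC_compose[OF ulipC_exp[of _ _ 0]])
      show "ulipC k J ?S (\<lambda>i x. lam * \<mu> i x)" by (intro ulipC_linear[OF \<mu>(1)] bounded_linear_mult_right)
      show "lam * \<mu> i x \<in> {..0}" if "i \<in> J" "x \<in> ?S i" for i x
        using lam \<mu>0[OF that] by (auto intro!: mult_nonpos_nonneg simp: less_imp_le)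
    qed
    then have l: "ulipC k J ?S (\<lambda>i x. 1 + - exp (lam * \<mu> i x))"
      by (intro ulipC_add ulipC_const ulipC_linear[OF _ bounded_linear_minus[OF bounded_linear_ident]])
    have "ulipC k J ?S (\<lambda>i x. inverse (1 + - exp (lam * \<mu> i x)))" "ubd J ?S (\<lambda>i x. inverse (1 + - exp (lam * \<mu> i x)))"
      by (rule ulipC_compose[OF ulipC_inverse[OF c] l ge], assumption+)
        (rule ubd_compose[OF ubd_inverse[OF c] ge], assumption+)
    then show "ulipC k J ?S \<nu>" "ubd J ?S \<nu>" by (simp_all add: \<nu>_def)
  qed
  have ker_eq: "amp_kernel lam (freq w0 (f i (fst x))) t = \<mu> i x * \<nu> i x * exp (lam * t * \<mu> i x)" for i x t
    by (simp add: amp_kernel_def \<mu>_def \<nu>_def)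
  have half: "ubd (?T \<times> J) (\<lambda>q. ?S (snd q)) (\<lambda>q x. 1 / 2 - fst q)"
  proof (rule ubdI)
    fix q and x :: "real \<times> real" assume "q \<in> ?T \<times> J"
    then have "0 \<le> fst q" "fst q \<le> 1" by auto
    then show "norm (1 / 2 - fst q) \<le> 1 / 2" unfolding real_norm_def by linarith
  qed
  have ph: "ulipC k J ?S (\<lambda>i x. integral {0..1} (\<lambda>t. (1 / 2 - t) * fst (f i (fst x) (snd x - t))))"
  proof (rule ulipC_integral[where f = "\<lambda>t i x. (1 / 2 - t) * fst (f i (fst x) (snd x - t))", OF _ _ opn'])
    show "ulipC k (?T \<times> J) (\<lambda>q. ?S (snd q)) (\<lambda>q x. (1 / 2 - fst q) * fst (f (snd q) (fst x) (snd x - fst q)))"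
      by (intro ulipC_mult ulipC_const ulipC_linear[OF shift bounded_linear_fst] ubd_linear[OF fb bounded_linear_fst] half)
    show "continuous_on {0..1} (\<lambda>t. (1 / 2 - t) * fst (f i (fst x) (snd x - t)))" if "i \<in> J" "x \<in> ?S i" for i x
      using that by (intro continuous_intros continuous_on_fst contt) auto
  qed
  have phb: "ubd J ?S (\<lambda>i x. integral {0..1} (\<lambda>t. (1 / 2 - t) * fst (f i (fst x) (snd x - t))))"
  proof (rule ubdI)
    fix i x assume ix: "i \<in> J" "x \<in> ?S i"
    have "norm (integral {0..1} (\<lambda>t. (1 / 2 - t) * fst (f i (fst x) (snd x - t)))) \<le> (1 / 2 * forcing_radius w0 lam) * (1 - 0)"
    proof (rule integral_bound)
      show "continuous_on {0..1} (\<lambda>t. (1 / 2 - t) * fst (f i (fst x) (snd x - t)))"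
        using ix by (intro continuous_intros continuous_on_fst contt) auto
      fix t :: real assume t: "t \<in> {0..1}"
      have "\<bar>fst (f i (fst x) (snd x - t))\<bar> \<le> forcing_radius w0 lam"
        using bd[of i "fst x" "snd x - t"] ix norm_fst_le[of "fst (f i (fst x) (snd x - t))" "snd (f i (fst x) (snd x - t))"] by auto
      moreover have "\<bar>1 / 2 - t\<bar> \<le> 1 / 2" using t unfolding atLeastAtMost_iff by linarith
      ultimately show "norm ((1 / 2 - t) * fst (f i (fst x) (snd x - t))) \<le> 1 / 2 * forcing_radius w0 lam"
        unfolding real_norm_def abs_mult by (intro mult_mono) auto
    qed simp
    then show "norm (integral {0..1} (\<lambda>t. (1 / 2 - t) * fst (f i (fst x) (snd x - t)))) \<le> 1 / 2 * forcing_radius w0 lam" by simp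
  qed
  have am: "ulipC k J ?S (\<lambda>i x. amp w0 lam (f i (fst x)) (snd x))"
    unfolding amp_def ker_eq
  proof (rule ulipC_integral[where f = "\<lambda>t i x. \<mu> i x * \<nu> i x * exp (lam * t * \<mu> i x) * snd (f i (fst x) (snd x - t))", OF _ _ opn'])
    show "ulipC k (?T \<times> J) (\<lambda>q. ?S (snd q))
      (\<lambda>q x. \<mu> (snd q) x * \<nu> (snd q) x * exp (lam * fst q * \<mu> (snd q) x) * snd (f (snd q) (fst x) (snd x - fst q)))"
      by (intro ulipC_mult ubd_mult expq \<mu>q ulipC_snd_index[OF \<nu>(1)] ubd_snd_index[OF \<nu>(2)]
          ulipC_linear[OF shift bounded_linear_snd] ubd_linear[OF fb bounded_linear_snd])
    show "continuous_on {0..1} (\<lambda>t. \<mu> i x * \<nu> i x * exp (lam * t * \<mu> i x) * snd (f i (fst x) (snd x - t)))"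
      if "i \<in> J" "x \<in> ?S i" for i x
      using that by (intro continuous_intros continuous_on_snd contt) auto
  qed
  have amb: "ubd J ?S (\<lambda>i x. amp w0 lam (f i (fst x)) (snd x))"
  proof (rule ubdI)
    fix i x assume ix: "i \<in> J" "x \<in> ?S i"
    then have p: "fst x \<in> P i" by auto
    show "norm (amp w0 lam (f i (fst x)) (snd x)) \<le> 1 / 2"
      unfolding real_norm_def by (rule amp_bound[OF w0 lam cont[OF ix(1) p] bd[OF ix(1) p]])
  qed
  have wv: "wave w0 lam (f i (fst x)) (snd x) - (snd x, 0)
    = (\<mu> i x * integral {0..1} (\<lambda>t. (1 / 2 - t) * fst (f i (fst x) (snd x - t))), amp w0 lam (f i (fst x)) (snd x))" for i x
    by (simp add: wave_def phase_def \<mu>_def)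
  show ?wave unfolding wv by (intro ulipC_Pair ulipC_mult \<mu> ph phb am)
  show ?waveb
  proof -
    have "ubd J ?S (\<lambda>i x. (\<mu> i x * integral {0..1} (\<lambda>t. (1 / 2 - t) * fst (f i (fst x) (snd x - t))), 0)
        + (0, amp w0 lam (f i (fst x)) (snd x)))"
      by (intro ubd_add ubd_linear[OF ubd_mult[OF \<mu>(2) phb], of "\<lambda>a. (a, 0)"] ubd_linear[OF amb, of "\<lambda>a. (0, a)"])
        (auto intro: bounded_linear_Pair bounded_linear_ident bounded_linear_zero)
    then show ?thesis unfolding wv by simp
  qed
qed

section \<open>The fixed point problem\<close>

text \<open>The hypotheses in the form the iteration consumes, with no cutoff in the equation.
  \<open>K\<close> is regular on the half-width strip, which contains the values of every wave with
  admissible forcing.\<close>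

locale delay_problem =
  fixes w0 lam h :: real and I :: "real set" and K :: "real \<times> real \<Rightarrow> real \<times> real"
    and r :: "real \<Rightarrow> real \<times> real \<Rightarrow> real"
    and Y :: "real \<Rightarrow> real \<times> real \<Rightarrow> real \<times> real \<Rightarrow> real \<Rightarrow> real \<times> real"
  assumes w0: "w0 > 0" and lam: "lam < 0" and open_I: "open I"
    and K_ulipC: "\<And>k. ulipC k {()} (\<lambda>_. UNIV \<times> {-1/2..1/2}) (\<lambda>_. K)"
    and K_periodic: "\<And>\<theta> s. s \<in> {-1..1} \<Longrightarrow> K (\<theta> + 1, s) = K (\<theta>, s)"
    and r_ulipC: "\<And>k. ulipC k {()} (\<lambda>_. I \<times> UNIV) (\<lambda>_ z. r (fst z) (snd z))"
    and r_bounds: "\<And>\<eta> x. \<eta> \<in> I \<Longrightarrow> r \<eta> x \<in> {0..h}"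
    and Y_ulipC: "\<And>k. ulipC k {()} (\<lambda>_. I \<times> strip \<times> strip \<times> {0..})
        (\<lambda>_ z. Y (fst z) (fst (snd z)) (fst (snd (snd z))) (snd (snd (snd z))))"
    and Y_bounded: "\<exists>M. \<forall>\<eta>\<in>I. \<forall>u\<in>strip. \<forall>v\<in>strip. \<forall>\<epsilon>\<ge>0. norm (Y \<eta> u v \<epsilon>) \<le> M"
    and Y_periodic: "\<And>\<eta> u v \<epsilon>. \<eta> \<in> I \<Longrightarrow> u \<in> strip \<Longrightarrow> v \<in> strip \<Longrightarrow> \<epsilon> \<ge> 0 \<Longrightarrow>
        Y \<eta> (u + (1, 0)) v \<epsilon> = Y \<eta> u v \<epsilon> \<and> Y \<eta> u (v + (1, 0)) \<epsilon> = Y \<eta> u v \<epsilon>"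
begin

abbreviation radius :: real where "radius \<equiv> forcing_radius w0 lam"

definition delayed :: "real \<Rightarrow> (real \<Rightarrow> real \<times> real) \<Rightarrow> real \<Rightarrow> real"
  where "delayed \<eta> g \<theta> = \<theta> - freq w0 g * r \<eta> (K (wave w0 lam g \<theta>))"

definition response :: "real \<Rightarrow> real \<Rightarrow> (real \<Rightarrow> real \<times> real) \<Rightarrow> real \<Rightarrow> real \<times> real"
  where "response \<eta> \<epsilon> g \<theta> = Y \<eta> (wave w0 lam g \<theta>) (wave w0 lam g (delayed \<eta> g \<theta>)) \<epsilon>"

lemma radius_pos: "radius > 0"
  by (rule forcing_radius_pos[OF w0 lam])

lemma wave_snd_bound:
  assumes "continuous_on UNIV g" "\<And>\<theta>. norm (g \<theta>) \<le> radius"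
  shows "\<bar>snd (wave w0 lam g \<theta>)\<bar> \<le> 1 / 2"
  using amp_bound[OF w0 lam assms] by (simp add: wave_def)

lemma wave_in_strip:
  assumes "continuous_on UNIV g" "\<And>\<theta>. norm (g \<theta>) \<le> radius"
  shows "wave w0 lam g \<theta> \<in> strip"
  using wave_snd_bound[OF assms, of \<theta>] by (auto simp: mem_Times_iff abs_le_iff)

lemma response_periodic:
  assumes g: "continuous_on UNIV g" "\<And>\<theta>. norm (g \<theta>) \<le> radius" and per: "\<And>\<theta>. g (\<theta> + 1) = g \<theta>"
    and "\<eta> \<in> I" "\<epsilon> \<ge> 0"
  shows "response \<eta> \<epsilon> g (\<theta> + 1) = response \<eta> \<epsilon> g \<theta>"
proof -
  have w: "wave w0 lam g (\<theta> + 1) = wave w0 lam g \<theta> + (1, 0)" for \<theta> by (rule wave_add_1[of g, OF per])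
  have "K (wave w0 lam g \<theta> + (1, 0)) = K (wave w0 lam g \<theta>)"
    using K_periodic[of "snd (wave w0 lam g \<theta>)" "fst (wave w0 lam g \<theta>)"] wave_in_strip[OF g, of \<theta>]
    by (cases "wave w0 lam g \<theta>") auto
  then have "delayed \<eta> g (\<theta> + 1) = delayed \<eta> g \<theta> + 1" by (simp add: delayed_def w)
  then show ?thesis
    using Y_periodic[OF assms(4) wave_in_strip[OF g, of \<theta>] wave_in_strip[OF g, of "delayed \<eta> g \<theta> + 1"] assms(5)]
      Y_periodic[OF assms(4) wave_in_strip[OF g, of \<theta>] wave_in_strip[OF g, of "delayed \<eta> g \<theta>"] assms(5)]
    by (simp add: response_def w)
qed

text \<open>The map \<open>e\<close> separates the parameter of the forcing from the parameter of
  the equation: it is the identity for regularity in \<open>\<eta>\<close>, and constant when two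
  forcings are compared at fixed \<open>\<eta>\<close>.\<close>

lemma response_ulipC:
  fixes f :: "'i \<Rightarrow> real \<Rightarrow> real \<Rightarrow> real \<times> real"
  assumes f: "ulipC k J (\<lambda>i. P i \<times> UNIV) (\<lambda>i x. f i (fst x) (snd x))"
    and bdd: "\<forall>i\<in>J. \<forall>p\<in>P i. \<forall>\<theta>. norm (f i p \<theta>) \<le> radius"
    and opn: "k = 0 \<or> (\<forall>i\<in>J. open (P i))"
    and e: "ulipC k J P e" and e_in: "\<And>i p. i \<in> J \<Longrightarrow> p \<in> P i \<Longrightarrow> e i p \<in> I"
    and eps: "\<And>i. i \<in> J \<Longrightarrow> \<epsilon> i \<ge> 0"
  shows "ulipC k J (\<lambda>i. P i \<times> UNIV) (\<lambda>i x. response (e i (fst x)) (\<epsilon> i) (f i (fst x)) (snd x))"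
proof -
  let ?S = "\<lambda>i. P i \<times> (UNIV :: real set)"
  have bd: "norm (f i p \<theta>) \<le> radius" if "i \<in> J" "p \<in> P i" for i p \<theta>
    using bdd that by blast
  note wave = wave_ulipC[OF w0 lam f bdd opn]
  let ?w = "\<lambda>i x. wave w0 lam (f i (fst x)) (snd x)"
  have wb: "\<bar>snd (wave w0 lam (f i p) \<theta>)\<bar> \<le> 1 / 2" if "i \<in> J" "p \<in> P i" for i p \<theta>
    by (rule wave_snd_bound[OF wave(5)[OF that] bd[OF that]])
  have "ulipC k J ?S (\<lambda>i x. (?w i x - (snd x, 0)) + (snd x, 0))"
    by (intro ulipC_add wave(3) ulipC_Pair ulipC_linear_map ulipC_const bounded_linear_snd)
  then have w: "ulipC k J ?S ?w" by simp
  have e': "ulipC k J ?S (\<lambda>i x. e i (fst x))"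
    by (rule ulipC_compose[OF e ulipC_linear_map[OF bounded_linear_fst]]) auto
  have Kw: "ulipC k J ?S (\<lambda>i x. K (?w i x))"
  proof (rule ulipC_compose[OF ulipC_single[OF K_ulipC] w])
    fix i x assume "i \<in> J" "x \<in> ?S i"
    then have "\<bar>snd (?w i x)\<bar> \<le> 1 / 2" by (intro wb) auto
    then have "-1/2 \<le> snd (?w i x) \<and> snd (?w i x) \<le> 1/2" by linarith
    then show "?w i x \<in> UNIV \<times> {-1/2..1/2}" by (simp add: mem_Times_iff)
  qed
  have "ulipC k J ?S (\<lambda>i x. (\<lambda>z. r (fst z) (snd z)) (e i (fst x), K (?w i x)))"
    by (rule ulipC_compose[OF ulipC_single[OF r_ulipC] ulipC_Pair[OF e' Kw]]) (use e_in in auto)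
  then have rr: "ulipC k J ?S (\<lambda>i x. r (e i (fst x)) (K (?w i x)))" by simp
  have rb: "ubd J ?S (\<lambda>i x. r (e i (fst x)) (K (?w i x)))"
  proof (rule ubdI)
    fix i x assume ix: "i \<in> J" "x \<in> ?S i"
    then have "r (e i (fst x)) (K (?w i x)) \<in> {0..h}" by (intro r_bounds e_in) auto
    then show "norm (r (e i (fst x)) (K (?w i x))) \<le> h" by simp
  qed
  have "ulipC k J ?S (\<lambda>i x. snd x + - (freq w0 (f i (fst x)) * r (e i (fst x)) (K (?w i x))))"
    by (intro ulipC_add ulipC_linear_map bounded_linear_snd ulipC_linear[OF _ bounded_linear_minus[OF bounded_linear_ident]]
        ulipC_mult wave(1,2) rr rb)
  then have d: "ulipC k J ?S (\<lambda>i x. (fst x, delayed (e i (fst x)) (f i (fst x)) (snd x)))"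
    by (intro ulipC_Pair ulipC_linear_map bounded_linear_fst) (simp add: delayed_def)
  \<comment> \<open>The self-composition caused by the state-dependent delay: the wave, as a
    function of parameter and time, after a map that fixes the parameter and delays the time. Both
    have order \<open>k\<close>, hence so does the result.\<close>
  have "ulipC k J ?S (\<lambda>i x. ?w i (fst x, delayed (e i (fst x)) (f i (fst x)) (snd x)))"
    by (rule ulipC_compose[OF w d]) auto
  then have wd: "ulipC k J ?S (\<lambda>i x. wave w0 lam (f i (fst x)) (delayed (e i (fst x)) (f i (fst x)) (snd x)))" by simp
  have "ulipC k J ?S (\<lambda>i x. (\<lambda>z. Y (fst z) (fst (snd z)) (fst (snd (snd z))) (snd (snd (snd z))))
      (e i (fst x), ?w i x, wave w0 lam (f i (fst x)) (delayed (e i (fst x)) (f i (fst x)) (snd x)), \<epsilon> i))"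
  proof (rule ulipC_compose[OF ulipC_single[OF Y_ulipC]])
    show "ulipC k J ?S (\<lambda>i x. (e i (fst x), ?w i x, wave w0 lam (f i (fst x)) (delayed (e i (fst x)) (f i (fst x)) (snd x)), \<epsilon> i))"
      by (intro ulipC_Pair e' w wd ulipC_const)
    fix i x assume ix: "i \<in> J" "x \<in> ?S i"
    then have p: "fst x \<in> P i" by auto
    have "wave w0 lam (f i (fst x)) \<theta> \<in> strip" for \<theta>
      by (rule wave_in_strip[OF wave(5)[OF ix(1) p] bd[OF ix(1) p]])
    then show "(e i (fst x), ?w i x, wave w0 lam (f i (fst x)) (delayed (e i (fst x)) (f i (fst x)) (snd x)), \<epsilon> i)
        \<in> I \<times> strip \<times> strip \<times> {0..}"
      using e_in[OF ix(1) p] eps[OF ix(1)] by simp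
  qed
  then show ?thesis by (simp add: response_def)
qed

section \<open>The invariant ball, the contraction and its fixed point\<close>

definition forcing_ball :: "nat \<Rightarrow> (real \<Rightarrow> real \<Rightarrow> real \<times> real) set"
  where "forcing_ball k = {f. lipC k 1 (I \<times> UNIV) (\<lambda>x. f (fst x) (snd x)) \<and>
    (\<forall>\<eta>\<in>I. \<forall>\<theta>. norm (f \<eta> \<theta>) \<le> radius \<and> f \<eta> (\<theta> + 1) = f \<eta> \<theta>)}"

lemma forcing_ball_lipschitz:
  assumes "f \<in> forcing_ball k" "\<eta> \<in> I"
  shows "norm (f \<eta> y - f \<eta> x) \<le> norm (y - x)"
proof -
  have "lipC k 1 (I \<times> UNIV) (\<lambda>x. f (fst x) (snd x))"
    using assms by (simp add: forcing_ball_def)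
  then have "lipC 0 1 (I \<times> UNIV) (\<lambda>x. f (fst x) (snd x))" by (rule lipC_lip)
  then have "norm (f (fst (\<eta>, y)) (snd (\<eta>, y)) - f (fst (\<eta>, x)) (snd (\<eta>, x))) \<le> 1 * norm ((\<eta>, y) - (\<eta>, x))"
    unfolding lipC.simps using assms(2) by blast
  then show ?thesis by simp
qed

lemma continuous_if_lipschitz_1:
  fixes g :: "real \<Rightarrow> real \<times> real"
  assumes "\<And>x y. norm (g y - g x) \<le> norm (y - x)"
  shows "continuous_on UNIV g"
  by (rule lipschitz_on_continuous_on[of 1]) (use assms in \<open>auto intro!: lipschitz_onI simp: dist_norm\<close>)

text \<open>The index of the family contains \<open>\<epsilon>\<close> as well as the forcing, so
  the bound \<open>M\<close> is available before \<open>\<epsilon>\<close> is restricted. The bound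
  1 in \<open>forcing_ball\<close> is a normalization, whereas \<open>radius\<close> is dictated by
  the linear equation.\<close>

lemma response_maps_ball:
  "\<exists>\<epsilon>1>0. \<forall>\<epsilon>. 0 \<le> \<epsilon> \<and> \<epsilon> \<le> \<epsilon>1 \<longrightarrow>
    (\<forall>f\<in>forcing_ball k. (\<lambda>\<eta> \<theta>. \<epsilon> *\<^sub>R response \<eta> \<epsilon> (f \<eta>) \<theta>) \<in> forcing_ball k)"
proof -
  define J where "J = {q :: real \<times> (real \<Rightarrow> real \<Rightarrow> real \<times> real). 0 \<le> fst q \<and> snd q \<in> forcing_ball k}"
  have "ulipC k J (\<lambda>_. I \<times> UNIV) (\<lambda>q x. response (fst x) (fst q) (snd q (fst x)) (snd x))"
  proof (rule response_ulipC[where P = "\<lambda>_. I" and e = "\<lambda>_ p. p"])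
    show "ulipC k J (\<lambda>_. I \<times> UNIV) (\<lambda>q x. snd q (fst x) (snd x))"
      unfolding ulipC_def by (rule exI[of _ 1]) (auto simp: J_def forcing_ball_def)
    show "ulipC k J (\<lambda>_. I) (\<lambda>_ p. p)" by (rule ulipC_linear_map[OF bounded_linear_ident])
  qed (use open_I in \<open>auto simp: J_def forcing_ball_def\<close>)
  then obtain M where M: "\<And>\<epsilon> f. 0 \<le> \<epsilon> \<Longrightarrow> f \<in> forcing_ball k \<Longrightarrow>
      lipC k M (I \<times> UNIV) (\<lambda>x. response (fst x) \<epsilon> (f (fst x)) (snd x))"
    unfolding ulipC_def J_def by fastforce
  obtain B where B: "\<And>\<eta> u v \<epsilon>. \<eta> \<in> I \<Longrightarrow> u \<in> strip \<Longrightarrow> v \<in> strip \<Longrightarrow> \<epsilon> \<ge> 0 \<Longrightarrow> norm (Y \<eta> u v \<epsilon>) \<le> B"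
    using Y_bounded by blast
  \<comment> \<open>The first entry brings the derivative bound \<open>M\<close> below 1, the second
    the sup bound \<open>B\<close> below \<open>radius\<close>; \<open>\<bar>M\<bar> + 1\<close> and
    \<open>\<bar>B\<bar> + 1\<close> avoid zero denominators and signs.\<close>
  define \<epsilon>1 where "\<epsilon>1 = min (1 / (\<bar>M\<bar> + 1)) (radius / (\<bar>B\<bar> + 1))"
  have e1: "\<epsilon>1 > 0" using radius_pos by (simp add: \<epsilon>1_def add_nonneg_pos)
  have "(\<lambda>\<eta> \<theta>. \<epsilon> *\<^sub>R response \<eta> \<epsilon> (f \<eta>) \<theta>) \<in> forcing_ball k"
    if eps: "0 \<le> \<epsilon>" "\<epsilon> \<le> \<epsilon>1" and f: "f \<in> forcing_ball k" for \<epsilon> f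
    unfolding forcing_ball_def
  proof (intro CollectI conjI ballI allI)
    have "\<epsilon> * M \<le> 1"
    proof -
      have "\<epsilon> * M \<le> \<epsilon> * (\<bar>M\<bar> + 1)" using eps(1) by (intro mult_left_mono) auto
      also have "\<dots> \<le> (1 / (\<bar>M\<bar> + 1)) * (\<bar>M\<bar> + 1)" using eps(2) by (intro mult_right_mono) (auto simp: \<epsilon>1_def)
      also have "\<dots> = 1" by (simp add: add_nonneg_pos less_imp_neq[THEN not_sym])
      finally show ?thesis .
    qed
    then have le: "\<bar>\<epsilon>\<bar> * M \<le> 1" using eps(1) by simp
    show "lipC k 1 (I \<times> UNIV) (\<lambda>x. \<epsilon> *\<^sub>R response (fst x) \<epsilon> (f (fst x)) (snd x))"
      by (rule lipC_mono[OF lipC_scaleR_const[OF M[OF eps(1) f]] le])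
    fix \<eta> \<theta> assume \<eta>: "\<eta> \<in> I"
    have cont: "continuous_on UNIV (f \<eta>)" by (rule continuous_if_lipschitz_1, rule forcing_ball_lipschitz[OF f \<eta>])
    have bd: "norm (f \<eta> \<theta>) \<le> radius" and per: "f \<eta> (\<theta> + 1) = f \<eta> \<theta>" for \<theta> using f \<eta> by (auto simp: forcing_ball_def)
    have "norm (response \<eta> \<epsilon> (f \<eta>) \<theta>) \<le> B"
      unfolding response_def by (intro B wave_in_strip cont bd \<eta> eps)
    then have "\<epsilon> * norm (response \<eta> \<epsilon> (f \<eta>) \<theta>) \<le> (radius / (\<bar>B\<bar> + 1)) * (\<bar>B\<bar> + 1)"
      using eps radius_pos by (intro mult_mono) (auto simp: \<epsilon>1_def)
    also have "\<dots> = radius" by (simp add: add_nonneg_pos less_imp_neq[THEN not_sym])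
    finally show "norm (\<epsilon> *\<^sub>R response \<eta> \<epsilon> (f \<eta>) \<theta>) \<le> radius" using eps(1) by simp
    show "\<epsilon> *\<^sub>R response \<eta> \<epsilon> (f \<eta>) (\<theta> + 1) = \<epsilon> *\<^sub>R response \<eta> \<epsilon> (f \<eta>) \<theta>"
      using response_periodic[OF cont bd per \<eta> eps(1)] by simp
  qed
  then show ?thesis using e1 by blast
qed

text \<open>
  Here the parameter in \<open>response_ulipC\<close> interpolates between two forcings, so that a uniform Lipschitz
  bound in the parameter becomes a Lipschitz bound in the sup norm; no separate estimate is needed.
\<close>

lemma response_lipschitz:
  "\<exists>M\<ge>0. \<forall>\<epsilon>\<ge>0. \<forall>\<eta>\<in>I. \<forall>g g' d. d > 0 \<and>
      (\<forall>x y. norm (g y - g x) \<le> norm (y - x)) \<and> (\<forall>x y. norm (g' y - g' x) \<le> norm (y - x)) \<and>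
      (\<forall>x. norm (g x) \<le> radius) \<and> (\<forall>x. norm (g' x) \<le> radius) \<and> (\<forall>x. norm (g' x - g x) \<le> d) \<longrightarrow>
      (\<forall>\<theta>. norm (response \<eta> \<epsilon> g' \<theta> - response \<eta> \<epsilon> g \<theta>) \<le> M * d)"
proof -
  define good where "good = (\<lambda>(\<epsilon>, \<eta>, d, g, g'). \<epsilon> \<ge> (0::real) \<and> \<eta> \<in> I \<and> (d::real) > 0 \<and>
      (\<forall>x y :: real. norm (g y - g x) \<le> norm (y - x)) \<and> (\<forall>x y :: real. norm (g' y - g' x) \<le> norm (y - x)) \<and>
      (\<forall>x. norm (g x :: real \<times> real) \<le> radius) \<and> (\<forall>x. norm (g' x) \<le> radius) \<and> (\<forall>x. norm (g' x - g x) \<le> d))"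
  \<comment> \<open>The parameter runs over an interval of length \<open>d\<close> rather than over
    the unit interval: then \<open>F\<close> has Lipschitz constant 2 whatever \<open>d\<close> is,
    and the end points are at distance exactly \<open>d\<close>.\<close>
  define F where "F = (\<lambda>(\<epsilon> :: real, \<eta> :: real, d, g, g') \<tau> (\<theta> :: real). g \<theta> + (\<tau> / d) *\<^sub>R (g' \<theta> - g \<theta> :: real \<times> real))"
  define P where "P = (\<lambda>(\<epsilon> :: real, \<eta> :: real, d :: real, g :: real \<Rightarrow> real \<times> real, g' :: real \<Rightarrow> real \<times> real). {0..d})"
  \<comment> \<open>Order zero is all that a Lipschitz estimate requires, and it permits the closed
    parameter interval.\<close>
  have "ulipC 0 (Collect good) (\<lambda>i. P i \<times> UNIV) (\<lambda>i x. response (fst (snd i)) (fst i) (F i (fst x)) (snd x))"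
  proof (rule response_ulipC[where e = "\<lambda>i _. fst (snd i)" and P = P])
    show "\<forall>i\<in>Collect good. \<forall>p\<in>P i. \<forall>\<theta>. norm (F i p \<theta>) \<le> radius"
    proof (intro ballI allI)
      fix i p \<theta> assume that: "i \<in> Collect good" "p \<in> P i"
      obtain \<epsilon> \<eta> d g g' where i: "i = (\<epsilon>, \<eta>, d, g, g')" by (cases i) auto
      define c where "c = p / d"
      have c: "0 \<le> c" "c \<le> 1" using that by (auto simp: i good_def P_def c_def)
      have "F i p \<theta> = (1 - c) *\<^sub>R g \<theta> + c *\<^sub>R g' \<theta>" by (simp add: F_def i c_def algebra_simps)
      also have "norm \<dots> \<le> (1 - c) * radius + c * radius"
        using that c by (intro norm_triangle_le add_mono) (auto simp: i good_def intro!: mult_left_mono)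
      finally show "norm (F i p \<theta>) \<le> radius" by (simp add: algebra_simps)
    qed
    show "ulipC 0 (Collect good) (\<lambda>i. P i \<times> UNIV) (\<lambda>i x. F i (fst x) (snd x))"
    proof (rule ulipC_0I[of _ _ _ 2])
      fix i x y assume *: "i \<in> Collect good" "x \<in> P i \<times> (UNIV :: real set)" "y \<in> P i \<times> (UNIV :: real set)"
      obtain \<epsilon> \<eta> d g g' where i: "i = (\<epsilon>, \<eta>, d, g, g')" by (cases i) auto
      have good: "d > 0" "\<And>x y. norm (g y - g x) \<le> norm (y - x)" "\<And>x y. norm (g' y - g' x) \<le> norm (y - x)"
        "\<And>x. norm (g' x - g x) \<le> d" using * by (auto simp: i good_def)
      define c where "c = fst y / d"
      have c: "0 \<le> c" "c \<le> 1" using * good(1) by (auto simp: i P_def c_def)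
      have "F i (fst y) (snd y) - F i (fst x) (snd x)
        = (1 - c) *\<^sub>R (g (snd y) - g (snd x)) + c *\<^sub>R (g' (snd y) - g' (snd x))
          + ((fst y - fst x) / d) *\<^sub>R (g' (snd x) - g (snd x))"
        by (simp add: F_def i c_def algebra_simps diff_divide_distrib)
      also have "norm \<dots> \<le> ((1 - c) * norm (snd y - snd x) + c * norm (snd y - snd x)) + (\<bar>fst y - fst x\<bar> / d) * d"
        using c good by (intro norm_triangle_le add_mono) (auto simp: abs_divide intro!: mult_left_mono simp del: real_norm_def times_divide_eq_left)
      also have "\<dots> = norm (snd (y - x)) + norm (fst (y - x))" using good(1) by (simp add: algebra_simps)
      also have "\<dots> \<le> 2 * norm (y - x)"
        using norm_fst_le[of "fst (y - x)" "snd (y - x)"] norm_snd_le[of "snd (y - x)" "fst (y - x)"]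
        unfolding prod.collapse by linarith
      finally show "norm (F i (fst y) (snd y) - F i (fst x) (snd x)) \<le> 2 * norm (y - x)" .
    qed
  qed (auto simp: good_def intro: ulipC_const)
  then obtain M where M: "M \<ge> 0" "\<And>i x y. i \<in> Collect good \<Longrightarrow> x \<in> P i \<times> UNIV \<Longrightarrow> y \<in> P i \<times> UNIV \<Longrightarrow>
      norm (response (fst (snd i)) (fst i) (F i (fst y)) (snd y) - response (fst (snd i)) (fst i) (F i (fst x)) (snd x))
        \<le> M * norm (y - x)"
    by (rule ulipC_0E) (rule that)
  show ?thesis
  proof (intro exI[of _ M] conjI allI impI ballI)
    fix \<epsilon> \<eta> d :: real and g g' :: "real \<Rightarrow> real \<times> real" and \<theta>
    assume a: "0 \<le> \<epsilon>" "\<eta> \<in> I" "d > 0 \<and>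
      (\<forall>x y. norm (g y - g x) \<le> norm (y - x)) \<and> (\<forall>x y. norm (g' y - g' x) \<le> norm (y - x)) \<and>
      (\<forall>x. norm (g x) \<le> radius) \<and> (\<forall>x. norm (g' x) \<le> radius) \<and> (\<forall>x. norm (g' x - g x) \<le> d)"
    let ?i = "(\<epsilon>, \<eta>, d, g, g')"
    have "F ?i 0 = g" "F ?i d = g'" using a by (auto simp: F_def)
    then show "norm (response \<eta> \<epsilon> g' \<theta> - response \<eta> \<epsilon> g \<theta>) \<le> M * d"
      using M(2)[of ?i "(0, \<theta>)" "(d, \<theta>)"] a by (simp add: good_def P_def)
  qed (rule M(1))
qed

text \<open>Picard iteration from zero. Convergence is geometric in the sup norm only; the limit
  inherits its regularity from \<open>ulipC_lim\<close>, since all iterates stay in the ball and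
  thus share the constant 1.\<close>

lemma forcing_fixed_point:
  "\<exists>\<epsilon>0>0. \<forall>\<epsilon>. 0 \<le> \<epsilon> \<and> \<epsilon> < \<epsilon>0 \<longrightarrow>
    (\<exists>f. ulipC k {()} (\<lambda>_. I \<times> UNIV) (\<lambda>_ x. f (fst x) (snd x)) \<and>
      (\<forall>\<eta>\<in>I. \<forall>\<theta>. norm (f \<eta> \<theta>) \<le> radius \<and> f \<eta> (\<theta> + 1) = f \<eta> \<theta> \<and> f \<eta> \<theta> = \<epsilon> *\<^sub>R response \<eta> \<epsilon> (f \<eta>) \<theta>))"
proof -
  obtain \<epsilon>1 where e1: "\<epsilon>1 > 0" "\<And>\<epsilon> f. 0 \<le> \<epsilon> \<Longrightarrow> \<epsilon> \<le> \<epsilon>1 \<Longrightarrow> f \<in> forcing_ball k \<Longrightarrow>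
      (\<lambda>\<eta> \<theta>. \<epsilon> *\<^sub>R response \<eta> \<epsilon> (f \<eta>) \<theta>) \<in> forcing_ball k"
    using response_maps_ball[of k] by blast
  obtain M where M: "M \<ge> 0" "\<And>\<epsilon> \<eta> g g' d \<theta>. \<epsilon> \<ge> 0 \<Longrightarrow> \<eta> \<in> I \<Longrightarrow> d > 0 \<Longrightarrow>
      (\<And>x y. norm (g y - g x) \<le> norm (y - x)) \<Longrightarrow> (\<And>x y. norm (g' y - g' x) \<le> norm (y - x)) \<Longrightarrow>
      (\<And>x. norm (g x) \<le> radius) \<Longrightarrow> (\<And>x. norm (g' x) \<le> radius) \<Longrightarrow> (\<And>x. norm (g' x - g x) \<le> d) \<Longrightarrow>
      norm (response \<eta> \<epsilon> g' \<theta> - response \<eta> \<epsilon> g \<theta>) \<le> M * d"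
    using response_lipschitz by (elim exE conjE) (rule that, assumption, blast)
  \<comment> \<open>The second entry makes the contraction factor \<open>\<epsilon> * M\<close> at
    most 1/2.\<close>
  define \<epsilon>0 where "\<epsilon>0 = min \<epsilon>1 (1 / (2 * (M + 1)))"
  show ?thesis
  proof (intro exI[of _ \<epsilon>0] conjI allI impI)
    show "\<epsilon>0 > 0" using e1(1) M(1) by (simp add: \<epsilon>0_def)
    fix \<epsilon> assume "0 \<le> \<epsilon> \<and> \<epsilon> < \<epsilon>0"
    then have eps: "0 \<le> \<epsilon>" "\<epsilon> \<le> \<epsilon>1" "\<epsilon> \<le> 1 / (2 * (M + 1))" by (auto simp: \<epsilon>0_def)
    have eM: "\<epsilon> * M \<le> 1 / 2"
    proof -
      have "\<epsilon> * (2 * (M + 1)) \<le> 1" using eps(3) M(1) by (simp add: field_simps)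
      then show ?thesis using eps(1) by (simp add: algebra_simps)
    qed
    define f where "f = rec_nat (\<lambda>_ _. 0) (\<lambda>_ f \<eta> \<theta>. \<epsilon> *\<^sub>R response \<eta> \<epsilon> (f \<eta>) \<theta>)"
    have f0: "f 0 = (\<lambda>_ _. 0)" and fSuc: "f (Suc n) = (\<lambda>\<eta> \<theta>. \<epsilon> *\<^sub>R response \<eta> \<epsilon> (f n \<eta>) \<theta>)" for n
      by (simp_all add: f_def)
    have zero: "lipC j 1 S (\<lambda>x. 0 :: real \<times> real)" for j and S :: "(real \<times> real) set"
      by (induction j) (auto intro!: exI[of _ "\<lambda>_ _. 0"])
    have ball: "f n \<in> forcing_ball k" for n
    proof (induction n)
      case 0
      then show ?case using radius_pos zero by (simp add: f0 forcing_ball_def)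
    next
      case (Suc n)
      then show ?case unfolding fSuc by (rule e1(2)[OF eps(1,2)])
    qed
    have lip: "norm (f n \<eta> y - f n \<eta> x) \<le> norm (y - x)" if "\<eta> \<in> I" for n \<eta> x y
      by (rule forcing_ball_lipschitz[OF ball that])
    have bd: "norm (f n \<eta> x) \<le> radius" and per: "f n \<eta> (x + 1) = f n \<eta> x" if "\<eta> \<in> I" for n \<eta> x
      using ball[of n] that by (auto simp: forcing_ball_def)
    \<comment> \<open>As the iteration starts at zero, its first step is at most
      \<open>radius\<close>; each later step is at most half the one before.\<close>
    define d where "d = (\<lambda>n. radius * (1 / 2) ^ n)"
    have d: "d n > 0" "d n - d (Suc n) = d (Suc n)" for n using radius_pos by (simp_all add: d_def)
    have dist1: "norm (f (Suc n) \<eta> \<theta> - f n \<eta> \<theta>) \<le> d n" if \<eta>: "\<eta> \<in> I" for n \<eta> \<theta>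
    proof (induction n arbitrary: \<theta>)
      case 0
      then show ?case using bd[OF \<eta>, of "Suc 0" \<theta>] by (simp add: f0 d_def)
    next
      case (Suc n)
      have "norm (response \<eta> \<epsilon> (f (Suc n) \<eta>) \<theta> - response \<eta> \<epsilon> (f n \<eta>) \<theta>) \<le> M * d n"
        by (rule M(2)[OF eps(1) \<eta> d(1)[of n] lip[OF \<eta>] lip[OF \<eta>] bd[OF \<eta>] bd[OF \<eta>] Suc])
      then have "\<epsilon> * norm (response \<eta> \<epsilon> (f (Suc n) \<eta>) \<theta> - response \<eta> \<epsilon> (f n \<eta>) \<theta>) \<le> \<epsilon> * (M * d n)"
        by (rule mult_left_mono[OF _ eps(1)])
      also have "\<dots> \<le> 1 / 2 * d n" using mult_right_mono[OF eM less_imp_le[OF d(1)[of n]]] by (simp add: mult.assoc)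
      also have "\<dots> = d (Suc n)" by (simp add: d_def)
      also have "\<epsilon> * norm (response \<eta> \<epsilon> (f (Suc n) \<eta>) \<theta> - response \<eta> \<epsilon> (f n \<eta>) \<theta>)
        = norm (f (Suc (Suc n)) \<eta> \<theta> - f (Suc n) \<eta> \<theta>)"
        using eps(1) by (simp add: fSuc[of "Suc n"] fSuc[of n] scaleR_diff_right[symmetric])
      finally show ?case .
    qed
    \<comment> \<open>The subtracted term closes the induction: one more step costs
      \<open>d (n + m)\<close>, exactly the decrease of \<open>2 * d (n + m)\<close>.\<close>
    have dist2: "norm (f (n + m) \<eta> \<theta> - f n \<eta> \<theta>) \<le> 2 * d n - 2 * d (n + m)" if \<eta>: "\<eta> \<in> I" for n m \<eta> \<theta>
    proof (induction m)
      case (Suc m)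
      have "f (n + Suc m) \<eta> \<theta> - f n \<eta> \<theta> = (f (Suc (n + m)) \<eta> \<theta> - f (n + m) \<eta> \<theta>) + (f (n + m) \<eta> \<theta> - f n \<eta> \<theta>)" by simp
      also have "norm \<dots> \<le> d (n + m) + (2 * d n - 2 * d (n + m))" by (rule norm_add_rule_thm[OF dist1[OF \<eta>] Suc])
      finally show ?case using d(2)[of "n + m"] by simp
    qed simp
    have dlim: "d \<longlonglongrightarrow> 0" unfolding d_def by (rule tendsto_mult_right_zero) (rule LIMSEQ_power_zero, simp)
    have "convergent (\<lambda>n. f n \<eta> \<theta>)" if \<eta>: "\<eta> \<in> I" for \<eta> \<theta>
    proof (rule Cauchy_convergent, rule metric_CauchyI)
      fix e :: real assume "e > 0"
      then obtain N where N: "\<And>n. n \<ge> N \<Longrightarrow> norm (d n - 0) < e / 4"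
        using LIMSEQ_D[OF dlim, of "e / 4"] by auto
      have "dist (f n \<eta> \<theta>) (f N \<eta> \<theta>) < e / 2" if "n \<ge> N" for n
        using dist2[OF \<eta>, of N "n - N" \<theta>] that N[of N] d(1)[of n] by (simp add: dist_norm)
      then have "dist (f m \<eta> \<theta>) (f n \<eta> \<theta>) < e" if "m \<ge> N" "n \<ge> N" for m n
        using that dist_triangle_half_l by metis
      then show "\<exists>N. \<forall>m\<ge>N. \<forall>n\<ge>N. dist (f m \<eta> \<theta>) (f n \<eta> \<theta>) < e" by blast
    qed
    then obtain F where F: "\<And>\<eta> \<theta>. \<eta> \<in> I \<Longrightarrow> (\<lambda>n. f n \<eta> \<theta>) \<longlonglongrightarrow> F \<eta> \<theta>"
      unfolding convergent_LIMSEQ_iff by (rule that[of "\<lambda>\<eta> \<theta>. lim (\<lambda>n. f n \<eta> \<theta>)"])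
    have Flip: "norm (F \<eta> y - F \<eta> x) \<le> norm (y - x)" if "\<eta> \<in> I" for \<eta> x y
      by (rule Lim_bounded[OF tendsto_norm[OF tendsto_diff[OF F[OF that] F[OF that]]]]) (use lip[OF that] in blast)
    have Fbd: "norm (F \<eta> x) \<le> radius" if "\<eta> \<in> I" for \<eta> x
      by (rule Lim_bounded[OF tendsto_norm[OF F[OF that]]]) (use bd[OF that] in blast)
    have Fper: "F \<eta> (x + 1) = F \<eta> x" if "\<eta> \<in> I" for \<eta> x
      using F[OF that, of "x + 1"] F[OF that, of x] unfolding per[OF that] by (rule LIMSEQ_unique)
    have Fdist: "norm (F \<eta> x - f n \<eta> x) \<le> 2 * d n" if \<eta>: "\<eta> \<in> I" for \<eta> x n
    proof (rule Lim_bounded[OF tendsto_norm[OF tendsto_diff[OF F[OF \<eta>] tendsto_const]]])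
      show "\<forall>m\<ge>n. norm (f m \<eta> x - f n \<eta> x) \<le> 2 * d n"
      proof (intro allI impI)
        fix m assume "n \<le> m"
        then show "norm (f m \<eta> x - f n \<eta> x) \<le> 2 * d n"
          using dist2[OF \<eta>, of n "m - n" x] d(1)[of m] by simp
      qed
    qed
    \<comment> \<open>The Lipschitz estimate for the response compares functions with Lipschitz
      constant 1 only, so it applies to the limit because of \<open>Flip\<close>;
      \<open>2 * d n\<close> bounds the distance.\<close>
    have Ffix: "F \<eta> \<theta> = \<epsilon> *\<^sub>R response \<eta> \<epsilon> (F \<eta>) \<theta>" if \<eta>: "\<eta> \<in> I" for \<eta> \<theta>
    proof -
      have "(\<lambda>n. response \<eta> \<epsilon> (f n \<eta>) \<theta>) \<longlonglongrightarrow> response \<eta> \<epsilon> (F \<eta>) \<theta>"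
      proof (rule LIM_zero_cancel, rule Lim_null_comparison[OF always_eventually])
        show "\<forall>n. norm (response \<eta> \<epsilon> (f n \<eta>) \<theta> - response \<eta> \<epsilon> (F \<eta>) \<theta>) \<le> M * (2 * d n)"
        proof
          fix n
          have "norm (response \<eta> \<epsilon> (F \<eta>) \<theta> - response \<eta> \<epsilon> (f n \<eta>) \<theta>) \<le> M * (2 * d n)"
            by (rule M(2)[OF eps(1) \<eta> _ lip[OF \<eta>] Flip[OF \<eta>] bd[OF \<eta>] Fbd[OF \<eta>] Fdist[OF \<eta>]]) (simp add: d)
          then show "norm (response \<eta> \<epsilon> (f n \<eta>) \<theta> - response \<eta> \<epsilon> (F \<eta>) \<theta>) \<le> M * (2 * d n)"
            by (simp only: norm_minus_commute)
        qed
        show "(\<lambda>n. M * (2 * d n)) \<longlonglongrightarrow> 0" using dlim by (intro tendsto_mult_right_zero)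
      qed
      then have "(\<lambda>n. \<epsilon> *\<^sub>R response \<eta> \<epsilon> (f n \<eta>) \<theta>) \<longlonglongrightarrow> \<epsilon> *\<^sub>R response \<eta> \<epsilon> (F \<eta>) \<theta>"
        by (intro tendsto_intros)
      moreover have "(\<lambda>n. f (Suc n) \<eta> \<theta>) \<longlonglongrightarrow> F \<eta> \<theta>" using F[OF \<eta>] by (rule LIMSEQ_Suc)
      ultimately show ?thesis unfolding fSuc by (rule LIMSEQ_unique[rotated])
    qed
    have "ulipC k {()} (\<lambda>_. I \<times> UNIV) (\<lambda>_ x. F (fst x) (snd x))"
    proof (rule ulipC_lim[where f = "\<lambda>n _ x. f n (fst x) (snd x)"])
      show "ulipC k (UNIV \<times> {()}) (\<lambda>q. I \<times> UNIV) (\<lambda>q x. f (fst q) (fst x) (snd x))"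
        unfolding ulipC_def using ball by (intro exI[of _ 1]) (auto simp: forcing_ball_def)
      show "k = 0 \<or> (\<forall>i\<in>{()}. open (I \<times> UNIV))" using open_I by (simp add: open_Times)
    qed (use F in auto)
    then show "\<exists>f. ulipC k {()} (\<lambda>_. I \<times> UNIV) (\<lambda>_ x. f (fst x) (snd x)) \<and>
      (\<forall>\<eta>\<in>I. \<forall>\<theta>. norm (f \<eta> \<theta>) \<le> radius \<and> f \<eta> (\<theta> + 1) = f \<eta> \<theta> \<and> f \<eta> \<theta> = \<epsilon> *\<^sub>R response \<eta> \<epsilon> (f \<eta>) \<theta>)"
      using Fbd Fper Ffix by blast
  qed
qed

end

section \<open>Conclusion for the equation with cutoffs\<close>

theorem theorem13:
  fixes X0 K :: "real \<times> real \<Rightarrow> real \<times> real" and \<omega>0 lam0 h :: real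
    and \<phi> :: "real \<Rightarrow> real" and I :: "real set"
    and r :: "real \<Rightarrow> real \<times> real \<Rightarrow> real"
    and Y :: "real \<Rightarrow> real \<times> real \<Rightarrow> real \<times> real \<Rightarrow> real \<Rightarrow> real \<times> real"
    and L :: nat
  assumes "limit_cycle_data X0 \<omega>0 lam0 K"
    and "cutoff \<phi>"
    and "open I" and "is_interval I"
    and "\<forall>\<eta>\<in>I. \<forall>x. r \<eta> x \<in> {0..h}"
    and "smooth_bounded_on (\<lambda>(\<eta>, x). r \<eta> x) (I \<times> UNIV)"
    and "\<forall>\<eta>\<in>I. \<forall>u\<in>strip. \<forall>v\<in>strip. \<forall>\<epsilon>\<ge>0.
           Y \<eta> (u + (1, 0)) v \<epsilon> = Y \<eta> u v \<epsilon> \<and> Y \<eta> u (v + (1, 0)) \<epsilon> = Y \<eta> u v \<epsilon>"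
    and "smooth_bounded_on (\<lambda>(\<eta>, u, v, \<epsilon>). Y \<eta> u v \<epsilon>) (I \<times> strip \<times> strip \<times> {0..})"
    and "L \<ge> 1"
  shows "\<exists>\<epsilon>0>0. \<forall>\<epsilon>. 0 \<le> \<epsilon> \<and> \<epsilon> < \<epsilon>0 \<longrightarrow>
    (\<exists>(\<omega> :: real \<Rightarrow> real) (W :: real \<Rightarrow> real \<Rightarrow> real \<times> real).
      (\<forall>\<eta>\<in>I. \<forall>\<theta>.
         W \<eta> (\<theta> + 1) = W \<eta> \<theta> + (1, 0) \<and>
         W \<eta> differentiable at \<theta> \<and>
         \<omega> \<eta> *\<^sub>R vector_derivative (W \<eta>) (at \<theta>) - (\<omega>0, lam0 * snd (W \<eta> \<theta>)) =
           \<epsilon> *\<^sub>R Y_ext \<phi> (Y \<eta>) (W \<eta> \<theta>) (W \<eta> (\<theta> - \<omega> \<eta> * rho_ext \<phi> K (r \<eta>) (W \<eta> \<theta>))) \<epsilon>) \<and>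
      CLip_on L (\<lambda>(\<eta>, \<theta>). W \<eta> \<theta> - (\<theta>, 0)) (I \<times> UNIV))"
proof -
  \<comment> \<open>Convexity of the domains turns bounded derivatives into Lipschitz and Taylor
    estimates.\<close>
  have conv: "convex I" using assms(4) is_interval_convex by blast
  interpret delay_problem \<omega>0 lam0 h I K r Y
  proof
    show "\<omega>0 > 0" "lam0 < 0" using assms(1) by (simp_all add: limit_cycle_data_def)
    show "ulipC k {()} (\<lambda>_. UNIV \<times> {-1/2..1/2}) (\<lambda>_. K)" for k by (rule limit_cycle_ulipC[OF assms(1)])
    show "K (\<theta> + 1, s) = K (\<theta>, s)" if "s \<in> {-1..1}" for \<theta> s
      using assms(1) that unfolding limit_cycle_data_def by blast
    show "ulipC k {()} (\<lambda>_. I \<times> UNIV) (\<lambda>_ z. r (fst z) (snd z))" for k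
      using Cb_on_imp_ulipC[of "I \<times> UNIV" k "\<lambda>(\<eta>, x). r \<eta> x" "{()}"] assms(6) conv
      by (simp add: smooth_bounded_on_def convex_Times case_prod_beta' del: Cb_on.simps)
    have "convex (I \<times> strip \<times> strip \<times> {0::real..})"
      by (intro convex_Times conv convex_UNIV convex_real_interval)
    then show "ulipC k {()} (\<lambda>_. I \<times> strip \<times> strip \<times> {0..})
        (\<lambda>_ z. Y (fst z) (fst (snd z)) (fst (snd (snd z))) (snd (snd (snd z))))" for k
      using Cb_on_imp_ulipC[of "I \<times> strip \<times> strip \<times> {0..}" k "\<lambda>(\<eta>, u, v, \<epsilon>). Y \<eta> u v \<epsilon>" "{()}"] assms(8)
      by (simp add: smooth_bounded_on_def case_prod_beta' del: Cb_on.simps)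
    have "Cb_on 0 (\<lambda>(\<eta>, u, v, \<epsilon>). Y \<eta> u v \<epsilon>) (I \<times> strip \<times> strip \<times> {0..})"
      using assms(8) unfolding smooth_bounded_on_def by blast
    then obtain M where M: "\<And>z. z \<in> I \<times> strip \<times> strip \<times> {0..} \<Longrightarrow> norm ((\<lambda>(\<eta>, u, v, \<epsilon>). Y \<eta> u v \<epsilon>) z) \<le> M"
      unfolding Cb_on.simps bounded_iff by (metis imageI)
    show "\<exists>M. \<forall>\<eta>\<in>I. \<forall>u\<in>strip. \<forall>v\<in>strip. \<forall>\<epsilon>\<ge>0. norm (Y \<eta> u v \<epsilon>) \<le> M"
      using M[of "(_, _, _, _)"] by (intro exI[of _ M] ballI allI impI) simp
  qed (use assms(3,5,7) in blast)+
  obtain \<epsilon>0 where e0: "\<epsilon>0 > 0" and fp: "\<forall>\<epsilon>. 0 \<le> \<epsilon> \<and> \<epsilon> < \<epsilon>0 \<longrightarrow>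
    (\<exists>f. ulipC L {()} (\<lambda>_. I \<times> UNIV) (\<lambda>_ x. f (fst x) (snd x)) \<and>
      (\<forall>\<eta>\<in>I. \<forall>\<theta>. norm (f \<eta> \<theta>) \<le> radius \<and> f \<eta> (\<theta> + 1) = f \<eta> \<theta> \<and> f \<eta> \<theta> = \<epsilon> *\<^sub>R response \<eta> \<epsilon> (f \<eta>) \<theta>))"
    using forcing_fixed_point[of L] by (elim exE conjE) (rule that)
  show ?thesis
  proof (intro exI[of _ \<epsilon>0] conjI allI impI e0)
    fix \<epsilon> assume eps: "0 \<le> \<epsilon> \<and> \<epsilon> < \<epsilon>0"
    from fp[rule_format, OF eps] obtain f where f: "ulipC L {()} (\<lambda>_. I \<times> UNIV) (\<lambda>_ x. f (fst x) (snd x))"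
      and f': "\<forall>\<eta>\<in>I. \<forall>\<theta>. norm (f \<eta> \<theta>) \<le> radius \<and> f \<eta> (\<theta> + 1) = f \<eta> \<theta> \<and> f \<eta> \<theta> = \<epsilon> *\<^sub>R response \<eta> \<epsilon> (f \<eta>) \<theta>"
      by (elim exE conjE) (rule that)
    have bd: "norm (f \<eta> \<theta>) \<le> radius" and per: "f \<eta> (\<theta> + 1) = f \<eta> \<theta>"
      and fixp: "f \<eta> \<theta> = \<epsilon> *\<^sub>R response \<eta> \<epsilon> (f \<eta>) \<theta>" if "\<eta> \<in> I" for \<eta> \<theta>
      using f' that by blast+
    have opn: "L = 0 \<or> (\<forall>i\<in>{()}. open I)" using assms(3) by simp
    have bdd: "\<forall>i\<in>{()}. \<forall>\<eta>\<in>I. \<forall>\<theta>. norm (f \<eta> \<theta>) \<le> radius" using bd by blast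
    note wv = wave_ulipC[where f = "\<lambda>_ :: unit. f" and P = "\<lambda>_. I", OF w0 lam f bdd opn]
    define W where "W = (\<lambda>\<eta>. wave \<omega>0 lam0 (f \<eta>))"
    define \<omega> where "\<omega> = (\<lambda>\<eta>. freq \<omega>0 (f \<eta>))"
    have sol: "W \<eta> (\<theta> + 1) = W \<eta> \<theta> + (1, 0) \<and> W \<eta> differentiable at \<theta> \<and>
         \<omega> \<eta> *\<^sub>R vector_derivative (W \<eta>) (at \<theta>) - (\<omega>0, lam0 * snd (W \<eta> \<theta>)) =
           \<epsilon> *\<^sub>R Y_ext \<phi> (Y \<eta>) (W \<eta> \<theta>) (W \<eta> (\<theta> - \<omega> \<eta> * rho_ext \<phi> K (r \<eta>) (W \<eta> \<theta>))) \<epsilon>"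
      if \<eta>: "\<eta> \<in> I" for \<eta> \<theta>
    proof -
      have cont: "continuous_on UNIV (f \<eta>)" by (rule wv(5)[OF _ \<eta>]) simp
      have pos: "\<omega> \<eta> > 0" using freq_bounds(1)[OF w0 cont bd[OF \<eta>]] w0 by (simp add: \<omega>_def)
      \<comment> \<open>This holds at every \<open>z\<close>, hence at the current and at the
        delayed point, so that \<open>rho_ext\<close> and \<open>Y_ext\<close> reduce to the delay
        and the perturbation used in \<open>response\<close>.\<close>
      have \<phi>1: "\<phi> (snd (W \<eta> z)) = 1" for z
        using wave_snd_bound[OF cont bd[OF \<eta>], of z] assms(2) by (simp add: cutoff_def W_def)
      have der: "(W \<eta> has_vector_derivative inverse (\<omega> \<eta>) *\<^sub>R (f \<eta> \<theta> + (\<omega>0, lam0 * snd (W \<eta> \<theta>)))) (at \<theta>)"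
        unfolding W_def \<omega>_def
        by (rule wave_has_vector_derivative[OF cont per[OF \<eta>] pos[unfolded \<omega>_def] lam])
      have "\<omega> \<eta> *\<^sub>R vector_derivative (W \<eta>) (at \<theta>) - (\<omega>0, lam0 * snd (W \<eta> \<theta>)) = f \<eta> \<theta>"
        using pos by (simp add: vector_derivative_at[OF der])
      also have "\<dots> = \<epsilon> *\<^sub>R Y_ext \<phi> (Y \<eta>) (W \<eta> \<theta>) (W \<eta> (\<theta> - \<omega> \<eta> * rho_ext \<phi> K (r \<eta>) (W \<eta> \<theta>))) \<epsilon>"
        by (subst fixp[OF \<eta>]) (simp add: response_def delayed_def Y_ext_def rho_ext_def \<phi>1[unfolded W_def] W_def \<omega>_def)
      finally show ?thesis
        using wave_add_1[of "f \<eta>", OF per[OF \<eta>], of \<omega>0 lam0 \<theta>] differentiableI_vector[OF der] by (simp add: W_def)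
    qed
    have "CLip_on L (\<lambda>x. W (fst x) (snd x) - (snd x, 0)) (I \<times> UNIV)"
    proof -
      obtain M where "lipC L M (I \<times> UNIV) (\<lambda>x. W (fst x) (snd x) - (snd x, 0))"
        using wv(3) unfolding ulipC_def W_def by auto
      moreover have "bounded ((\<lambda>x. W (fst x) (snd x) - (snd x, 0)) ` (I \<times> UNIV))"
        using wv(4) unfolding ubd_def W_def bounded_iff by auto
      ultimately show ?thesis by (rule lipC_imp_CLip_on)
    qed
    then have "CLip_on L (\<lambda>(\<eta>, \<theta>). W \<eta> \<theta> - (\<theta>, 0)) (I \<times> UNIV)" by (simp only: case_prod_beta')
    with sol show "\<exists>\<omega> W. (\<forall>\<eta>\<in>I. \<forall>\<theta>. W \<eta> (\<theta> + 1) = W \<eta> \<theta> + (1, 0) \<and> W \<eta> differentiable at \<theta> \<and>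
         \<omega> \<eta> *\<^sub>R vector_derivative (W \<eta>) (at \<theta>) - (\<omega>0, lam0 * snd (W \<eta> \<theta>)) =
           \<epsilon> *\<^sub>R Y_ext \<phi> (Y \<eta>) (W \<eta> \<theta>) (W \<eta> (\<theta> - \<omega> \<eta> * rho_ext \<phi> K (r \<eta>) (W \<eta> \<theta>))) \<epsilon>) \<and>
      CLip_on L (\<lambda>(\<eta>, \<theta>). W \<eta> \<theta> - (\<theta>, 0)) (I \<times> UNIV)"
      by (intro exI[of _ \<omega>] exI[of _ W]) blast
  qed
qed

end
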